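(* Let $\nu$ satisfy (H0) and (H1b), let $A$ be the generator of a Feller semigroup on $C_\infty(\mathbb R^d)$ with $C_\infty^\infty(\mathbb R^d)\subset Dom(A)$, and assume that (H2) holds. Let $A_\lambda=\lambda A(\lambda-A)^{-1}$, $\lambda>0$, be the Yosida approximation of $A$. Fix $g\in C_\infty([a,b]\times\mathbb R^d)$ and $\phi_a\in Dom(A)$. Then for each $t\in[a,b]$, as $\lambda\to\infty$, $$E_{(\nu)}(A_\lambda\phi_aI^{(\nu)}_{a+}\mathbf 1)(t,x):=\sum_{n=0}^\infty A_\lambda^n\phi_a(x)\,\big(I^{(\nu),n}_{a+}\mathbf 1\big)(t)\ \to\ \mathbf E\left[\phi_a\big(X^{x,A}(\tau_a^{(\nu)}(t))\big)\right]$$ and $$\sum_{n=0}^\infty\big((I^{(\nu)}_{a+}A_\lambda)^nI^{(\nu)}_{a+}g\big)(t,x)\ \to\ \mathbf E\left[\int_0^{\tau_a^{(\nu)}(t)}e^{As}g(X_+^{t,(\nu)}(s),\cdot)(x)\,ds\right],$$ both uniformly in $x\in\mathbb R^d$.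
   Context: Fix real numbers $a<b$ and $d\in\mathbb N$. $B(E)$ is the space of bounded Borel functions on $E$, $C_\infty(E)$ the continuous functions vanishing at infinity, with the sup norm. $C_\infty^\infty(\mathbb R^d)$: smooth functions all of whose derivatives lie in $C_\infty(\mathbb R^d)$. $\mathbf 1$ is the constant function 1. Assumptions on $\nu:\mathbb R\times(0,\infty)\to[0,\infty)$: (H0) $\nu(t,r)$ is continuous in both variables and continuously differentiable in $t$; $\sup_t\int_0^\infty\min\{1,r\}\nu(t,r)dr<\infty$, $\sup_t\int_0^\infty\min\{1,r\}|\partial_t\nu(t,r)|dr<\infty$, and $\lim_{\delta\to0}\sup_t\int_{0<r\le\delta}r\nu(t,r)dr=0$. (H1b) There are $C>0$ and $\beta\in(0,1)$ with $\nu(t,r)\ge Cr^{-1-\beta}$. Under (H0) it is known that the operator $-D^{(\nu)}_+f(t)=\int_0^\infty(f(t-r)-f(t))\nu(t,r)dr$ generates a Feller semigroup on $C_\infty((-\infty,b])$ with core $\{f\in C^1_\infty((-\infty,b]):-D_+^{(\nu)}f\in C_\infty((-\infty,b])\}$; $X_+^{t,(\nu)}$ is the corresponding (non-increasing) Feller process started at $t$, with transition probabilities $p_s^{(\nu)+}(t,\cdot)$, and $\tau_a^{(\nu)}(t)=\inf\{s\ge0:X_+^{t,(\nu)}(s)\le a\}$. $(I^{(\nu)}_{a+}f)(t)=\int_{(a,t]}f(y)\left(\int_0^\infty p_s^{(\nu)+}(t,dy)ds\right)$ for $t>a$, and $0$ for $t=a$ ($f\in B([a,b])$); $I^{(\nu),n}_{a+}$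 is its $n$-fold iterate, $I^{(\nu),0}_{a+}$ the identity. On functions of $(t,x)$, $I^{(\nu)}_{a+}$ acts on $t$ and $A_\lambda$ (a bounded operator on $C_\infty(\mathbb R^d)$) acts on $x$. $X^{x,A}$ is the Feller process on $\mathbb R^d$ generated by $A$ started at $x$, taken independent of $X_+^{t,(\nu)}$; $p_s^A(x,\cdot)$ is the law of $X^{x,A}(s)$ and $e^{As}$ its semigroup. (H2) For every $t\in[a,b]$, $x\in\mathbb R^d$, $s>0$, the measures $p_s^{(\nu)+}(t,\cdot)$ and $p_s^A(x,\cdot)$ are absolutely continuous with respect to Lebesgue measure. *)

theory Defs
  imports "HOL-Probability.Probability"
begin

section \<open>Spaces of functions vanishing at infinity\<close>

text \<open>A function on \<open>E\<close> is represented by its extension by \<open>0\<close> to the whole type, so that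
  equality of elements of \<open>C_inf E\<close> is plain equality of functions.\<close>

definition C_inf :: "'a::topological_space set \<Rightarrow> ('a \<Rightarrow> real) set" where
  "C_inf E = {f. continuous_on E f \<and>
     (\<forall>e>0. \<exists>K. compact K \<and> K \<subseteq> E \<and> (\<forall>x\<in>E - K. \<bar>f x\<bar> < e)) \<and>
     (\<forall>x. x \<notin> E \<longrightarrow> f x = 0)}"

definition sup_norm :: "'a set \<Rightarrow> ('a \<Rightarrow> real) \<Rightarrow> real" where
  "sup_norm E f = (SUP x\<in>E. \<bar>f x\<bar>)"

definition partial_deriv :: "'d \<Rightarrow> (real ^ 'd \<Rightarrow> real) \<Rightarrow> real ^ 'd \<Rightarrow> real" where
  "partial_deriv i f x = frechet_derivative f (at x) (axis i 1)"

definition C_inf_smooth :: "(real ^ 'd \<Rightarrow> real) set" where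
  "C_inf_smooth = {f. \<forall>is. foldr partial_deriv is f differentiable_on UNIV \<and>
     foldr partial_deriv is f \<in> C_inf UNIV}"

text \<open>The one-sided derivative is used at the end point \<open>b\<close>.\<close>

definition C1_inf :: "real \<Rightarrow> (real \<Rightarrow> real) set" where
  "C1_inf b = {f \<in> C_inf {..b}. \<exists>f'\<in>C_inf {..b}.
     \<forall>t\<le>b. (f has_real_derivative f' t) (at t within {..b})}"


section \<open>Feller semigroups and their generators\<close>

type_synonym 'a semigroup = "real \<Rightarrow> ('a \<Rightarrow> real) \<Rightarrow> 'a \<Rightarrow> real"

text \<open>Positive contractions, not assumed conservative.\<close>

definition feller_semigroup :: "'a::topological_space set \<Rightarrow> 'a semigroup \<Rightarrow> bool" where
  "feller_semigroup E T \<longleftrightarrow>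
     (\<forall>s\<ge>0. \<forall>f\<in>C_inf E. T s f \<in> C_inf E) \<and>
     (\<forall>s\<ge>0. \<forall>f\<in>C_inf E. \<forall>g\<in>C_inf E. \<forall>c. T s (\<lambda>x. c * f x + g x) = (\<lambda>x. c * T s f x + T s g x)) \<and>
     (\<forall>f\<in>C_inf E. T 0 f = f) \<and>
     (\<forall>s\<ge>0. \<forall>u\<ge>0. \<forall>f\<in>C_inf E. T (s + u) f = T s (T u f)) \<and>
     (\<forall>s\<ge>0. \<forall>f\<in>C_inf E. (\<forall>x\<in>E. 0 \<le> f x) \<longrightarrow> (\<forall>x\<in>E. 0 \<le> T s f x)) \<and>
     (\<forall>s\<ge>0. \<forall>f\<in>C_inf E. sup_norm E (T s f) \<le> sup_norm E f) \<and>
     (\<forall>f\<in>C_inf E. uniform_limit E (\<lambda>s. T s f) f (at_right 0))"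

definition generator_graph ::
  "'a::topological_space set \<Rightarrow> 'a semigroup \<Rightarrow> (('a \<Rightarrow> real) \<times> ('a \<Rightarrow> real)) set" where
  "generator_graph E T = {(f, h). f \<in> C_inf E \<and> h \<in> C_inf E \<and>
     uniform_limit E (\<lambda>s x. (T s f x - f x) / s) h (at_right 0)}"

definition gen_dom :: "'a::topological_space set \<Rightarrow> 'a semigroup \<Rightarrow> ('a \<Rightarrow> real) set" where
  "gen_dom E T = Domain (generator_graph E T)"

definition gen :: "'a::topological_space set \<Rightarrow> 'a semigroup \<Rightarrow> ('a \<Rightarrow> real) \<Rightarrow> 'a \<Rightarrow> real" where
  "gen E T f = (THE h. (f, h) \<in> generator_graph E T)"

text \<open>\<open>L\<close> on \<open>D\<close> is a restriction of the generator of \<open>T\<close>, and the generator is its closure.\<close>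

definition generates_with_core ::
  "'a::topological_space set \<Rightarrow> (('a \<Rightarrow> real) \<Rightarrow> 'a \<Rightarrow> real) \<Rightarrow> ('a \<Rightarrow> real) set \<Rightarrow> 'a semigroup \<Rightarrow> bool" where
  "generates_with_core E L D T \<longleftrightarrow>
     (\<forall>f\<in>D. (f, L f) \<in> generator_graph E T) \<and>
     (\<forall>(f, h)\<in>generator_graph E T. \<exists>F :: nat \<Rightarrow> 'a \<Rightarrow> real. (\<forall>n. F n \<in> D) \<and>
        uniform_limit E F f sequentially \<and>
        uniform_limit E (\<lambda>n. L (F n)) h sequentially)"

definition resolvent ::
  "'a::topological_space set \<Rightarrow> 'a semigroup \<Rightarrow> real \<Rightarrow> ('a \<Rightarrow> real) \<Rightarrow> 'a \<Rightarrow> real" where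
  "resolvent E T lam = inv_into (gen_dom E T) (\<lambda>u x. lam * u x - gen E T u x)"

definition yosida ::
  "'a::topological_space set \<Rightarrow> 'a semigroup \<Rightarrow> real \<Rightarrow> ('a \<Rightarrow> real) \<Rightarrow> 'a \<Rightarrow> real" where
  "yosida E T lam f x = lam * gen E T (resolvent E T lam f) x"


section \<open>Feller processes\<close>

text \<open>The state \<open>None\<close> is the cemetery, i.e. the point at infinity of the one-point
  compactification of \<open>E\<close>; functions on \<open>E\<close> are extended to it by \<open>0\<close>.\<close>

definition option_borel :: "'a::topological_space option measure" where
  "option_borel = sigma UNIV {Some ` B | B. B \<in> sets borel}"

abbreviation extend0 :: "('a \<Rightarrow> real) \<Rightarrow> 'a option \<Rightarrow> real" where
  "extend0 f \<equiv> case_option 0 f"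

definition path_sigma ::
  "'w measure \<Rightarrow> (real \<Rightarrow> 'w \<Rightarrow> 'a::topological_space option) \<Rightarrow> real set \<Rightarrow> 'w measure" where
  "path_sigma M X J =
     vimage_algebra (space M) (\<lambda>\<omega>. \<lambda>u\<in>J. X u \<omega>) (PiM J (\<lambda>_. option_borel))"

definition cadlag :: "'a::topological_space set \<Rightarrow> (real \<Rightarrow> 'a option) \<Rightarrow> bool" where
  "cadlag E w \<longleftrightarrow>
     (\<forall>s\<ge>0. limitin (Alexandroff_compactification (top_of_set E)) w (w s) (at_right s)) \<and>
     (\<forall>s>0. \<exists>l. limitin (Alexandroff_compactification (top_of_set E)) w l (at_left s))"

definition feller_process ::
  "'w measure \<Rightarrow> 'a::topological_space set \<Rightarrow> 'a semigroup \<Rightarrow> 'a \<Rightarrow> (real \<Rightarrow> 'w \<Rightarrow> 'a option) \<Rightarrow> bool" where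
  "feller_process M E T x X \<longleftrightarrow>
     (\<forall>s\<ge>0. X s \<in> measurable M option_borel) \<and>
     (\<forall>s\<ge>0. \<forall>\<omega>\<in>space M. X s \<omega> \<in> insert None (Some ` E)) \<and>
     (\<forall>\<omega>\<in>space M. cadlag E (\<lambda>s. X s \<omega>)) \<and>
     (AE \<omega> in M. X 0 \<omega> = Some x) \<and>
     (\<forall>s\<ge>0. \<forall>u\<ge>s. \<forall>f\<in>C_inf E. AE \<omega> in M.
        real_cond_exp M (path_sigma M X {0..s}) (\<lambda>\<omega>. extend0 f (X u \<omega>)) \<omega>
          = extend0 (T (u - s) f) (X s \<omega>))"

text \<open>For processes that are never killed.\<close>

abbreviation lift_process :: "(real \<Rightarrow> 'w \<Rightarrow> 'a) \<Rightarrow> real \<Rightarrow> 'w \<Rightarrow> 'a option" where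
  "lift_process X \<equiv> \<lambda>s \<omega>. Some (X s \<omega>)"

definition indep_processes :: "'w measure \<Rightarrow> (real \<Rightarrow> 'w \<Rightarrow> 'a::topological_space option) \<Rightarrow>
    (real \<Rightarrow> 'w \<Rightarrow> 'b::topological_space option) \<Rightarrow> bool" where
  "indep_processes M X Y \<longleftrightarrow>
     prob_space.indep_set M (sets (path_sigma M X {0..})) (sets (path_sigma M Y {0..}))"

text \<open>The law of \<open>Y\<^sub>s\<close> on the state space without cemetery (of mass less than \<open>1\<close> if
  \<open>Y\<close> has been killed with positive probability).\<close>

definition state_law ::
  "'w measure \<Rightarrow> (real \<Rightarrow> 'w \<Rightarrow> 'a::topological_space option) \<Rightarrow> real \<Rightarrow> 'a measure" where
  "state_law M Y s =
     distr (restrict_space M {\<omega> \<in> space M. Y s \<omega> \<noteq> None}) borel (\<lambda>\<omega>. the (Y s \<omega>))"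

definition hitting_time :: "real \<Rightarrow> (real \<Rightarrow> 'w \<Rightarrow> real) \<Rightarrow> 'w \<Rightarrow> ereal" where
  "hitting_time a X \<omega> = Inf {ereal s | s. 0 \<le> s \<and> X s \<omega> \<le> a}"

text \<open>The process is in the cemetery at time \<open>\<infinity>\<close>; \<open>Inf {} = \<infinity>\<close> in \<open>hitting_time\<close>.\<close>

definition at_time :: "(real \<Rightarrow> 'w \<Rightarrow> 'a option) \<Rightarrow> ('w \<Rightarrow> ereal) \<Rightarrow> 'w \<Rightarrow> 'a option" where
  "at_time Y \<tau> \<omega> = (if \<tau> \<omega> = \<infinity> then None else Y (real_of_ereal (\<tau> \<omega>)) \<omega>)"


section \<open>The kernel and the operators it defines\<close>

definition H0 :: "(real \<Rightarrow> real \<Rightarrow> real) \<Rightarrow> bool" where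
  "H0 \<nu> \<longleftrightarrow>
     continuous_on (UNIV \<times> {0<..}) (\<lambda>(t, r). \<nu> t r) \<and>
     (\<forall>r>0. (\<lambda>t. \<nu> t r) differentiable_on UNIV \<and> continuous_on UNIV (deriv (\<lambda>t. \<nu> t r))) \<and>
     (SUP t. \<integral>\<^sup>+r\<in>{0<..}. ennreal (min 1 r * \<nu> t r) \<partial>lborel) < \<infinity> \<and>
     (SUP t. \<integral>\<^sup>+r\<in>{0<..}. ennreal (min 1 r * \<bar>deriv (\<lambda>t. \<nu> t r) t\<bar>) \<partial>lborel) < \<infinity> \<and>
     ((\<lambda>\<delta>. SUP t. \<integral>\<^sup>+r\<in>{0<..\<delta>}. ennreal (r * \<nu> t r) \<partial>lborel) \<longlongrightarrow> 0) (at_right 0)"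

definition H1b :: "(real \<Rightarrow> real \<Rightarrow> real) \<Rightarrow> bool" where
  "H1b \<nu> \<longleftrightarrow> (\<exists>C>0. \<exists>\<beta>\<in>{0<..<1}. \<forall>t. \<forall>r>0. \<nu> t r \<ge> C * r powr (- 1 - \<beta>))"

text \<open>\<open>- D\<^sub>+\<close>, with values in functions on \<open>{..b}\<close> (extended by \<open>0\<close>).\<close>

definition minus_D :: "real \<Rightarrow> (real \<Rightarrow> real \<Rightarrow> real) \<Rightarrow> (real \<Rightarrow> real) \<Rightarrow> real \<Rightarrow> real" where
  "minus_D b \<nu> f t = (if t \<le> b then LINT r:{0<..}|lborel. (f (t - r) - f t) * \<nu> t r else 0)"

definition D_core :: "real \<Rightarrow> (real \<Rightarrow> real \<Rightarrow> real) \<Rightarrow> (real \<Rightarrow> real) set" where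
  "D_core b \<nu> = {f \<in> C1_inf b. minus_D b \<nu> f \<in> C_inf {..b}}"

text \<open>In the following \<open>p s t\<close> is the transition probability from \<open>t\<close> in time \<open>s\<close>.\<close>

definition potential_measure :: "(real \<Rightarrow> real \<Rightarrow> real measure) \<Rightarrow> real \<Rightarrow> real measure" where
  "potential_measure p t =
     measure_of UNIV (sets borel) (\<lambda>B. \<integral>\<^sup>+s\<in>{0..}. emeasure (p s t) B \<partial>lborel)"

definition frac_int ::
  "(real \<Rightarrow> real \<Rightarrow> real measure) \<Rightarrow> real \<Rightarrow> (real \<Rightarrow> real) \<Rightarrow> real \<Rightarrow> real" where
  "frac_int p a f t = (if t > a then LINT y:{a<..t}|potential_measure p t. f y else 0)"

definition act_fst :: "((real \<Rightarrow> real) \<Rightarrow> real \<Rightarrow> real) \<Rightarrow> (real \<times> 'x \<Rightarrow> real) \<Rightarrow> real \<times> 'x \<Rightarrow> real" where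
  "act_fst I F = (\<lambda>(t, x). I (\<lambda>s. F (s, x)) t)"

definition act_snd :: "(('x \<Rightarrow> real) \<Rightarrow> 'x \<Rightarrow> real) \<Rightarrow> (real \<times> 'x \<Rightarrow> real) \<Rightarrow> real \<times> 'x \<Rightarrow> real" where
  "act_snd B F = (\<lambda>(t, x). B (\<lambda>y. F (t, y)) x)"

end

theory Submission
  imports Defs
begin

text \<open>Let \<open>\<tau>\<close> be the time at which the decreasing process started at \<open>t\<close> enters \<open>(-\<infinity>, a]\<close>.
  By the Markov property, the iterates of the potential operator are time-weighted potentials of
  the process killed at \<open>\<tau>\<close>: \<open>(I\<^sup>n\<^sup>+\<^sup>1 f)(t) = \<integral> s\<^sup>n/n! E[f(X\<^sub>s); s < \<tau>] ds\<close>. Hence the two series are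
  \<open>E[e\<^bsup>\<tau>A\<^esup> \<phi>]\<close> and \<open>E \<integral>\<^bsub>s<\<tau>\<^esub> e\<^bsup>sA\<^esup> g(X\<^sub>s, \<cdot>) ds\<close>, where \<open>A = A\<^sub>\<lambda>\<close>. The interchange of sums and integrals needs
  \<open>E e\<^bsup>K\<tau>\<^esup> < \<infinity>\<close> for all \<open>K\<close>. This follows from the Lyapunov functions \<open>u(t) = e\<^bsup>\<mu>t\<^esup>\<close>: the lower bound on \<open>\<nu>\<close> gives
  \<open>- D\<^sub>+ u \<le> - c \<mu>\<^sup>\<beta> u\<close>, so that \<open>P(X\<^sub>s > a)\<close> decays in \<open>s\<close> faster than any exponential. Finally
  \<open>\<parallel>e\<^bsup>sA\<^esup> f - S\<^sub>s f\<parallel> \<le> \<epsilon> (1 + s)\<close> for large \<open>\<lambda>\<close>, uniformly in \<open>s\<close> and for \<open>f\<close> in a compact set of functions,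
  by the proof of the Hille--Yosida theorem; the functions \<open>g(r, \<cdot>)\<close> form such a compact set.\<close>

section \<open>Contraction semigroups and the Yosida approximation\<close>

text \<open>The Yosida operators have norm up to \<open>2 * lam\<close>, and \<open>lam\<close>
  tends to infinity: this is why exponential moments of every order are required, although the
  limits involve contractions only. For the same reason the error estimate must not see the operator
  norm. Written as \<open>lam *\<^sub>R (P - 1)\<close> with a contraction \<open>P\<close>, the
  Yosida operator admits a Gronwall bound that is linear in time and free of \<open>lam\<close>;
  linear growth is harmless because \<tau>, though unbounded, is integrable. Monotone paths keep the
  killing elementary: being above \<open>a\<close> at time s means not having been killed before, so
  the killed semigroup is a restriction of the one-dimensional laws and its semigroup property is
  Chapman-Kolmogorov. Processes from different starting points are given without any relation
  between them, so measurability of the transition kernel has to be recovered from the semigroup. In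
  the second series an operator in x meets a function that has been integrated in t; exchanging the
  two calls for a Banach space of functions of x.\<close>

text \<open>At a point \<open>s\<^sub>1\<close> where \<open>\<parallel>D s\<parallel> - \<parallel>D 0\<parallel> - s c\<close> attains a positive maximum, the growth of \<open>e\<^bsup>lam s\<^esup> D s\<close>
  on \<open>[0, s\<^sub>1]\<close> would be too small.\<close>

lemma norm_le_gronwall:
  fixes D :: "real \<Rightarrow> 'b::real_normed_vector" and P :: "'b \<Rightarrow> 'b"
  assumes lam: "0 \<le> lam" and P: "\<And>z. norm (P z) \<le> norm z"
    and cont: "continuous_on {0..} D"
    and der: "\<And>s. 0 < s \<Longrightarrow> (D has_vector_derivative lam *\<^sub>R (P (D s) - D s) + r s) (at s)"
    and r: "\<And>s. 0 < s \<Longrightarrow> s \<le> u \<Longrightarrow> norm (r s) \<le> c"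
    and u: "0 \<le> u"
  shows "norm (D u) \<le> norm (D 0) + u * c"
proof (rule ccontr)
  assume neg: "\<not> ?thesis"
  define k where "k s = norm (D s) - norm (D 0) - s * c" for s
  have "continuous_on {0..u} k"
    unfolding k_def by (intro continuous_intros continuous_on_subset[OF cont]) auto
  from continuous_attains_sup[OF compact_Icc _ this]
  obtain s1 where s1: "s1 \<in> {0..u}" "\<And>s. s \<in> {0..u} \<Longrightarrow> k s \<le> k s1"
    using u by (auto simp: Bex_def)
  define N where "N = k s1"
  have N: "0 < N" using s1(2)[of u] neg u by (auto simp: N_def k_def)
  have "s1 \<noteq> 0" using N by (auto simp: N_def k_def)
  with s1 have s1': "0 < s1" "s1 \<le> u" by auto
  have "norm (exp (lam * s1) *\<^sub>R D s1 - exp (lam * 0) *\<^sub>R D 0)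
      \<le> exp (lam * s1) * (norm (D 0) + s1 * c + N) - exp (lam * 0) * (norm (D 0) + 0 * c + N)"
  proof (rule differentiable_bound_general[OF s1'(1),
      where f' = "\<lambda>s. exp (lam * s) *\<^sub>R (lam *\<^sub>R P (D s) + r s)"
        and \<phi>' = "\<lambda>s. exp (lam * s) * (lam * (norm (D 0) + s * c + N) + c)"])
    show "continuous_on {0..s1} (\<lambda>s. exp (lam * s) *\<^sub>R D s)"
      by (intro continuous_intros continuous_on_subset[OF cont]) auto
    show "continuous_on {0..s1} (\<lambda>s. exp (lam * s) * (norm (D 0) + s * c + N))"
      by (intro continuous_intros)
  next
    fix s assume s: "0 < s" "s < s1"
    show "((\<lambda>s. exp (lam * s) *\<^sub>R D s) has_vector_derivative exp (lam * s) *\<^sub>R (lam *\<^sub>R P (D s) + r s)) (at s)"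
      by (rule has_vector_derivative_eq_rhs, rule has_vector_derivative_scaleR, (rule derivative_intros)+, rule der[OF s(1)])
        (simp add: algebra_simps)
    show "((\<lambda>s. exp (lam * s) * (norm (D 0) + s * c + N)) has_vector_derivative
        exp (lam * s) * (lam * (norm (D 0) + s * c + N) + c)) (at s)"
      unfolding has_real_derivative_iff_has_vector_derivative[symmetric]
      by (auto intro!: derivative_eq_intros simp: algebra_simps)
    have "norm (D s) \<le> norm (D 0) + s * c + N"
      using s1(2)[of s] s s1' by (auto simp: N_def k_def)
    then have "norm (lam *\<^sub>R P (D s) + r s) \<le> lam * (norm (D 0) + s * c + N) + c"
      using P[of "D s"] r[of s] s s1' lam
      by (intro norm_triangle_le add_mono) (auto intro!: mult_left_mono)
    then show "norm (exp (lam * s) *\<^sub>R (lam *\<^sub>R P (D s) + r s))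
        \<le> exp (lam * s) * (lam * (norm (D 0) + s * c + N) + c)"
      by simp
  qed
  moreover have "norm (exp (lam * s1) *\<^sub>R D s1) - norm (D 0) \<le> norm (exp (lam * s1) *\<^sub>R D s1 - exp (lam * 0) *\<^sub>R D 0)"
    using norm_triangle_ineq2[of "exp (lam * s1) *\<^sub>R D s1" "D 0"] by simp
  moreover have "norm (D s1) = norm (D 0) + s1 * c + N"
    by (simp add: N_def k_def)
  ultimately show False using N by simp
qed

locale contraction_semigroup =
  fixes S :: "real \<Rightarrow> 'b::banach \<Rightarrow> 'b"
  assumes linS: "\<And>s. 0 \<le> s \<Longrightarrow> bounded_linear (S s)"
    and normS: "\<And>s f. 0 \<le> s \<Longrightarrow> norm (S s f) \<le> norm f"
    and S0: "\<And>f. S 0 f = f"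
    and S_add: "\<And>s u f. 0 \<le> s \<Longrightarrow> 0 \<le> u \<Longrightarrow> S (s + u) f = S s (S u f)"
    and S_tendsto: "\<And>f. ((\<lambda>s. S s f) \<longlongrightarrow> f) (at_right 0)"
begin

lemma S_diff: "0 \<le> s \<Longrightarrow> S s (f - g) = S s f - S s g"
  by (rule linear_diff[OF bounded_linear.linear[OF linS]])

lemma S_plus: "0 \<le> s \<Longrightarrow> S s (f + g) = S s f + S s g"
  by (rule linear_add[OF bounded_linear.linear[OF linS]])

lemma S_scaleR: "0 \<le> s \<Longrightarrow> S s (c *\<^sub>R f) = c *\<^sub>R S s f"
  by (rule linear_scale[OF bounded_linear.linear[OF linS]])

text \<open>Factoring out the semigroup at the smaller of the two times, a contraction, reduces
  continuity at any time to continuity at 0.\<close>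

lemma norm_S_diff:
  assumes "0 \<le> s" "0 \<le> u"
  shows "norm (S s f - S u f) \<le> norm (S \<bar>s - u\<bar> f - f)"
proof -
  have *: "norm (S s f - S u f) \<le> norm (S \<bar>s - u\<bar> f - f)" if "0 \<le> u" "u \<le> s" for s u
  proof -
    have "S s f - S u f = S u (S (s - u) f - f)"
      using S_add[of u "s - u" f] that by (simp add: S_diff)
    then show ?thesis using normS[of u] that by simp
  qed
  show ?thesis
    using *[of u s] *[of s u] assms by (cases "u \<le> s") (auto simp: norm_minus_commute abs_minus_commute)
qed

lemma S_close:
  assumes "0 < e"
  obtains d where "0 < d" "\<And>s. 0 \<le> s \<Longrightarrow> s < d \<Longrightarrow> norm (S s f - f) < e"
proof -
  have "eventually (\<lambda>s. dist (S s f) f < e) (at_right 0)"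
    by (rule tendstoD[OF S_tendsto assms])
  then obtain d where d: "0 < d" "\<And>s. 0 < s \<Longrightarrow> s < d \<Longrightarrow> dist (S s f) f < e"
    by (auto simp: eventually_at_right_field)
  show thesis
    by (rule that[OF d(1)]) (use d(2) assms in \<open>force simp: S0 dist_norm order.order_iff_strict\<close>)
qed

lemma continuous_on_S: "continuous_on {0..} (\<lambda>s. S s f)"
  unfolding continuous_on_iff
proof (intro ballI allI impI)
  fix s e :: real assume s: "s \<in> {0..}" "0 < e"
  obtain d where d: "0 < d" "\<And>s. 0 \<le> s \<Longrightarrow> s < d \<Longrightarrow> norm (S s f - f) < e"
    using S_close[OF s(2)] by metis
  have "dist (S u f) (S s f) < e" if "u \<in> {0..}" "dist u s < d" for u
    using norm_S_diff[of u s f] d(2)[of "\<bar>u - s\<bar>"] that s by (auto simp: dist_norm)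
  with d(1) show "\<exists>d>0. \<forall>x'\<in>{0..}. dist x' s < d \<longrightarrow> dist (S x' f) (S s f) < e" by blast
qed

section \<open>The generator as a relation\<close>

definition gen_graph :: "'b \<Rightarrow> 'b \<Rightarrow> bool" where
  "gen_graph f h \<longleftrightarrow> ((\<lambda>s. (1 / s) *\<^sub>R (S s f - f)) \<longlongrightarrow> h) (at_right 0)"

lemma at_right_0_pos: "eventually (\<lambda>s::real. 0 < s) (at_right 0)"
  by (simp add: eventually_at_right_less)

lemma gen_graph_unique: "gen_graph f h \<Longrightarrow> gen_graph f h' \<Longrightarrow> h = h'"
  unfolding gen_graph_def by (rule tendsto_unique[rotated]) auto

lemma gen_graph_add: 
  assumes "gen_graph f h" "gen_graph f' h'" shows "gen_graph (f + f') (h + h')"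
proof -
  have "((\<lambda>s. (1 / s) *\<^sub>R (S s f - f) + (1 / s) *\<^sub>R (S s f' - f')) \<longlongrightarrow> h + h') (at_right 0)"
    using assms unfolding gen_graph_def by (rule tendsto_add)
  then show ?thesis unfolding gen_graph_def
    by (rule Lim_transform_eventually)
      (rule eventually_mono[OF at_right_0_pos], simp add: S_plus algebra_simps)
qed

lemma gen_graph_scaleR: 
  assumes "gen_graph f h" shows "gen_graph (c *\<^sub>R f) (c *\<^sub>R h)"
proof -
  have "((\<lambda>s. c *\<^sub>R ((1 / s) *\<^sub>R (S s f - f))) \<longlongrightarrow> c *\<^sub>R h) (at_right 0)"
    using assms unfolding gen_graph_def by (intro tendsto_intros)
  then show ?thesis unfolding gen_graph_def
    by (rule Lim_transform_eventually)
      (rule eventually_mono[OF at_right_0_pos], simp add: S_scaleR algebra_simps)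
qed

lemma gen_graph_S: 
  assumes "gen_graph f h" "0 \<le> u" shows "gen_graph (S u f) (S u h)"
proof -
  have "((\<lambda>s. S u ((1 / s) *\<^sub>R (S s f - f))) \<longlongrightarrow> S u h) (at_right 0)"
    using assms unfolding gen_graph_def by (intro bounded_linear.tendsto[OF linS])
  then show ?thesis unfolding gen_graph_def
  proof (rule Lim_transform_eventually, intro eventually_mono[OF at_right_0_pos])
    fix s :: real assume "0 < s"
    then show "S u ((1 / s) *\<^sub>R (S s f - f)) = (1 / s) *\<^sub>R (S s (S u f) - S u f)"
      using assms S_add[of u s f] S_add[of s u f] by (simp add: S_scaleR S_diff add.commute)
  qed
qed

text \<open>With the difference quotient in place of \<open>h\<close>, the right-hand side is the
  norm of (lam + 1/s) f - (1/s) S_s f, whose second term has norm at most \<open>norm f\<close> / s;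
  the inequality survives s -> 0. It yields uniqueness for the resolvent equation and the norm bound
  of the resolvent.\<close>

lemma gen_graph_dissipative:
  assumes "gen_graph f h" "0 < lam"
  shows "lam * norm f \<le> norm (lam *\<^sub>R f - h)"
proof -
  have "((\<lambda>s. norm (lam *\<^sub>R f - (1 / s) *\<^sub>R (S s f - f))) \<longlongrightarrow> norm (lam *\<^sub>R f - h)) (at_right 0)"
    using assms unfolding gen_graph_def by (intro tendsto_intros)
  moreover have "eventually (\<lambda>s. lam * norm f \<le> norm (lam *\<^sub>R f - (1 / s) *\<^sub>R (S s f - f))) (at_right 0)"
  proof (intro eventually_mono[OF at_right_0_pos])
    fix s :: real assume s: "0 < s"
    have "(lam + 1 / s) * norm f = norm ((lam *\<^sub>R f - (1 / s) *\<^sub>R (S s f - f)) + (1 / s) *\<^sub>R S s f)"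
      using s assms by (simp add: scaleR_diff_right scaleR_add_left[symmetric])
    also have "\<dots> \<le> norm (lam *\<^sub>R f - (1 / s) *\<^sub>R (S s f - f)) + (1 / s) * norm f"
      using s normS[of s f] by (intro norm_triangle_le add_mono order_refl) (auto intro!: divide_right_mono)
    finally show "lam * norm f \<le> norm (lam *\<^sub>R f - (1 / s) *\<^sub>R (S s f - f))"
      by (simp add: algebra_simps)
  qed
  ultimately show ?thesis
    by (rule tendsto_lowerbound) simp
qed

lemma gen_graph_inj:
  assumes "gen_graph u (lam *\<^sub>R u - f)" "gen_graph v (lam *\<^sub>R v - f)" "0 < lam"
  shows "u = v"
proof -
  have "gen_graph (u - v) (lam *\<^sub>R (u - v))"
    using gen_graph_add[OF assms(1) gen_graph_scaleR[OF assms(2), of "-1"]] by (simp add: algebra_simps)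
  from gen_graph_dissipative[OF this assms(3)] show ?thesis
    using assms(3) by (simp add: mult_le_0_iff)
qed

text \<open>\<open>gen_graph\<close> is a one-sided statement at time 0. To the right of
  \<open>s\<close> the factor \<open>S s\<close> can be taken out; to the left only
  \<open>S y\<close> can, which moves the candidate derivative from \<open>S s h\<close> to
  \<open>S y h\<close> and costs the extra term S_k h - h. The modulus \<open>\<rho>\<close> covers
  both sides.\<close>

lemma S_has_vector_derivative:
  assumes gen_graph: "gen_graph f h" and s: "0 < s"
  shows "((\<lambda>s. S s f) has_vector_derivative S s h) (at s)"
proof -
  define \<rho> where "\<rho> k = norm ((1 / k) *\<^sub>R (S k f - f) - h) + norm (S k h - h)" for k
  have "((\<lambda>k. (1 / k) *\<^sub>R (S k f - f) - h) \<longlongrightarrow> 0) (at_right 0)" "((\<lambda>k. S k h - h) \<longlongrightarrow> 0) (at_right 0)"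
    using gen_graph S_tendsto[of h] unfolding gen_graph_def by (auto simp: LIM_zero_iff)
  then have \<rho>: "(\<rho> \<longlongrightarrow> 0) (at_right 0)"
    unfolding \<rho>_def by (intro tendsto_add_zero tendsto_norm_zero)
  have bound: "norm ((S y f - S s f - (y - s) *\<^sub>R S s h) /\<^sub>R norm (y - s)) \<le> \<rho> \<bar>y - s\<bar>"
    if y: "0 \<le> y" "y \<noteq> s" for y
  proof (cases "s < y")
    case True
    let ?k = "y - s"
    have "S y f - S s f - ?k *\<^sub>R S s h = S s (?k *\<^sub>R ((1 / ?k) *\<^sub>R (S ?k f - f) - h))"
      using S_add[of s ?k f] True s by (simp add: S_diff S_scaleR scaleR_diff_right)
    then have "norm (S y f - S s f - ?k *\<^sub>R S s h) \<le> ?k * norm ((1 / ?k) *\<^sub>R (S ?k f - f) - h)"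
      using normS[of s "?k *\<^sub>R ((1 / ?k) *\<^sub>R (S ?k f - f) - h)"] s True by simp
    also have "\<dots> \<le> ?k * \<rho> ?k" using True by (intro mult_left_mono) (auto simp: \<rho>_def)
    finally show ?thesis using True by (simp add: divide_inverse_commute[symmetric] pos_divide_le_eq mult.commute)
  next
    case False
    let ?k = "s - y"
    have k: "0 < ?k" using False y by simp
    have 1: "S s f = S y (S ?k f)" "S s h = S y (S ?k h)"
      using S_add[of y ?k f] S_add[of y ?k h] y k by auto
    have "S y f - S s f - (y - s) *\<^sub>R S s h
       = S y (?k *\<^sub>R (S ?k h - h) - ?k *\<^sub>R ((1 / ?k) *\<^sub>R (S ?k f - f) - h))"
      unfolding 1 using y k by (simp add: S_diff S_scaleR S_plus algebra_simps)
    then have "norm (S y f - S s f - (y - s) *\<^sub>R S s h)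
        \<le> norm (?k *\<^sub>R (S ?k h - h) - ?k *\<^sub>R ((1 / ?k) *\<^sub>R (S ?k f - f) - h))"
      using normS[of y] y by simp
    also have "\<dots> \<le> norm (?k *\<^sub>R (S ?k h - h)) + norm (?k *\<^sub>R ((1 / ?k) *\<^sub>R (S ?k f - f) - h))"
      by (rule norm_triangle_ineq4)
    also have "\<dots> = ?k * \<rho> ?k" using k by (simp only: \<rho>_def norm_scaleR distrib_left abs_of_pos add.commute)
    finally show ?thesis using k by (simp add: divide_inverse_commute[symmetric] pos_divide_le_eq mult.commute)
  qed
  have "((\<lambda>y. \<rho> \<bar>y - s\<bar>) \<longlongrightarrow> 0) (at s)"
  proof (rule filterlim_compose[OF \<rho>])
    have "((\<lambda>y. \<bar>y - s\<bar>) \<longlongrightarrow> 0) (at s)"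
      using tendsto_rabs[OF tendsto_diff[OF tendsto_ident_at tendsto_const], of s s UNIV] by simp
    then show "filterlim (\<lambda>y. \<bar>y - s\<bar>) (at_right 0) (at s)"
      by (auto simp: filterlim_at eventually_at_filter intro!: always_eventually)
  qed
  moreover have "eventually (\<lambda>y. 0 < y) (at s)"
    using order_tendstoD(1)[OF tendsto_ident_at s] .
  then have "eventually (\<lambda>y. norm ((S y f - S s f - (y - s) *\<^sub>R S s h) /\<^sub>R norm (y - s)) \<le> \<rho> \<bar>y - s\<bar>) (at s)"
    using eventually_neq_at_within[of s] 
    by eventually_elim (use bound in auto)
  ultimately have "((\<lambda>y. (S y f - S s f - (y - s) *\<^sub>R S s h) /\<^sub>R norm (y - s)) \<longlongrightarrow> 0) (at s)"
    by (rule Lim_null_comparison[rotated])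
  then show ?thesis
    unfolding has_vector_derivative_def has_derivative_at_within
    by (auto intro: bounded_linear_scaleR_left)
qed

text \<open>The Laplace integral of the resolvent, cut off at \<open>d\<close>. With
  \<open>lam = 0\<close> its averages over short intervals approximate \<open>f\<close> from within
  the domain; with \<open>d = 1\<close> it is the building block of the resolvent.\<close>

definition J :: "real \<Rightarrow> real \<Rightarrow> 'b \<Rightarrow> 'b" where
  "J lam d f = integral {0..d} (\<lambda>s. exp (- (lam * s)) *\<^sub>R S s f)"

lemma J_has_vector_derivative:
  assumes "0 \<le> d"
  shows "((\<lambda>d. J lam d f) has_vector_derivative exp (- (lam * d)) *\<^sub>R S d f) (at_right d)"
proof -
  have "((\<lambda>d. J lam d f) has_vector_derivative exp (- (lam * d)) *\<^sub>R S d f) (at d within {0..d+1})"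
    unfolding J_def using assms
    by (intro integral_has_vector_derivative continuous_intros continuous_on_subset[OF continuous_on_S]) auto
  then have "((\<lambda>d. J lam d f) has_vector_derivative exp (- (lam * d)) *\<^sub>R S d f) (at d within {d..d+1})"
    by (rule has_vector_derivative_within_subset) (use assms in auto)
  then show ?thesis
    by (simp add: at_within_Icc_at_right)
qed

text \<open>Applying the semigroup shifts the interval of integration, and the factor in front
  compensates the exponential weight.\<close>

lemma S_J:
  assumes "0 \<le> h" "0 \<le> d"
  shows "S h (J lam d f) = exp (lam * h) *\<^sub>R (J lam (d + h) f - J lam h f)"
proof -
  let ?F = "\<lambda>s. exp (- (lam * s)) *\<^sub>R S s f"
  have cont: "continuous_on {p..q} ?F" if "0 \<le> p" for p q
    using that by (intro continuous_intros continuous_on_subset[OF continuous_on_S]) auto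
  have "S h (J lam d f) = integral {0..d} (S h \<circ> ?F)"
    unfolding J_def by (rule integral_linear[symmetric, OF integrable_continuous_real[OF cont] linS[OF assms(1)]]) simp
  also have "\<dots> = integral {0..d} (\<lambda>s. exp (lam * h) *\<^sub>R ?F (h + s))"
    using assms by (intro integral_cong) (simp add: S_scaleR S_add[symmetric] exp_add[symmetric] algebra_simps)
  also have "\<dots> = exp (lam * h) *\<^sub>R integral {0..d} (?F \<circ> ((+) h))"
    unfolding o_def by (rule integral_cmul)
  also have "integral {0..d} (?F \<circ> ((+) h)) = integral {h..d+h} ?F"
    using integral_shift_Icc_real[of 0 d ?F h] by simp
  also have "\<dots> = J lam (d + h) f - J lam h f"
    unfolding J_def using Henstock_Kurzweil_Integration.integral_combine[where a = 0 and c = h and b = "d + h" and f = ?F] assms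
      integrable_continuous_real[OF cont[of 0 "d+h"]] by (simp add: algebra_simps)
  finally show ?thesis .
qed

text \<open>The right derivative at \<open>h = 0\<close> of the formula in \<open>S_J\<close>: the
  moving upper end contributes the boundary term at \<open>d\<close>, the removed initial piece
  contributes \<open>f\<close>, and the exponential factor contributes
  \<open>lam *\<^sub>R J lam d f\<close>.\<close>

lemma gen_graph_J:
  assumes "0 \<le> d"
  shows "gen_graph (J lam d f) (lam *\<^sub>R J lam d f - (f - exp (- (lam * d)) *\<^sub>R S d f))"
proof -
  have J0: "J lam 0 f = 0" by (simp add: J_def)
  have "((\<lambda>h. exp (lam * h) *\<^sub>R (J lam (d + h) f - J lam h f)) has_vector_derivative
     exp (lam * 0) *\<^sub>R (exp (- (lam * d)) *\<^sub>R S d f - exp (- (lam * 0)) *\<^sub>R S 0 f)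
      + (exp (lam * 0) * lam) *\<^sub>R (J lam (d + 0) f - J lam 0 f)) (at_right 0)"
  proof (rule has_vector_derivative_scaleR)
    show "((\<lambda>h. exp (lam * h)) has_real_derivative exp (lam * 0) * lam) (at_right 0)"
      by (auto intro!: derivative_eq_intros)
    have "((\<lambda>h. J lam (d + h) f) has_vector_derivative exp (- (lam * d)) *\<^sub>R S d f) (at_right 0)"
    proof -
      have 1: "((\<lambda>h. d + h) has_vector_derivative 1) (at_right 0)"
        by (auto intro!: derivative_eq_intros simp: has_real_derivative_iff_has_vector_derivative[symmetric])
      have 2: "(+) d ` {0<..} = {d<..}" by (auto simp: image_iff intro!: bexI[of _ "_ - d"])
      have "((\<lambda>d. J lam d f) \<circ> (\<lambda>h. d + h) has_vector_derivative 1 *\<^sub>R (exp (- (lam * d)) *\<^sub>R S d f)) (at_right 0)"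
        by (rule vector_diff_chain_within[OF 1]) (use J_has_vector_derivative[OF assms, of lam f] 2 in simp)
      then show ?thesis by (simp add: o_def)
    qed
    then show "((\<lambda>h. J lam (d + h) f - J lam h f) has_vector_derivative
        exp (- (lam * d)) *\<^sub>R S d f - exp (- (lam * 0)) *\<^sub>R S 0 f) (at_right 0)"
      by (intro has_vector_derivative_diff J_has_vector_derivative) auto
  qed
  then have "((\<lambda>h. exp (lam * h) *\<^sub>R (J lam (d + h) f - J lam h f)) has_vector_derivative
     (lam *\<^sub>R J lam d f - (f - exp (- (lam * d)) *\<^sub>R S d f))) (at_right 0)" (is "(?F has_vector_derivative ?D) _")
    by (simp add: S0 J0 algebra_simps)
  then have "((\<lambda>y. (?F y - ?F 0 - (y - 0) *\<^sub>R ?D) /\<^sub>R norm (y - 0)) \<longlongrightarrow> 0) (at_right 0)"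
    unfolding has_vector_derivative_def has_derivative_at_within by simp
  then have "((\<lambda>y. (1 / y) *\<^sub>R (S y (J lam d f) - J lam d f) - ?D) \<longlongrightarrow> 0) (at_right 0)"
  proof (rule Lim_transform_eventually, intro eventually_mono[OF at_right_0_pos])
    fix y :: real assume y: "0 < y"
    show "(?F y - ?F 0 - (y - 0) *\<^sub>R ?D) /\<^sub>R norm (y - 0) = (1 / y) *\<^sub>R (S y (J lam d f) - J lam d f) - ?D"
      using y assms by (subst S_J) (auto simp: J0 scaleR_diff_right[of "inverse y"] scaleR_diff_right[of "1/y"] divide_inverse)
  qed
  then show ?thesis
    unfolding gen_graph_def by (simp add: LIM_zero_iff)
qed

text \<open>The averages of the orbit over [0, y] lie in the domain and tend to \<open>f\<close>,
  being difference quotients of \<open>J 0\<close> at 0.\<close>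

lemma gen_graph_dense:
  assumes "0 < e" obtains u h where "gen_graph u h" "norm (u - f) < e"
proof -
  have "((\<lambda>d. J 0 d f) has_vector_derivative f) (at_right 0)"
    using J_has_vector_derivative[of 0 0 f] by (simp add: S0)
  then have "((\<lambda>y. (J 0 y f - J 0 0 f - (y - 0) *\<^sub>R f) /\<^sub>R norm (y - 0)) \<longlongrightarrow> 0) (at_right 0)"
    unfolding has_vector_derivative_def has_derivative_at_within by simp
  then have "eventually (\<lambda>y. norm ((J 0 y f - J 0 0 f - (y - 0) *\<^sub>R f) /\<^sub>R norm (y - 0)) < e) (at_right 0)"
    using assms by (auto dest!: tendstoD[OF _ assms] simp: dist_norm)
  then have "eventually (\<lambda>y. y > 0 \<and> norm ((J 0 y f - J 0 0 f - (y - 0) *\<^sub>R f) /\<^sub>R norm (y - 0)) < e) (at_right 0)"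
    using at_right_0_pos by eventually_elim auto
  then obtain y where y: "y > 0" "norm ((J 0 y f - J 0 0 f - (y - 0) *\<^sub>R f) /\<^sub>R norm (y - 0)) < e"
    using eventually_happens'[OF trivial_limit_at_right_real] by blast
  have "(J 0 y f - J 0 0 f - (y - 0) *\<^sub>R f) /\<^sub>R norm (y - 0) = (1 / y) *\<^sub>R J 0 y f - f"
    using y(1) by (simp add: J_def scaleR_diff_right divide_inverse)
  then have "norm ((1 / y) *\<^sub>R J 0 y f - f) < e" using y(2) by metis
  then show thesis
    using that[OF gen_graph_scaleR[OF gen_graph_J[of y 0 f], of "1 / y"]] y(1) by simp
qed

text \<open>With \<open>B = e\<^bsup>-lam\<^esup> S\<^sub>1\<close>, of norm less than \<open>1\<close>, one has \<open>(lam - A) J\<^sub>1 = 1 - B\<close>, so that \<open>J\<^sub>1\<close> applied to the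
  Neumann series of \<open>B\<close> is the resolvent; no improper integral is needed.\<close>

lemma ex_resolvent:
  assumes "0 < lam"
  shows "\<exists>u. gen_graph u (lam *\<^sub>R u - f)"
proof -
  define B where "B g = exp (- lam) *\<^sub>R S 1 g" for g
  have B: "bounded_linear B"
    unfolding B_def by (intro bounded_linear_const_scaleR linS) simp
  have "norm ((B ^^ n) f) \<le> exp (- lam) ^ n * norm f" for n
  proof (induction n)
    case (Suc n)
    have "norm ((B ^^ Suc n) f) \<le> exp (- lam) * norm ((B ^^ n) f)"
      by (simp add: B_def normS)
    also have "\<dots> \<le> exp (- lam) * (exp (- lam) ^ n * norm f)"
      by (intro mult_left_mono Suc) simp
    finally show ?case by simp
  qed simp
  then have sum: "summable (\<lambda>n. (B ^^ n) f)"
    using assms by (intro summable_norm_cancel[OF summable_comparison_test'[where N = 0, OF summable_mult2[OF summable_geometric[of "exp (- lam)"], of "norm f"]]]) auto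
  define v where "v = (\<Sum>n. (B ^^ n) f)"
  have "B v = (\<Sum>n. (B ^^ Suc n) f)"
    unfolding v_def by (simp add: bounded_linear.suminf[OF B sum])
  also have "\<dots> = v - f"
    unfolding v_def using suminf_split_head[OF sum] by simp
  finally have "v - B v = f" by simp
  then have "gen_graph (J lam 1 v) (lam *\<^sub>R J lam 1 v - f)"
    using gen_graph_J[of 1 lam v] by (simp add: B_def)
  then show ?thesis ..
qed

section \<open>The resolvent, its bounds and its commutation with the semigroup\<close>

definition R :: "real \<Rightarrow> 'b \<Rightarrow> 'b" where
  "R lam f = (THE u. gen_graph u (lam *\<^sub>R u - f))"

context
  fixes lam :: real
  assumes lam: "0 < lam"
begin

lemma gen_graph_R: "gen_graph (R lam f) (lam *\<^sub>R R lam f - f)"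
proof -
  obtain u where u: "gen_graph u (lam *\<^sub>R u - f)" using ex_resolvent[OF lam] by blast
  then show ?thesis
    unfolding R_def by (rule theI) (use gen_graph_inj[OF _ u lam] in blast)
qed

lemma R_eqI: "gen_graph u (lam *\<^sub>R u - f) \<Longrightarrow> R lam f = u"
  by (rule gen_graph_inj[OF gen_graph_R _ lam])

lemma norm_R: "norm (lam *\<^sub>R R lam f) \<le> norm f"
  using gen_graph_dissipative[OF gen_graph_R lam, of f] lam by simp

lemma bounded_linear_R: "bounded_linear (R lam)"
proof (rule bounded_linear_intro[where K = "1 / lam"])
  show "R lam (f + g) = R lam f + R lam g" for f g
    by (rule R_eqI) (use gen_graph_add[OF gen_graph_R[of f] gen_graph_R[of g]] in \<open>simp add: algebra_simps\<close>)
  show "R lam (c *\<^sub>R f) = c *\<^sub>R R lam f" for c f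
    by (rule R_eqI) (use gen_graph_scaleR[OF gen_graph_R[of f], of c] in \<open>simp add: algebra_simps\<close>)
  show "norm (R lam f) \<le> norm f * (1 / lam)" for f
    using norm_R[of f] lam by (simp add: field_simps)
qed

lemma R_S: "0 \<le> s \<Longrightarrow> R lam (S s f) = S s (R lam f)"
  by (rule R_eqI) (use gen_graph_S[OF gen_graph_R[of f], of s] in \<open>simp add: S_diff S_scaleR\<close>)

text \<open>\<open>R lam\<close> inverts lam - A, so it maps lam f - h back to \<open>f\<close>;
  linearity gives the identity. On the domain it turns the Yosida approximation into
  \<open>lam *\<^sub>R R lam h\<close>, where \<open>R_tendsto\<close> applies.\<close>

lemma R_gen_graph: 
  assumes "gen_graph f h" shows "lam *\<^sub>R R lam f - f = R lam h"
proof -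
  have 1: "R lam (lam *\<^sub>R f - h) = f" by (rule R_eqI) (use assms in simp)
  interpret R: bounded_linear "R lam" by (rule bounded_linear_R)
  from 1 show ?thesis by (simp add: R.diff R.scaleR algebra_simps)
qed

text \<open>This is lam A R, because A R = lam R - 1. The chosen form displays the operator as lam
  (P - 1) with the contraction P = lam R, the shape that \<open>norm_le_gronwall\<close>
  expects.\<close>

definition "yos f = lam *\<^sub>R (lam *\<^sub>R R lam f - f)"

lemma bounded_linear_yos: "bounded_linear yos"
  unfolding yos_def
  by (intro bounded_linear_const_scaleR bounded_linear_sub bounded_linear_R bounded_linear_ident)

lemma norm_yos: "norm (yos f) \<le> 2 * lam * norm f"
proof -
  have "norm (lam *\<^sub>R R lam f - f) \<le> norm f + norm f"
    using norm_R[of f] norm_triangle_ineq4[of "lam *\<^sub>R R lam f" f] by simp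
  then show ?thesis unfolding yos_def using lam by simp
qed

lemma norm_yos_pow: "norm ((yos ^^ n) f) \<le> (2 * lam) ^ n * norm f"
proof (induction n)
  case (Suc n)
  have "norm ((yos ^^ Suc n) f) \<le> 2 * lam * norm ((yos ^^ n) f)"
    by (simp add: norm_yos)
  also have "\<dots> \<le> 2 * lam * ((2 * lam) ^ n * norm f)"
    using Suc lam by (intro mult_left_mono) auto
  finally show ?case by simp
qed simp

lemma bounded_linear_yos_pow: "bounded_linear (yos ^^ n)"
  by (induction n) (auto simp: o_def id_def intro: bounded_linear_ident bounded_linear_compose[OF bounded_linear_yos])

lemma yos_S: "0 \<le> s \<Longrightarrow> yos (S s f) = S s (yos f)"
  by (simp add: yos_def R_S S_diff S_scaleR)

lemma yos_gen_graph: "gen_graph f h \<Longrightarrow> yos f = lam *\<^sub>R R lam h"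
  by (simp add: yos_def R_gen_graph)

definition "expo_part N s f = (\<Sum>n<N. (s ^ n / fact n) *\<^sub>R (yos ^^ n) f)"
definition "expo s f = (\<Sum>n. (s ^ n / fact n) *\<^sub>R (yos ^^ n) f)"

lemma summable_expo_bound: "summable (\<lambda>n. ((2 * lam) * s) ^ n / fact n * c)"
  using summable_exp[of "(2 * lam) * s"]
  by (intro summable_mult2) (simp add: divide_inverse mult.commute)

lemma summable_expo: "0 \<le> s \<Longrightarrow> summable (\<lambda>n. (s ^ n / fact n) *\<^sub>R (yos ^^ n) f)"
proof (rule summable_norm_cancel[OF summable_comparison_test'[where N = 0, OF summable_expo_bound[of s "norm f"]]])
  fix n assume "0 \<le> s"
  then show "norm (norm ((s ^ n / fact n) *\<^sub>R (yos ^^ n) f)) \<le> (2 * lam * s) ^ n / fact n * norm f"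
    using mult_left_mono[OF norm_yos_pow[of n f], of "s ^ n / fact n"]
    by (simp add: power_mult_distrib algebra_simps)
qed

lemma expo_part_tendsto: "0 \<le> s \<Longrightarrow> (\<lambda>N. expo_part N s f) \<longlonglongrightarrow> expo s f"
  unfolding expo_part_def expo_def using summable_LIMSEQ[OF summable_expo] by blast

text \<open>The partial sums solve the evolution equation up to a residual that vanishes in the limit, which
  is all that is needed for the Gronwall estimate.\<close>

lemma expo_part_has_vector_derivative:
  "((\<lambda>s. expo_part (Suc N) s f) has_vector_derivative
     yos (expo_part (Suc N) s f) - (s ^ N / fact N) *\<^sub>R (yos ^^ Suc N) f) (at s)"
proof -
  interpret Y: bounded_linear yos by (rule bounded_linear_yos)
  have d: "((\<lambda>s. (s ^ Suc n / fact (Suc n)) *\<^sub>R (yos ^^ Suc n) f) has_vector_derivative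
      (s ^ n / fact n) *\<^sub>R (yos ^^ Suc n) f) (at s)" for n
  proof -
    have "((\<lambda>s. s ^ Suc n / fact (Suc n)) has_real_derivative s ^ n / fact n) (at s)"
    proof -
      have "((\<lambda>s. s ^ Suc n / fact (Suc n)) has_real_derivative (real (Suc n) * s ^ n) / fact (Suc n)) (at s)"
        by (intro DERIV_cdivide DERIV_pow[of "Suc n" s UNIV, unfolded diff_Suc_1 diff_Suc_Suc diff_zero])
      also have "(real (Suc n) * s ^ n) / fact (Suc n) = s ^ n / fact n"
        by (simp only: fact_Suc of_nat_mult) simp
      finally show ?thesis .
    qed
    from has_vector_derivative_scaleR[OF this has_vector_derivative_const] show ?thesis by simp
  qed
  have split: "expo_part (Suc N) s f = f + (\<Sum>n<N. (s ^ Suc n / fact (Suc n)) *\<^sub>R (yos ^^ Suc n) f)" for s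
    unfolding expo_part_def by (subst sum.lessThan_Suc_shift) simp
  have "((\<lambda>s. expo_part (Suc N) s f) has_vector_derivative (0 + (\<Sum>n<N. (s ^ n / fact n) *\<^sub>R (yos ^^ Suc n) f))) (at s)"
    unfolding split by (intro has_vector_derivative_add has_vector_derivative_const has_vector_derivative_sum d)
  also have "0 + (\<Sum>n<N. (s ^ n / fact n) *\<^sub>R (yos ^^ Suc n) f)
     = yos (expo_part (Suc N) s f) - (s ^ N / fact N) *\<^sub>R (yos ^^ Suc N) f"
    by (simp add: expo_part_def Y.sum Y.add Y.scaleR)
  finally show ?thesis .
qed

lemma residual_tendsto: "(\<lambda>N. (s0 ^ N / fact N) * ((2 * lam) ^ Suc N * norm f)) \<longlonglongrightarrow> 0"
proof -
  have "(\<lambda>N. (((2 * lam) * s0) ^ N / fact N * (2 * lam * norm f))) \<longlonglongrightarrow> 0"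
    by (rule summable_LIMSEQ_zero[OF summable_expo_bound])
  then show ?thesis by (simp add: power_mult_distrib algebra_simps)
qed

lemma norm_residual:
  assumes "0 < s" "s \<le> s0"
  shows "norm ((s ^ N / fact N) *\<^sub>R (yos ^^ Suc N) f) \<le> (s0 ^ N / fact N) * ((2 * lam) ^ Suc N * norm f)"
proof -
  have "norm ((s ^ N / fact N) *\<^sub>R (yos ^^ Suc N) f) = (s ^ N / fact N) * norm ((yos ^^ Suc N) f)"
    using assms by simp
  also have "\<dots> \<le> (s0 ^ N / fact N) * ((2 * lam) ^ Suc N * norm f)"
    using assms norm_yos_pow[of "Suc N" f] by (intro mult_mono divide_right_mono power_mono) auto
  finally show ?thesis .
qed

lemma expo_part_0: "expo_part (Suc N) 0 f = f"
  unfolding expo_part_def by (subst sum.lessThan_Suc_shift) simp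

lemma yos_alt: "yos f = lam *\<^sub>R (lam *\<^sub>R R lam f - f)" by (simp add: yos_def)

lemma continuous_on_expo_part: "continuous_on {0..} (\<lambda>s. expo_part (Suc N) s f)"
  using has_vector_derivative_continuous[OF expo_part_has_vector_derivative]
  by (simp add: continuous_at_imp_continuous_on)

text \<open>Termwise estimates would give only exp(2 lam s). The Gronwall bound sees the contraction
  lam R and the residual of the partial sum, and the residual vanishes as the number of terms
  grows.\<close>

lemma norm_expo:
  assumes "0 \<le> s"
  shows "norm (expo s f) \<le> norm f"
proof -
  let ?res = "\<lambda>N. (s ^ N / fact N) * ((2 * lam) ^ Suc N * norm f)"
  have res: "(\<lambda>N. norm f + s * ?res N) \<longlonglongrightarrow> norm f + s * 0"
    by (intro tendsto_add tendsto_mult tendsto_const residual_tendsto)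
  have "norm (expo_part (Suc N) s f) \<le> norm f + s * ?res N" for N
    using norm_le_gronwall[where P = "\<lambda>z. lam *\<^sub>R R lam z" and lam = lam and D = "\<lambda>s. expo_part (Suc N) s f"
          and r = "\<lambda>s. - ((s ^ N / fact N) *\<^sub>R (yos ^^ Suc N) f)" and u = s and c = "?res N"]
      lam norm_R continuous_on_expo_part[of N f] expo_part_has_vector_derivative[of N f] norm_residual[of _ s N f] assms
    by (simp add: yos_alt expo_part_0)
  moreover have "(\<lambda>N. norm (expo_part (Suc N) s f)) \<longlonglongrightarrow> norm (expo s f)"
    by (intro tendsto_norm LIMSEQ_Suc expo_part_tendsto assms)
  moreover note res
  ultimately show ?thesis
    by (intro tendsto_le[of sequentially "\<lambda>N. norm f + s * ?res N" "norm f" "\<lambda>N. norm (expo_part (Suc N) s f)"]) auto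
qed

text \<open>Since \<open>yos\<close> commutes with the semigroup, the difference solves the Yosida
  evolution equation with source S_s (yos f - h), whose norm never exceeds
  \<open>norm (yos f - h)\<close>. Hence the linear growth in \<open>s\<close>.\<close>

lemma norm_expo_diff:
  assumes s: "0 \<le> s" and gen_graph: "gen_graph f h"
  shows "norm (expo s f - S s f) \<le> s * norm (yos f - h)"
proof -
  let ?res = "\<lambda>N. (s ^ N / fact N) * ((2 * lam) ^ Suc N * norm f)"
  interpret Y: bounded_linear yos by (rule bounded_linear_yos)
  have "norm (expo_part (Suc N) s f - S s f) \<le> norm (expo_part (Suc N) 0 f - S 0 f) + s * (norm (yos f - h) + ?res N)" for N
  proof (rule norm_le_gronwall[where P = "\<lambda>z. lam *\<^sub>R R lam z" and lam = lam and D = "\<lambda>s. expo_part (Suc N) s f - S s f"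
          and r = "\<lambda>s. S s (yos f - h) - ((s ^ N / fact N) *\<^sub>R (yos ^^ Suc N) f)"])
    show "continuous_on {0..} (\<lambda>s. expo_part (Suc N) s f - S s f)"
      by (intro continuous_intros continuous_on_expo_part continuous_on_S)
    fix u :: real assume u: "0 < u"
    have "((\<lambda>s. expo_part (Suc N) s f - S s f) has_vector_derivative
       (yos (expo_part (Suc N) u f) - (u ^ N / fact N) *\<^sub>R (yos ^^ Suc N) f) - S u h) (at u)"
      by (intro has_vector_derivative_diff expo_part_has_vector_derivative S_has_vector_derivative gen_graph u)
    also have "(yos (expo_part (Suc N) u f) - (u ^ N / fact N) *\<^sub>R (yos ^^ Suc N) f) - S u h
      = yos (expo_part (Suc N) u f - S u f) + (S u (yos f - h) - ((u ^ N / fact N) *\<^sub>R (yos ^^ Suc N) f))"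
      using u by (simp add: Y.diff yos_S S_diff)
    finally show "((\<lambda>s. expo_part (Suc N) s f - S s f) has_vector_derivative
        lam *\<^sub>R (lam *\<^sub>R R lam (expo_part (Suc N) u f - S u f) - (expo_part (Suc N) u f - S u f)) +
        (S u (yos f - h) - (u ^ N / fact N) *\<^sub>R (yos ^^ Suc N) f)) (at u)"
      by (simp only: yos_alt)
    assume us: "u \<le> s"
    show "norm (S u (yos f - h) - (u ^ N / fact N) *\<^sub>R (yos ^^ Suc N) f) \<le> norm (yos f - h) + ?res N"
      using norm_triangle_ineq4[of "S u (yos f - h)" "(u ^ N / fact N) *\<^sub>R (yos ^^ Suc N) f"]
        normS[of u "yos f - h"] norm_residual[OF u us, of N f] u by linarith
  qed (use lam norm_R s in auto)
  then have "norm (expo_part (Suc N) s f - S s f) \<le> s * (norm (yos f - h) + ?res N)" for N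
    by (simp add: expo_part_0 S0)
  moreover have "(\<lambda>N. norm (expo_part (Suc N) s f - S s f)) \<longlonglongrightarrow> norm (expo s f - S s f)"
    by (intro tendsto_norm tendsto_diff tendsto_const LIMSEQ_Suc expo_part_tendsto s)
  moreover have "(\<lambda>N. s * (norm (yos f - h) + ?res N)) \<longlonglongrightarrow> s * (norm (yos f - h) + 0)"
    by (intro tendsto_add tendsto_mult tendsto_const residual_tendsto)
  ultimately show ?thesis
    by (intro tendsto_le[of sequentially "\<lambda>N. s * (norm (yos f - h) + ?res N)" _ "\<lambda>N. norm (expo_part (Suc N) s f - S s f)"]) auto
qed

lemma expo_diff: "0 \<le> s \<Longrightarrow> expo s (f - g) = expo s f - expo s g"
  unfolding expo_def
  by (subst suminf_diff[OF summable_expo summable_expo])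
    (auto simp: bounded_linear.linear[OF bounded_linear_yos_pow] linear_diff scaleR_diff_right)

end

text \<open>On the domain the error is \<open>R lam h\<close>, of norm at most
  \<open>norm h / lam\<close>. Density of the domain and the contraction bound, uniform in
  \<open>lam\<close>, carry this over to every \<open>f\<close>.\<close>

lemma R_tendsto: "((\<lambda>lam. lam *\<^sub>R R lam f) \<longlongrightarrow> f) at_top"
proof (rule tendstoI)
  fix e :: real assume e: "0 < e"
  obtain u h where u: "gen_graph u h" "norm (u - f) < e / 3" using gen_graph_dense[of "e/3" f] e by auto
  have "norm (lam *\<^sub>R R lam f - f) < e" if lam: "lam > 0" "lam > 3 * norm h / e" for lam
  proof -
    have "norm h / lam < e / 3" using lam e by (simp add: field_simps)
    moreover have "norm (lam *\<^sub>R R lam u - u) \<le> norm h / lam"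
      using norm_R[OF lam(1), of h] lam(1) by (simp add: R_gen_graph[OF lam(1) u(1)] field_simps)
    moreover have eq: "lam *\<^sub>R R lam f - f = (lam *\<^sub>R R lam u - u) + (u - f) - lam *\<^sub>R R lam (u - f)"
      by (simp add: linear_diff[OF bounded_linear.linear[OF bounded_linear_R[OF lam(1)]]] algebra_simps)
    ultimately show ?thesis
      unfolding eq using norm_R[OF lam(1), of "u - f"] u(2)
        norm_triangle_ineq4[of "(lam *\<^sub>R R lam u - u) + (u - f)" "lam *\<^sub>R R lam (u - f)"]
        norm_triangle_ineq[of "lam *\<^sub>R R lam u - u" "u - f"]
      by linarith
  qed
  then show "eventually (\<lambda>lam. dist (lam *\<^sub>R R lam f) f < e) at_top"
    unfolding dist_norm
    by (intro eventually_mono[OF eventually_conj[OF eventually_gt_at_top[of 0] eventually_gt_at_top[of "3 * norm h / e"]]]) auto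
qed

text \<open>The approximating generators converge pointwise and on the domain only. Compactness of
  \<open>K\<close> provides finitely many domain elements within e/2 of all its points; their errors
  are at most s e, and the two contractions add e/2 each, which explains the factor 1 + s.\<close>

lemma expo_tendsto_uniform:
  assumes K: "compact K" and e: "0 < e"
  shows "eventually (\<lambda>lam. \<forall>f\<in>K. \<forall>s\<ge>0. norm (expo lam s f - S s f) \<le> e * (1 + s)) at_top"
proof -
  define c where "c = (\<lambda>p :: 'b \<times> 'b. ball (fst p) (e/2))"
  define P where "P = {p. gen_graph (fst p) (snd p)}"
  have "K \<subseteq> (\<Union>p\<in>P. c p)"
  proof
    fix f assume "f \<in> K"
    obtain u h where "gen_graph u h" "norm (u - f) < e / 2" using gen_graph_dense[of "e/2" f] e by auto
    then show "f \<in> (\<Union>p\<in>P. c p)"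
      by (auto intro!: bexI[of _ "(u, h)"] simp: c_def P_def dist_norm)
  qed
  then obtain Q where Q: "Q \<subseteq> P" "finite Q" "K \<subseteq> (\<Union>p\<in>Q. c p)"
    using compactE_image[OF K, of P c] by (auto simp: c_def)
  have "eventually (\<lambda>lam. norm (yos lam (fst p) - snd p) < e) at_top" if "p \<in> Q" for p
  proof -
    have gen_graph: "gen_graph (fst p) (snd p)" using that Q by (auto simp: P_def)
    have "eventually (\<lambda>lam. dist (lam *\<^sub>R R lam (snd p)) (snd p) < e) at_top"
      by (rule tendstoD[OF R_tendsto e])
    with eventually_gt_at_top[of 0] show ?thesis
      by eventually_elim (auto simp: dist_norm yos_gen_graph[OF _ gen_graph])
  qed
  then have "eventually (\<lambda>lam. \<forall>p\<in>Q. norm (yos lam (fst p) - snd p) < e) at_top"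
    using Q(2) by (simp add: eventually_ball_finite_distrib)
  with eventually_gt_at_top[of 0] show ?thesis
  proof eventually_elim
    case (elim lam)
    show ?case
    proof safe
      fix f s assume f: "f \<in> K" and s: "0 \<le> (s::real)"
      then obtain p where p: "p \<in> Q" "f \<in> c p" using Q by auto
      have gen_graph: "gen_graph (fst p) (snd p)" using p Q by (auto simp: P_def)
      have 1: "norm (f - fst p) < e / 2" using p by (auto simp: c_def dist_norm norm_minus_commute)
      have 2: "norm (expo lam s (fst p) - S s (fst p)) \<le> s * e"
        using norm_expo_diff[OF elim(1) s gen_graph] elim(2) p s
        by (meson less_imp_le mult_left_mono order_trans)
      have eq: "expo lam s f - S s f = expo lam s (f - fst p) + (expo lam s (fst p) - S s (fst p)) - S s (f - fst p)"
        using s elim by (simp add: expo_diff S_diff)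
      have "e * (1 + s) = e / 2 + s * e + e / 2" by (simp add: algebra_simps)
      then show "norm (expo lam s f - S s f) \<le> e * (1 + s)"
        unfolding eq using 1 2 norm_expo[OF elim(1) s, of "f - fst p"] normS[OF s, of "f - fst p"]
          norm_triangle_ineq4[of "expo lam s (f - fst p) + (expo lam s (fst p) - S s (fst p))" "S s (f - fst p)"]
          norm_triangle_ineq[of "expo lam s (f - fst p)" "expo lam s (fst p) - S s (fst p)"]
        by linarith
    qed
  qed
qed

end

section \<open>The Banach space of functions vanishing at infinity\<close>

lemma C_infE:
  assumes "f \<in> C_inf E" "0 < e"
  obtains K where "compact K" "K \<subseteq> E" "\<forall>x\<in>E - K. \<bar>f x\<bar> < e"
  using assms by (auto simp: C_inf_def)

lemma C_inf_continuous_on: "f \<in> C_inf E \<Longrightarrow> continuous_on E f"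
  by (simp add: C_inf_def)

lemma C_inf_outside: "f \<in> C_inf E \<Longrightarrow> x \<notin> E \<Longrightarrow> f x = 0"
  by (simp add: C_inf_def)

lemma C_infI:
  assumes "continuous_on E f" "\<And>x. x \<notin> E \<Longrightarrow> f x = 0"
    and "\<And>e. 0 < e \<Longrightarrow> \<exists>K. compact K \<and> K \<subseteq> E \<and> (\<forall>x\<in>E - K. \<bar>f x\<bar> < e)"
  shows "f \<in> C_inf E"
  using assms by (simp add: C_inf_def)

lemma C_inf_add:
  assumes "f \<in> C_inf E" "g \<in> C_inf E" shows "(\<lambda>x. f x + g x) \<in> C_inf E"
proof -
  have "\<exists>K. compact K \<and> K \<subseteq> E \<and> (\<forall>x\<in>E - K. \<bar>f x + g x\<bar> < e)" if e: "0 < e" for e :: real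
  proof -
    obtain K where K: "compact K" "K \<subseteq> E" "\<forall>x\<in>E - K. \<bar>f x\<bar> < e / 2"
      by (rule C_infE[OF assms(1) half_gt_zero[OF e]])
    obtain L where L: "compact L" "L \<subseteq> E" "\<forall>x\<in>E - L. \<bar>g x\<bar> < e / 2"
      by (rule C_infE[OF assms(2) half_gt_zero[OF e]])
    note KL = K L
    have "\<bar>f x + g x\<bar> < e" if "x \<in> E - (K \<union> L)" for x
    proof -
      have "\<bar>f x\<bar> < e / 2" "\<bar>g x\<bar> < e / 2" using K(3) L(3) that by auto
      then show ?thesis by linarith
    qed
    then show ?thesis using KL by (intro exI[of _ "K \<union> L"]) (simp add: compact_Un)
  qed
  then show ?thesis using assms by (auto intro!: C_infI continuous_on_add simp: C_inf_outside dest: C_inf_continuous_on)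
qed

lemma C_inf_scale:
  assumes "f \<in> C_inf E" shows "(\<lambda>x. c * f x) \<in> C_inf E"
proof -
  have "\<exists>K. compact K \<and> K \<subseteq> E \<and> (\<forall>x\<in>E - K. \<bar>c * f x\<bar> < e)" if "0 < e" for e :: real
  proof -
    have pos: "0 < e / (\<bar>c\<bar> + 1)" using that by (simp add: add_nonneg_pos)
    obtain K where K: "compact K" "K \<subseteq> E" "\<forall>x\<in>E - K. \<bar>f x\<bar> < e / (\<bar>c\<bar> + 1)"
      by (rule C_infE[OF assms pos])
    have "\<bar>c * f x\<bar> < e" if "x \<in> E - K" for x
    proof -
      have "\<bar>c * f x\<bar> \<le> (\<bar>c\<bar> + 1) * \<bar>f x\<bar>" by (simp add: abs_mult mult_right_mono)
      also have "\<dots> < e" using K(3) that pos_less_divide_eq[of "\<bar>c\<bar> + 1" "\<bar>f x\<bar>" e] by (simp add: mult.commute)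
      finally show ?thesis .
    qed
    then show ?thesis using K by blast
  qed
  then show ?thesis using assms by (auto intro!: C_infI continuous_on_mult_left dest: C_inf_continuous_on C_inf_outside)
qed

lemma C_inf_zero: "(\<lambda>x. 0) \<in> C_inf E"
  by (rule C_infI) auto

lemma C_inf_bcontfun:
  assumes "f \<in> C_inf UNIV" shows "f \<in> bcontfun"
proof -
  obtain K where K: "compact K" "\<forall>x\<in>UNIV - K. \<bar>f x\<bar> < 1"
    by (rule C_infE[OF assms zero_less_one])
  have cont: "continuous_on UNIV f" using assms by (simp add: C_inf_def)
  have "bounded (f ` K)"
    by (intro compact_imp_bounded compact_continuous_image K(1) continuous_on_subset[OF cont]) simp
  then obtain B where B: "\<And>x. x \<in> K \<Longrightarrow> \<bar>f x\<bar> \<le> B" unfolding bounded_iff by auto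
  have "\<bar>f x\<bar> \<le> max B 1" for x using B[of x] bspec[OF K(2), of x] by (cases "x \<in> K") auto
  then have "bounded (range f)" unfolding bounded_iff by (intro exI[of _ "max B 1"]) auto
  with cont show ?thesis by (simp add: bcontfun_def)
qed

text \<open>\<open>C_inf UNIV\<close> is a set of plain functions, while the semigroup estimates
  need a Banach space as a type. A subtype of the bounded continuous functions inherits the sup
  norm; completeness then amounts to closedness.\<close>

typedef (overloaded) 'a c0 = "{f :: 'a::topological_space \<Rightarrow>\<^sub>C real. apply_bcontfun f \<in> C_inf UNIV}"
  by (rule exI[of _ 0]) (simp add: zero_bcontfun.rep_eq C_inf_zero)

setup_lifting type_definition_c0

instantiation c0 :: (topological_space) real_normed_vector
begin

lift_definition zero_c0 :: "'a c0" is 0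
  by (simp add: zero_bcontfun.rep_eq C_inf_zero)
lift_definition plus_c0 :: "'a c0 \<Rightarrow> 'a c0 \<Rightarrow> 'a c0" is "(+)"
  by (simp add: plus_bcontfun.rep_eq C_inf_add)
lift_definition scaleR_c0 :: "real \<Rightarrow> 'a c0 \<Rightarrow> 'a c0" is "scaleR"
  by (simp add: scaleR_bcontfun.rep_eq C_inf_scale)
lift_definition uminus_c0 :: "'a c0 \<Rightarrow> 'a c0" is uminus
  using C_inf_scale[where c = "-1"] by (simp add: uminus_bcontfun.rep_eq)
lift_definition minus_c0 :: "'a c0 \<Rightarrow> 'a c0 \<Rightarrow> 'a c0" is minus
  using C_inf_add[OF _ C_inf_scale[where c = "-1"]] by (simp add: minus_bcontfun.rep_eq)
lift_definition norm_c0 :: "'a c0 \<Rightarrow> real" is norm .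
lift_definition dist_c0 :: "'a c0 \<Rightarrow> 'a c0 \<Rightarrow> real" is dist .
lift_definition sgn_c0 :: "'a c0 \<Rightarrow> 'a c0" is sgn
  by (simp add: sgn_bcontfun_def scaleR_bcontfun.rep_eq C_inf_scale)
definition uniformity_c0 :: "('a c0 \<times> 'a c0) filter" where
  "uniformity_c0 = (INF e\<in>{0 <..}. principal {(x, y). dist x y < e})"
definition open_c0 :: "'a c0 set \<Rightarrow> bool" where
  "open_c0 U \<longleftrightarrow> (\<forall>x\<in>U. \<forall>\<^sub>F (x', y) in uniformity. x' = x \<longrightarrow> y \<in> U)"

instance
proof
  fix f g h :: "'a c0" and c d :: real and U
  show "f + g + h = f + (g + h)"
    by (rule Rep_c0_inject[THEN iffD1]) (simp only: plus_c0.rep_eq add.assoc)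
  show "f + g = g + f"
    by (rule Rep_c0_inject[THEN iffD1]) (simp only: plus_c0.rep_eq add.commute)
  show "0 + f = f"
    by (rule Rep_c0_inject[THEN iffD1]) (simp only: plus_c0.rep_eq zero_c0.rep_eq add_0_left)
  show "- f + f = 0"
    by (rule Rep_c0_inject[THEN iffD1]) (simp only: plus_c0.rep_eq uminus_c0.rep_eq zero_c0.rep_eq left_minus)
  show "f - g = f + - g"
    by (rule Rep_c0_inject[THEN iffD1]) (simp only: plus_c0.rep_eq uminus_c0.rep_eq minus_c0.rep_eq diff_conv_add_uminus)
  show "c *\<^sub>R (f + g) = c *\<^sub>R f + c *\<^sub>R g"
    by (rule Rep_c0_inject[THEN iffD1]) (simp only: plus_c0.rep_eq scaleR_c0.rep_eq scaleR_add_right)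
  show "(c + d) *\<^sub>R f = c *\<^sub>R f + d *\<^sub>R f"
    by (rule Rep_c0_inject[THEN iffD1]) (simp only: plus_c0.rep_eq scaleR_c0.rep_eq scaleR_add_left)
  show "c *\<^sub>R d *\<^sub>R f = (c * d) *\<^sub>R f"
    by (rule Rep_c0_inject[THEN iffD1]) (simp only: scaleR_c0.rep_eq scaleR_scaleR)
  show "1 *\<^sub>R f = f"
    by (rule Rep_c0_inject[THEN iffD1]) (simp only: scaleR_c0.rep_eq scaleR_one)
  show "sgn f = inverse (norm f) *\<^sub>R f"
    by (rule Rep_c0_inject[THEN iffD1]) (simp only: sgn_c0.rep_eq scaleR_c0.rep_eq norm_c0.rep_eq sgn_div_norm)
  show "dist f g = norm (f - g)"
    by (simp only: dist_c0.rep_eq minus_c0.rep_eq norm_c0.rep_eq dist_norm)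
  show "norm (f + g) \<le> norm f + norm g"
    unfolding plus_c0.rep_eq norm_c0.rep_eq by (rule norm_triangle_ineq)
  show "norm (c *\<^sub>R f) = \<bar>c\<bar> * norm f"
    by (simp only: scaleR_c0.rep_eq norm_c0.rep_eq norm_scaleR)
  show "(norm f = 0) = (f = 0)"
    using Rep_c0_inject[of f 0] by (simp only: zero_c0.rep_eq norm_c0.rep_eq norm_eq_zero)
qed (rule uniformity_c0_def open_c0_def)+

end

section \<open>Passage between functions and elements of \<open>c0\<close>\<close>

definition ev :: "'a::topological_space c0 \<Rightarrow> 'a \<Rightarrow> real" where
  "ev f = apply_bcontfun (Rep_c0 f)"

definition c0_of :: "('a \<Rightarrow> real) \<Rightarrow> 'a::topological_space c0" where
  "c0_of f = Abs_c0 (Bcontfun f)"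

lemma ev_C_inf [simp]: "ev f \<in> C_inf UNIV"
  using Rep_c0[of f] by (simp add: ev_def)

lemma ev_c0_of [simp]: "f \<in> C_inf UNIV \<Longrightarrow> ev (c0_of f) = f"
  by (simp add: ev_def c0_of_def Abs_c0_inverse Bcontfun_inverse C_inf_bcontfun)

lemma c0_of_ev [simp]: "c0_of (ev f) = f"
  by (simp add: ev_def c0_of_def apply_bcontfun_inverse Rep_c0_inverse)

lemma ev_eqI: "(\<And>x. ev f x = ev g x) \<Longrightarrow> f = g"
  by (metis ext c0_of_ev)

lemma ev_simps [simp]:
  "ev 0 x = 0" "ev (f + g) x = ev f x + ev g x" "ev (f - g) x = ev f x - ev g x"
  "ev (c *\<^sub>R f) x = c * ev f x"
  by (simp_all add: ev_def zero_c0.rep_eq plus_c0.rep_eq minus_c0.rep_eq scaleR_c0.rep_eq)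

lemma ev_sum: "ev (\<Sum>i\<in>I. f i) x = (\<Sum>i\<in>I. ev (f i) x)"
  by (induction I rule: infinite_finite_induct) auto

lemma abs_ev_le: "\<bar>ev f x\<bar> \<le> norm f"
  using norm_bounded[of "Rep_c0 f" x] by (simp add: ev_def norm_c0.rep_eq)

lemma norm_c0_leI: "(\<And>x. \<bar>ev f x\<bar> \<le> B) \<Longrightarrow> norm f \<le> B"
  unfolding norm_c0.rep_eq by (rule norm_bound) (simp add: ev_def)

lemma bounded_linear_ev: "bounded_linear (\<lambda>f. ev f x)"
  by (rule bounded_linear_intro[where K = 1]) (use abs_ev_le in auto)

lemma sup_norm_ev: "sup_norm UNIV (ev f) = norm f"
proof (rule antisym)
  show "sup_norm UNIV (ev f) \<le> norm f"
    unfolding sup_norm_def by (rule cSUP_least) (use abs_ev_le in auto)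
  show "norm f \<le> sup_norm UNIV (ev f)"
    unfolding sup_norm_def
    by (intro norm_c0_leI cSUP_upper) (auto intro!: bdd_aboveI2[where M = "norm f"] abs_ev_le)
qed

lemma tendsto_c0_iff: "(f \<longlongrightarrow> l) F \<longleftrightarrow> uniform_limit UNIV (\<lambda>i. ev (f i)) (ev l) F"
proof
  assume *: "(f \<longlongrightarrow> l) F"
  show "uniform_limit UNIV (\<lambda>i. ev (f i)) (ev l) F"
  proof (rule uniform_limitI)
    fix e :: real assume "0 < e"
    from tendstoD[OF * this] show "\<forall>\<^sub>F n in F. \<forall>x\<in>UNIV. dist (ev (f n) x) (ev l x) < e"
    proof eventually_elim
      case (elim n)
      then have "norm (f n - l) < e" by (simp add: dist_norm)
      then have "\<bar>ev (f n - l) x\<bar> < e" for x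
        by (rule le_less_trans[OF abs_ev_le])
      then show ?case by (simp add: dist_real_def)
    qed
  qed
next
  assume *: "uniform_limit UNIV (\<lambda>i. ev (f i)) (ev l) F"
  show "(f \<longlongrightarrow> l) F"
  proof (rule tendstoI)
    fix e :: real assume e: "0 < e"
    then have "0 < e / 2" by simp
    from uniform_limitD[OF * this] show "\<forall>\<^sub>F n in F. dist (f n) l < e"
    proof eventually_elim
      case (elim n)
      then have "norm (f n - l) \<le> e / 2" by (intro norm_c0_leI) (auto simp: dist_real_def less_imp_le)
      then show ?case using e by (simp add: dist_norm)
    qed
  qed
qed

instance c0 :: (metric_space) banach
proof (intro_classes)
  fix F :: "nat \<Rightarrow> 'a c0" assume C: "Cauchy F"
  have "Cauchy (\<lambda>n. Rep_c0 (F n))"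
  proof (rule metric_CauchyI)
    fix e :: real assume "0 < e"
    from metric_CauchyD[OF C this] show "\<exists>M. \<forall>m\<ge>M. \<forall>n\<ge>M. dist (Rep_c0 (F m)) (Rep_c0 (F n)) < e"
      by (simp only: dist_c0.rep_eq)
  qed
  from Cauchy_convergent_iff[THEN iffD1, OF this] obtain l where l: "(\<lambda>n. Rep_c0 (F n)) \<longlonglongrightarrow> l"
    unfolding convergent_def ..
  have "\<exists>K. compact K \<and> (\<forall>x\<in>UNIV - K. \<bar>apply_bcontfun l x\<bar> < e)" if e: "0 < e" for e :: real
  proof -
    \<comment> \<open>A uniform limit inherits vanishing at infinity: the compact set of an
      approximant at distance below e/2 serves the limit as well.\<close>
    obtain n where n: "dist (Rep_c0 (F n)) l < e / 2"
      using eventually_happens'[OF sequentially_bot tendstoD[OF l half_gt_zero[OF e]]] ..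
    obtain K where K: "compact K" "\<forall>x\<in>UNIV - K. \<bar>ev (F n) x\<bar> < e / 2"
      by (rule C_infE[OF ev_C_inf[of "F n"] half_gt_zero[OF e]])
    have "\<bar>apply_bcontfun l x\<bar> < e" if "x \<notin> K" for x
    proof -
      have "dist (ev (F n) x) (apply_bcontfun l x) < e / 2"
        unfolding ev_def by (rule dist_fun_lt_imp_dist_val_lt[OF n])
      moreover have "\<bar>ev (F n) x\<bar> < e / 2" using bspec[OF K(2), of x] that by simp
      ultimately show ?thesis unfolding dist_real_def by linarith
    qed
    with K(1) show ?thesis by (intro exI[of _ K] conjI ballI) simp_all
  qed
  then have "apply_bcontfun l \<in> C_inf UNIV" by (intro C_infI) simp_all
  then have "Rep_c0 (Abs_c0 l) = l" by (simp add: Abs_c0_inverse)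
  with l have "F \<longlonglongrightarrow> Abs_c0 l" unfolding tendsto_iff dist_c0.rep_eq by simp
  then show "convergent F" by (rule convergentI)
qed

text \<open>\<open>c0_of\<close> is meaningful on \<open>C_inf UNIV\<close> only, so this says
  something only for a \<open>B\<close> that preserves the space, such as \<open>S s\<close> with
  nonnegative \<open>s\<close>.\<close>

definition lift_op :: "(('a::metric_space \<Rightarrow> real) \<Rightarrow> 'a \<Rightarrow> real) \<Rightarrow> 'a c0 \<Rightarrow> 'a c0" where
  "lift_op B f = c0_of (B (ev f))"

context
  fixes S :: "'a::metric_space semigroup"
  assumes S: "feller_semigroup UNIV S"
begin

lemma ev_lift_S: "0 \<le> s \<Longrightarrow> ev (lift_op (S s) f) = S s (ev f)"
  using S by (simp add: lift_op_def feller_semigroup_def)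

lemma contraction_semigroup_lift: "contraction_semigroup (\<lambda>s. lift_op (S s))"
proof -
  have lin: "S s (\<lambda>x. c * ev f x + ev g x) = (\<lambda>x. c * S s (ev f) x + S s (ev g) x)" if "0 \<le> s" for c s and f g :: "'a c0"
    using S that by (simp add: feller_semigroup_def)
  have ext: "ev (c *\<^sub>R f + g) = (\<lambda>x. c * ev f x + ev g x)" for c and f g :: "'a c0" by auto
  have norm: "norm (lift_op (S s) f) \<le> norm f" if "0 \<le> s" for s and f :: "'a c0"
    unfolding sup_norm_ev[symmetric] ev_lift_S[OF that] using S that by (simp add: feller_semigroup_def)
  have bl: "bounded_linear (lift_op (S s))" if s: "0 \<le> s" for s
  proof -
    have comb: "lift_op (S s) (c *\<^sub>R f + g) = c *\<^sub>R lift_op (S s) f + lift_op (S s) g" for c f g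
      by (rule ev_eqI) (simp only: ev_simps ev_lift_S[OF s] ext lin[OF s])
    have 0: "lift_op (S s) 0 = 0" using norm[OF s, of 0] by simp
    show ?thesis
    proof (rule bounded_linear_intro[where K = 1])
      show "lift_op (S s) (f + g) = lift_op (S s) f + lift_op (S s) g" for f g
        using comb[of 1 f g] by simp
      show "lift_op (S s) (c *\<^sub>R f) = c *\<^sub>R lift_op (S s) f" for c f
        using comb[of c f 0] by (simp add: 0)
      show "norm (lift_op (S s) f) \<le> norm f * 1" for f using norm[OF s, of f] by simp
    qed
  qed
  have lim: "((\<lambda>s. lift_op (S s) f) \<longlongrightarrow> f) (at_right 0)" for f
  proof -
    have "uniform_limit UNIV (\<lambda>s. S s (ev f)) (ev f) (at_right 0)"
      using S by (simp add: feller_semigroup_def)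
    then have "uniform_limit UNIV (\<lambda>s. ev (lift_op (S s) f)) (ev f) (at_right 0)"
      by (rule uniform_limit_cong[THEN iffD1, rotated 2])
        (rule eventually_mono[OF eventually_at_right_less[of "0::real"]], simp_all add: ev_lift_S)
    then show ?thesis unfolding tendsto_c0_iff .
  qed
  show ?thesis
  proof (rule contraction_semigroup.intro)
    show "lift_op (S 0) f = f" for f using S by (simp add: lift_op_def feller_semigroup_def)
    show "lift_op (S (s + u)) f = lift_op (S s) (lift_op (S u) f)" if "0 \<le> s" "0 \<le> u" for s u f
      using S that by (simp add: lift_op_def feller_semigroup_def)
  qed (fact bl norm lim)+
qed

interpretation L: contraction_semigroup "\<lambda>s. lift_op (S s)"
  by (rule contraction_semigroup_lift)

lemma generator_graph_iff: "(ev f, ev h) \<in> generator_graph UNIV S \<longleftrightarrow> L.gen_graph f h"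
proof -
  have "uniform_limit UNIV (\<lambda>s x. (S s (ev f) x - ev f x) / s) (ev h) (at_right 0) \<longleftrightarrow>
      uniform_limit UNIV (\<lambda>s. ev ((1 / s) *\<^sub>R (lift_op (S s) f - f))) (ev h) (at_right 0)"
    by (intro uniform_limit_cong eventually_mono[OF eventually_at_right_less[of "0::real"]])
      (simp_all add: ev_lift_S)
  then show ?thesis by (simp add: generator_graph_def L.gen_graph_def tendsto_c0_iff)
qed

lemma gen_eq:
  assumes "L.gen_graph f h" shows "gen UNIV S (ev f) = ev h"
  unfolding gen_def
proof (rule the_equality)
  show "(ev f, ev h) \<in> generator_graph UNIV S" using assms by (simp add: generator_graph_iff)
  fix k assume k: "(ev f, k) \<in> generator_graph UNIV S"
  then have "k \<in> C_inf UNIV" by (simp add: generator_graph_def)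
  then have "k = ev (c0_of k)" by simp
  with k have "L.gen_graph f (c0_of k)" using generator_graph_iff[of f "c0_of k"] by simp
  then show "k = ev h" using L.gen_graph_unique[OF assms] \<open>k = ev (c0_of k)\<close> by simp
qed

lemma gen_dom_iff: "u \<in> gen_dom UNIV S \<longleftrightarrow> (\<exists>f h. u = ev f \<and> L.gen_graph f h)"
proof
  assume "u \<in> gen_dom UNIV S"
  then obtain k where k: "(u, k) \<in> generator_graph UNIV S" by (auto simp: gen_dom_def)
  then have "u = ev (c0_of u)" "k = ev (c0_of k)" by (auto simp: generator_graph_def)
  with k have "L.gen_graph (c0_of u) (c0_of k)" using generator_graph_iff[of "c0_of u" "c0_of k"] by simp
  then show "\<exists>f h. u = ev f \<and> L.gen_graph f h" using \<open>u = ev (c0_of u)\<close> by blast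
next
  assume "\<exists>f h. u = ev f \<and> L.gen_graph f h"
  then show "u \<in> gen_dom UNIV S" unfolding gen_dom_def using generator_graph_iff by blast
qed

text \<open>\<open>resolvent\<close> is defined through \<open>inv_into\<close>, a choice of
  preimage; lam - A is injective on the domain, so the choice is forced.\<close>

lemma resolvent_eq:
  assumes lam: "0 < lam" shows "resolvent UNIV S lam (ev f) = ev (L.R lam f)"
proof -
  have gen_graph: "L.gen_graph (L.R lam f) (lam *\<^sub>R L.R lam f - f)" by (rule L.gen_graph_R[OF lam])
  have inj: "inj_on (\<lambda>u x. lam * u x - gen UNIV S u x) (gen_dom UNIV S)"
  proof (rule inj_onI)
    fix u v assume "u \<in> gen_dom UNIV S" "v \<in> gen_dom UNIV S"
      and eq: "(\<lambda>x. lam * u x - gen UNIV S u x) = (\<lambda>x. lam * v x - gen UNIV S v x)"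
    from gen_dom_iff[THEN iffD1, OF this(1)] gen_dom_iff[THEN iffD1, OF this(2)]
    obtain p h q k where uv: "u = ev p" "L.gen_graph p h" "v = ev q" "L.gen_graph q k"
      by (elim exE conjE)
    have "lam * ev p x - ev h x = lam * ev q x - ev k x" for x
      using fun_cong[OF eq, of x] by (simp add: uv gen_eq[OF uv(2)] gen_eq[OF uv(4)])
    then have *: "lam *\<^sub>R p - h = lam *\<^sub>R q - k" by (intro ev_eqI) simp
    have "h = lam *\<^sub>R p - (lam *\<^sub>R q - k)" unfolding *[symmetric] by simp
    with uv have "L.gen_graph p (lam *\<^sub>R p - (lam *\<^sub>R q - k))" "L.gen_graph q (lam *\<^sub>R q - (lam *\<^sub>R q - k))" by simp_all
    from L.gen_graph_inj[OF this lam] show "u = v" by (simp add: uv)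
  qed
  have "(\<lambda>x. lam * ev (L.R lam f) x - gen UNIV S (ev (L.R lam f)) x) = ev f"
    by (simp add: gen_eq[OF gen_graph])
  moreover have "ev (L.R lam f) \<in> gen_dom UNIV S" using gen_graph by (subst gen_dom_iff) (intro exI[of _ "L.R lam f"] exI[of _ "lam *\<^sub>R L.R lam f - f"] conjI refl)
  ultimately show ?thesis unfolding resolvent_def using inv_into_f_f[OF inj, of "ev (L.R lam f)"] by simp
qed

lemma yosida_eq:
  assumes lam: "0 < lam" shows "yosida UNIV S lam (ev f) = ev (L.yos lam f)"
  by (rule ext) (simp add: yosida_def resolvent_eq[OF lam] gen_eq[OF L.gen_graph_R[OF lam]] L.yos_alt[OF lam])

lemma yosida_pow_eq: "0 < lam \<Longrightarrow> (yosida UNIV S lam ^^ n) (ev f) = ev ((L.yos lam ^^ n) f)"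
  by (induction n) (auto simp: yosida_eq)

end

section \<open>Functions of time and space as continuous curves in \<open>c0\<close>\<close>

lemma C_inf_section:
  assumes g: "g \<in> C_inf ({a..b} \<times> UNIV)"
  shows "(\<lambda>y. g (r, y)) \<in> C_inf UNIV"
proof (cases "r \<in> {a..b}")
  case True
  have c: "continuous_on UNIV (\<lambda>y. g (r, y))"
    by (rule continuous_on_compose2[of "{a..b} \<times> UNIV" g])
      (use C_inf_continuous_on[OF g] True in \<open>auto intro!: continuous_on_Pair\<close>)
  have "\<exists>K. compact K \<and> (\<forall>x\<in>UNIV - K. \<bar>g (r, x)\<bar> < e)" if e: "0 < e" for e :: real
  proof -
    obtain K where K: "compact K" "K \<subseteq> {a..b} \<times> UNIV" "\<forall>x\<in>{a..b} \<times> UNIV - K. \<bar>g x\<bar> < e"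
      by (rule C_infE[OF g e])
    have "compact (snd ` K)" by (intro compact_continuous_image K continuous_on_snd continuous_on_id)
    moreover have "\<bar>g (r, x)\<bar> < e" if "x \<in> UNIV - snd ` K" for x
    proof -
      from that
      have "(r, x) \<notin> K" by force
      then show "\<bar>g (r, x)\<bar> < e" using K(3) True by simp
    qed
    ultimately show ?thesis by blast
  qed
  with c show ?thesis by (intro C_infI) auto
next
  case False
  then have "(\<lambda>y. g (r, y)) = (\<lambda>y. 0)" using C_inf_outside[OF g] by auto
  then show ?thesis by (simp add: C_inf_zero)
qed

text \<open>Uniform continuity over the compact projection \<open>L\<close> is combined with
  smallness off \<open>L\<close>, where both values are below e/4. The gain is that the sections of
  \<open>g\<close> form a compact subset of \<open>c0\<close>, as
  \<open>expo_tendsto_uniform\<close> requires.\<close>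

lemma continuous_on_section:
  fixes g :: "real \<times> 'a::metric_space \<Rightarrow> real"
  assumes g: "g \<in> C_inf ({a..b} \<times> UNIV)"
  shows "continuous_on {a..b} (\<lambda>r. c0_of (\<lambda>y. g (r, y)))"
  unfolding continuous_on_iff
proof (intro ballI allI impI)
  fix r e :: real assume r: "r \<in> {a..b}" and e: "0 < e"
  have e4: "0 < e / 4" using e by simp
  obtain K where K: "compact K" "K \<subseteq> {a..b} \<times> UNIV" "\<forall>x\<in>{a..b} \<times> UNIV - K. \<bar>g x\<bar> < e / 4"
    by (rule C_infE[OF g e4])
  define L where "L = snd ` K"
  have L: "compact L" unfolding L_def by (intro compact_continuous_image K continuous_on_snd continuous_on_id)
  have "uniformly_continuous_on ({a..b} \<times> L) g"
    by (rule compact_uniformly_continuous[OF continuous_on_subset[OF C_inf_continuous_on[OF g]]])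
      (auto intro: compact_Times L)
  from this[unfolded uniformly_continuous_on_def, rule_format, OF half_gt_zero[OF e]]
  have "\<exists>d>0. \<forall>z\<in>{a..b} \<times> L. \<forall>z'\<in>{a..b} \<times> L. dist z' z < d \<longrightarrow> dist (g z') (g z) < e / 2"
    by (elim exE conjE) (intro exI conjI ballI impI; auto)
  then obtain d where d: "0 < d"
    "\<forall>z\<in>{a..b} \<times> L. \<forall>z'\<in>{a..b} \<times> L. dist z' z < d \<longrightarrow> dist (g z') (g z) < e / 2"
    by (elim exE conjE)
  have "dist (c0_of (\<lambda>y. g (q, y))) (c0_of (\<lambda>y. g (r, y))) < e" if q: "q \<in> {a..b}" "dist q r < d" for q
  proof -
    have "\<bar>g (q, y) - g (r, y)\<bar> \<le> e / 2" for y
    proof (cases "y \<in> L")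
      case True
      then show ?thesis using bspec[OF bspec[OF d(2), of "(r, y)"], of "(q, y)"] q r by (simp add: dist_Pair_Pair dist_real_def)
    next
      case False
      then have "(r, y) \<notin> K" "(q, y) \<notin> K" unfolding L_def using image_eqI[of y snd "(r, y)" K] image_eqI[of y snd "(q, y)" K] by auto
      then have "\<bar>g (r, y)\<bar> < e / 4" "\<bar>g (q, y)\<bar> < e / 4" using bspec[OF K(3), of "(r, y)"] bspec[OF K(3), of "(q, y)"] q r by simp_all
      then show ?thesis by linarith
    qed
    then have "norm (c0_of (\<lambda>y. g (q, y)) - c0_of (\<lambda>y. g (r, y))) \<le> e / 2"
      by (intro norm_c0_leI) (simp add: C_inf_section[OF g])
    then show ?thesis using e by (simp add: dist_norm)
  qed
  then show "\<exists>d>0. \<forall>x'\<in>{a..b}. dist x' r < d \<longrightarrow> dist (c0_of (\<lambda>y. g (x', y))) (c0_of (\<lambda>y. g (r, y))) < e"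
    using d(1) by (intro exI[of _ d] conjI ballI impI)
qed

section \<open>Feller processes\<close>

lemma C_inf_bounded:
  assumes f: "f \<in> C_inf E" obtains B where "0 \<le> B" "\<forall>x. \<bar>f x\<bar> \<le> B"
proof -
  obtain K where K: "compact K" "K \<subseteq> E" "\<forall>x\<in>E - K. \<bar>f x\<bar> < 1"
    by (rule C_infE[OF f zero_less_one])
  have "bounded (f ` K)"
    by (rule compact_imp_bounded[OF compact_continuous_image[OF continuous_on_subset[OF C_inf_continuous_on[OF f] K(2)] K(1)]])
  then obtain B where B: "\<And>x. x \<in> K \<Longrightarrow> \<bar>f x\<bar> \<le> B" unfolding bounded_iff by auto
  have "\<bar>f x\<bar> \<le> max B 1" for x
  proof (cases "x \<in> K")
    case False
    then show ?thesis using K(3) C_inf_outside[OF f, of x] by (cases "x \<in> E") force+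
  qed (use B[of x] in auto)
  then show thesis using that[of "max B 1"] by auto
qed

lemma C_inf_borel:
  assumes f: "f \<in> C_inf E" and "closed E" shows "f \<in> borel_measurable borel"
proof -
  have "(\<lambda>x. indicator E x *\<^sub>R f x) \<in> borel_measurable borel"
    using assms by (intro borel_measurable_continuous_on_indicator C_inf_continuous_on[OF f]) auto
  moreover have "(\<lambda>x. indicator E x *\<^sub>R f x) = f"
    using C_inf_outside[OF f] by (auto simp: indicator_def fun_eq_iff)
  ultimately show ?thesis by simp
qed

text \<open>Time is rounded to a grid point on its right: a fixed grid has countably many time
  values, and refining it reaches the limit by right continuity.\<close>

lemma right_continuous_jointly_measurable:
  fixes f :: "real \<Rightarrow> 'w \<Rightarrow> real"
  assumes meas: "\<And>s. 0 \<le> s \<Longrightarrow> f s \<in> borel_measurable N"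
    and rc: "\<And>s \<omega>. 0 \<le> s \<Longrightarrow> \<omega> \<in> space N \<Longrightarrow> ((\<lambda>u. f u \<omega>) \<longlongrightarrow> f s \<omega>) (at_right s)"
  shows "(\<lambda>(s, \<omega>). f (max s 0) \<omega>) \<in> borel_measurable (borel \<Otimes>\<^sub>M N)"
proof (rule borel_measurable_LIMSEQ_real)
  \<comment> \<open>The added 1 keeps the grid point strictly above the time, because the filter
    \<open>at_right\<close> excludes the time itself.\<close>
  define v where "v k s = (real (nat \<lfloor>real (Suc k) * max s 0\<rfloor>) + 1) / real (Suc k)" for k and s :: real
  show "(\<lambda>(s, \<omega>). f (v k s) \<omega>) \<in> borel_measurable (borel \<Otimes>\<^sub>M N)" for k
  proof -
    have "(\<lambda>z. (\<lambda>(s, \<omega>). f ((real i + 1) / real (Suc k)) \<omega>) z) \<in> borel_measurable (borel \<Otimes>\<^sub>M N)" for i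
      using meas[of "(real i + 1) / real (Suc k)"] by (simp add: measurable_snd'' case_prod_unfold)
    moreover have "(\<lambda>z. nat \<lfloor>real (Suc k) * max (fst z) 0\<rfloor>) \<in> measurable (borel \<Otimes>\<^sub>M N) (count_space UNIV)"
      by measurable
    ultimately have "(\<lambda>z. (\<lambda>(s, \<omega>). f ((real (nat \<lfloor>real (Suc k) * max (fst z) 0\<rfloor>) + 1) / real (Suc k)) \<omega>) z) \<in> borel_measurable (borel \<Otimes>\<^sub>M N)"
      by (rule measurable_compose_countable)
    then show ?thesis
      by (simp only: v_def case_prod_unfold)
  qed
  fix z :: "real \<times> 'w" assume "z \<in> space (borel \<Otimes>\<^sub>M N)"
  then obtain s \<omega> where z: "z = (s, \<omega>)" "\<omega> \<in> space N" by (auto simp: space_pair_measure)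
  let ?s = "max s 0"
  have gt: "?s < v k s" and le: "v k s \<le> ?s + 1 / real (Suc k)" for k
  proof -
    have p: "0 < real (Suc k)" by simp
    have "real (nat \<lfloor>real (Suc k) * ?s\<rfloor>) = of_int \<lfloor>real (Suc k) * ?s\<rfloor>" by simp
    then have "real (Suc k) * ?s < real (nat \<lfloor>real (Suc k) * ?s\<rfloor>) + 1"
      "real (nat \<lfloor>real (Suc k) * ?s\<rfloor>) \<le> real (Suc k) * ?s" by linarith+
    then show "?s < v k s" "v k s \<le> ?s + 1 / real (Suc k)"
      unfolding v_def by (simp_all add: pos_less_divide_eq[OF p] pos_divide_le_eq[OF p] mult.commute[of _ "real (Suc k)"] distrib_left del: of_nat_Suc)
  qed
  have "(\<lambda>k. v k s) \<longlonglongrightarrow> ?s"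
  proof (rule tendsto_sandwich[where f = "\<lambda>k. ?s" and h = "\<lambda>k. ?s + 1 / real (Suc k)"])
    show "(\<lambda>k. ?s + 1 / real (Suc k)) \<longlonglongrightarrow> ?s"
      using tendsto_add[OF tendsto_const LIMSEQ_inverse_real_of_nat, of ?s] by (simp add: inverse_eq_divide)
    show "\<forall>\<^sub>F k in sequentially. ?s \<le> v k s"
      by (rule always_eventually, rule allI, rule less_imp_le, rule gt)
    show "\<forall>\<^sub>F k in sequentially. v k s \<le> ?s + 1 / real (Suc k)"
      by (rule always_eventually, rule allI, rule le)
  qed (rule tendsto_const)
  then have "filterlim (\<lambda>k. v k s) (at_right ?s) sequentially"
    using gt by (simp add: filterlim_at less_imp_neq[symmetric])
  from filterlim_compose[OF rc[OF _ z(2), of ?s] this]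
  show "(\<lambda>k. case z of (s, \<omega>) \<Rightarrow> f (v k s) \<omega>) \<longlonglongrightarrow> (case z of (s, \<omega>) \<Rightarrow> f (max s 0) \<omega>)"
    by (simp add: z)
qed

section \<open>Measurability and right limits of processes with a cemetery\<close>

lemma space_option_borel [simp]: "space option_borel = UNIV"
  by (simp add: option_borel_def)

lemma Some_image_option_borel: "B \<in> sets borel \<Longrightarrow> Some ` B \<in> sets option_borel"
  by (auto simp: option_borel_def sets_measure_of_conv)

lemma extend0_measurable:
  fixes f :: "'a::topological_space \<Rightarrow> real"
  assumes "f \<in> borel_measurable borel"
  shows "extend0 f \<in> borel_measurable option_borel"
proof (rule measurableI)
  fix A :: "real set" assume A: "A \<in> sets borel"
  have N: "{None} \<in> sets (option_borel :: 'a option measure)"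
  proof -
    have "{None} = space option_borel - Some ` (UNIV :: 'a set)" by (auto simp: notin_range_Some)
    moreover have "Some ` (UNIV :: 'a set) \<in> sets option_borel" by (rule Some_image_option_borel) auto
    ultimately show ?thesis by (metis sets.compl_sets)
  qed
  have "extend0 f -` A \<inter> space option_borel = Some ` (f -` A) \<union> (if 0 \<in> A then {None} else {})"
    by (auto split: option.splits if_splits)
  moreover have "Some ` (f -` A) \<in> sets option_borel"
    by (rule Some_image_option_borel) (use measurable_sets_borel[OF assms A] in simp)
  ultimately show "extend0 f -` A \<inter> space option_borel \<in> sets option_borel"
    using N sets.Un[of "Some ` (f -` A)" option_borel "{None}"] by auto
qed simp

lemma measurable_the_Some:
  fixes X :: "'w \<Rightarrow> 'a::topological_space"
  assumes "(\<lambda>\<omega>. Some (X \<omega>)) \<in> measurable N option_borel" shows "X \<in> borel_measurable N"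
proof (rule measurableI)
  fix A :: "'a set" assume "A \<in> sets borel"
  from measurable_sets[OF assms Some_image_option_borel[OF this]]
  show "X -` A \<inter> space N \<in> sets N" by (simp add: vimage_def inj_image_mem_iff)
qed simp

lemma
  shows space_path_sigma [simp]: "space (path_sigma M X J) = space M"
    and path_sigma_component: "u \<in> J \<Longrightarrow> X u \<in> measurable (path_sigma M X J) option_borel"
    and path_sigma_subset: "(\<And>u. u \<in> J \<Longrightarrow> X u \<in> measurable M option_borel) \<Longrightarrow> sets (path_sigma M X J) \<subseteq> sets M"
proof -
  let ?F = "\<lambda>\<omega>. \<lambda>u\<in>J. X u \<omega>"
  show "space (path_sigma M X J) = space M" by (simp add: path_sigma_def)
  have F: "?F \<in> measurable (path_sigma M X J) (PiM J (\<lambda>_. option_borel))"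
    unfolding path_sigma_def by (rule measurable_vimage_algebra1) (auto simp: space_PiM)
  show "X u \<in> measurable (path_sigma M X J) option_borel" if "u \<in> J"
    using measurable_compose[OF F measurable_component_singleton[OF that]] that by simp
  show "sets (path_sigma M X J) \<subseteq> sets M" if "\<And>u. u \<in> J \<Longrightarrow> X u \<in> measurable M option_borel"
    unfolding path_sigma_def by (rule sets_image_in_sets[OF refl measurable_restrict]) (use that in auto)
qed

text \<open>Neighbourhoods of \<open>None\<close> in the one-point compactification are complements
  of compact sets, and vanishing at infinity is smallness off a compact set; so the extension by 0
  is continuous there.\<close>

lemma cadlag_extend0:
  fixes E :: "'a::t2_space set"
  assumes c: "cadlag E w" and s: "0 \<le> s" and f: "f \<in> C_inf E" and ws: "w s \<in> insert None (Some ` E)"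
  shows "((\<lambda>u. extend0 f (w u)) \<longlongrightarrow> extend0 f (w s)) (at_right s)"
proof (rule tendstoI)
  fix e :: real assume e: "0 < e"
  have lim: "limitin (Alexandroff_compactification (top_of_set E)) w (w s) (at_right s)"
    using c s by (simp add: cadlag_def)
  have "\<exists>V. openin (Alexandroff_compactification (top_of_set E)) V \<and> w s \<in> V \<and> (\<forall>z\<in>V. dist (extend0 f z) (extend0 f (w s)) < e)"
  proof (cases "w s")
    case None
    obtain K where K: "compact K" "K \<subseteq> E" "\<forall>x\<in>E - K. \<bar>f x\<bar> < e"
      by (rule C_infE[OF f e])
    have "closedin (top_of_set E) K" using K by (auto intro: closed_subset compact_imp_closed)
    moreover have "compactin (top_of_set E) K" using K by (simp add: compactin_subtopology)
    ultimately have "openin (Alexandroff_compactification (top_of_set E)) (insert None (Some ` (topspace (top_of_set E) - K)))"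
      unfolding openin_Alexandroff_compactification by blast
    then show ?thesis
      by (intro exI[of _ "insert None (Some ` (topspace (top_of_set E) - K))"] conjI) (use K(3) None e in auto)
  next
    case (Some x)
    then have x: "x \<in> E" using ws by auto
    have "openin (top_of_set E) (E \<inter> f -` ball (f x) e)"
      using C_inf_continuous_on[OF f] continuous_openin_preimage_gen by blast
    then have "openin (Alexandroff_compactification (top_of_set E)) (Some ` (E \<inter> f -` ball (f x) e))"
      by simp
    then show ?thesis
      by (intro exI[of _ "Some ` (E \<inter> f -` ball (f x) e)"] conjI) (use x Some e in \<open>auto simp: dist_commute\<close>)
  qed
  then obtain V where V: "openin (Alexandroff_compactification (top_of_set E)) V" "w s \<in> V"
    "\<forall>z\<in>V. dist (extend0 f z) (extend0 f (w s)) < e" by (elim exE conjE)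
  from limitinD[OF lim V(1,2)] show "\<forall>\<^sub>F u in at_right s. dist (extend0 f (w u)) (extend0 f (w s)) < e"
    by eventually_elim (use V(3) in auto)
qed

lemma cadlag_Some:
  fixes w :: "real \<Rightarrow> 'a::metric_space"
  assumes c: "cadlag E (\<lambda>s. Some (w s))" and s: "0 \<le> s" and ws: "w s \<in> E"
  shows "(w \<longlongrightarrow> w s) (at_right s)"
proof (rule tendstoI)
  fix e :: real assume e: "0 < e"
  have lim: "limitin (Alexandroff_compactification (top_of_set E)) (\<lambda>s. Some (w s)) (Some (w s)) (at_right s)"
    using c s by (simp add: cadlag_def)
  have "openin (Alexandroff_compactification (top_of_set E)) (Some ` (E \<inter> ball (w s) e))"
    by (simp add: openin_open_Int)
  from limitinD[OF lim this] have "\<forall>\<^sub>F u in at_right s. Some (w u) \<in> Some ` (E \<inter> ball (w s) e)"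
    using ws e by simp
  then show "\<forall>\<^sub>F u in at_right s. dist (w u) (w s) < e"
    by eventually_elim (auto simp: dist_commute)
qed

text \<open>The Markov property between times 0 and \<open>u\<close>, integrated: at time 0 the
  process sits at \<open>x\<close> almost surely, so the conditional expectation is almost surely
  the constant \<open>T u f x\<close>.\<close>

lemma feller_process_expectation:
  assumes M: "prob_space M" and X: "feller_process M E T x X" and E: "closed E" "x \<in> E"
    and f: "f \<in> C_inf E" and u: "0 \<le> u"
  shows "(LINT \<omega>|M. extend0 f (X u \<omega>)) = T u f x"
proof -
  interpret prob_space M by (rule M)
  let ?F = "path_sigma M X {0..0}"
  have meas: "X s \<in> measurable M option_borel" if "0 \<le> s" for s
    using X that by (simp add: feller_process_def)
  have "subalgebra M ?F"
    unfolding subalgebra_def using path_sigma_subset[of "{0..0}" X M] meas by simp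
  then interpret finite_measure_subalgebra M ?F
    by unfold_locales
  obtain B where B: "0 \<le> B" "\<forall>x. \<bar>f x\<bar> \<le> B" by (rule C_inf_bounded[OF f])
  have int: "integrable M (\<lambda>\<omega>. extend0 f (X u \<omega>))"
  proof (rule integrable_const_bound[where B = B])
    show "(\<lambda>\<omega>. extend0 f (X u \<omega>)) \<in> borel_measurable M"
      by (rule measurable_compose[OF meas[OF u] extend0_measurable[OF C_inf_borel[OF f E(1)]]])
    show "AE \<omega> in M. norm (extend0 f (X u \<omega>)) \<le> B"
      using B by (auto split: option.split)
  qed
  have "(LINT \<omega>|M. extend0 f (X u \<omega>)) = (LINT \<omega>|M. real_cond_exp M ?F (\<lambda>\<omega>. extend0 f (X u \<omega>)) \<omega>)"
    by (rule real_cond_exp_int(2)[OF int, symmetric])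
  also have "\<dots> = (LINT \<omega>|M. T u f x)"
  proof (rule integral_cong_AE)
    have "AE \<omega> in M. real_cond_exp M ?F (\<lambda>\<omega>. extend0 f (X u \<omega>)) \<omega> = extend0 (T (u - 0) f) (X 0 \<omega>)"
    proof -
      have "\<forall>s\<ge>0. \<forall>u\<ge>s. \<forall>f\<in>C_inf E. AE \<omega> in M.
          real_cond_exp M (path_sigma M X {0..s}) (\<lambda>\<omega>. extend0 f (X u \<omega>)) \<omega> = extend0 (T (u - s) f) (X s \<omega>)"
        using X unfolding feller_process_def by (elim conjE)
      from this[rule_format, of 0 u f] show ?thesis using u f by simp
    qed
    moreover have "AE \<omega> in M. X 0 \<omega> = Some x" using X by (simp add: feller_process_def)
    ultimately show "AE \<omega> in M. real_cond_exp M ?F (\<lambda>\<omega>. extend0 f (X u \<omega>)) \<omega> = T u f x"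
      by eventually_elim simp
  qed auto
  also have "\<dots> = T u f x" by (simp add: prob_space)
  finally show ?thesis .
qed

section \<open>Exponential Lyapunov functions\<close>

lemma C_inf_of_exp_bound:
  assumes h: "continuous_on {..b} h" and bd: "\<And>t. t \<le> b \<Longrightarrow> \<bar>h t\<bar> \<le> B * exp (\<mu> * t)" and \<mu>: "0 < \<mu>" and B: "0 \<le> B"
  shows "(\<lambda>t::real. if t \<le> b then h t else 0) \<in> C_inf {..b}"
proof (rule C_infI)
  show "continuous_on {..b} (\<lambda>t. if t \<le> b then h t else 0)"
    by (rule continuous_on_eq[OF h]) simp
  fix e :: real assume e: "0 < e"
  \<comment> \<open>The point where (B + 1) exp(\<mu> c) = e; the added 1 covers
    \<open>B = 0\<close>.\<close>
  define c where "c = ln (e / (B + 1)) / \<mu>"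
  show "\<exists>K. compact K \<and> K \<subseteq> {..b} \<and> (\<forall>x\<in>{..b} - K. \<bar>if x \<le> b then h x else 0\<bar> < e)"
  proof (intro exI[of _ "{c..b}"] conjI ballI)
    fix t assume t: "t \<in> {..b} - {c..b}"
    then have "t < c" by auto
    then have "\<mu> * t < ln (e / (B + 1))" using \<mu> by (simp add: c_def field_simps)
    then have "exp (\<mu> * t) < e / (B + 1)" using e B by (metis add_nonneg_pos divide_pos_pos exp_less_cancel_iff exp_ln zero_less_one)
    then have "(B + 1) * exp (\<mu> * t) < e" using B by (simp add: pos_less_divide_eq mult.commute)
    moreover have "B * exp (\<mu> * t) \<le> (B + 1) * exp (\<mu> * t)" by (intro mult_right_mono) auto
    moreover have tb: "t \<le> b" using t by simp
    ultimately have "\<bar>h t\<bar> < e" using bd[OF tb] by linarith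
    then show "\<bar>if t \<le> b then h t else 0\<bar> < e" using tb by simp
  qed auto
qed auto

text \<open>Brings the exponential weight under the integrability condition with min(1, r) in
  \<open>H0\<close>.\<close>

lemma one_minus_exp_le: 
  assumes "0 < \<mu>" "0 < (r::real)" shows "1 - exp (- (\<mu> * r)) \<le> max 1 \<mu> * min 1 r" "0 \<le> 1 - exp (- (\<mu> * r))"
proof -
  have 1: "1 - exp (- (\<mu> * r)) \<le> \<mu> * r" using exp_ge_add_one_self[of "- (\<mu> * r)"] by linarith
  have 2: "1 - exp (- (\<mu> * r)) \<le> 1" by simp
  have 3: "\<mu> * r \<le> max 1 \<mu> * r" using assms by (intro mult_right_mono) auto
  show "1 - exp (- (\<mu> * r)) \<le> max 1 \<mu> * min 1 r"
  proof (cases "r \<le> 1")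
    case False
    then have "max 1 \<mu> * min 1 r = max 1 \<mu>" by simp
    then show ?thesis using 2 max.cobounded1[of 1 \<mu>] by linarith
  qed (use 1 3 in simp)
  show "0 \<le> 1 - exp (- (\<mu> * r))" using assms by simp
qed

section \<open>The action of the generator on exponentials\<close>

context
  fixes \<nu> :: "real \<Rightarrow> real \<Rightarrow> real"
  assumes nn: "\<And>t r. 0 < r \<Longrightarrow> 0 \<le> \<nu> t r" and H0: "H0 \<nu>"
begin

text \<open>Extension by 0 to nonpositive \<open>r\<close> lets all kernel integrals run over the
  whole of \<open>lborel\<close>.\<close>

definition "ldens t r = (if 0 < r then \<nu> t r else 0)"
definition "ldens_deriv t r = (if 0 < r then deriv (\<lambda>t. \<nu> t r) t else 0)"

lemma ldens_measurable: "(\<lambda>(t, r). ldens t r) \<in> borel_measurable (borel \<Otimes>\<^sub>M borel)"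
proof -
  have "continuous_on (UNIV \<times> {0<..}) (\<lambda>(t, r). \<nu> t r)" using H0 by (simp add: H0_def)
  then have "(\<lambda>p. indicator (UNIV \<times> {0<..}) p *\<^sub>R (\<lambda>(t, r). \<nu> t r) p) \<in> borel_measurable borel"
    by (intro borel_measurable_continuous_on_indicator) (auto intro!: borel_open open_Times)
  moreover have "(\<lambda>p. indicator (UNIV \<times> {0<..}) p *\<^sub>R (\<lambda>(t, r). \<nu> t r) p) = (\<lambda>(t, r). ldens t r)"
    by (auto simp: fun_eq_iff ldens_def indicator_def)
  ultimately show ?thesis by (simp add: borel_prod)
qed

lemma ldens_measurable1 [measurable]: "ldens t \<in> borel_measurable borel"
  using measurable_compose[OF measurable_Pair1' ldens_measurable, of t] by simp

lemma ldens_deriv_has: "0 < r \<Longrightarrow> ((\<lambda>t. ldens t r) has_real_derivative ldens_deriv t r) (at t)"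
proof -
  assume r: "0 < r"
  have "(\<lambda>t. \<nu> t r) differentiable (at t)"
    using H0 r by (simp add: H0_def differentiable_on_def)
  then show ?thesis
    using r by (simp add: ldens_def ldens_deriv_def DERIV_deriv_iff_real_differentiable)
qed

lemma ldens_deriv_cont: "0 < r \<Longrightarrow> continuous_on UNIV (\<lambda>t. ldens_deriv t r)"
  using H0 by (simp add: H0_def ldens_deriv_def)

text \<open>\<open>H0\<close> makes the derivative continuous in \<open>t\<close> for each fixed
  \<open>r\<close>. Joint measurability, which Fubini needs in \<open>lexp_lipschitz\<close>, comes
  from difference quotients of the jointly measurable density.\<close>

lemma ldens_deriv_measurable: "(\<lambda>(t, r). ldens_deriv t r) \<in> borel_measurable (borel \<Otimes>\<^sub>M borel)"
proof (rule borel_measurable_LIMSEQ_real)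
  let ?h = "\<lambda>k. 1 / real (Suc k)"
  have [measurable]: "(\<lambda>p. ldens (fst p) (snd p)) \<in> borel_measurable (borel \<Otimes>\<^sub>M borel)"
    using ldens_measurable by (simp add: case_prod_unfold)
  have "(\<lambda>p. ldens (fst p + ?h k) (snd p)) \<in> borel_measurable (borel \<Otimes>\<^sub>M borel)" for k
  proof -
    have "(\<lambda>p. (fst p + ?h k, snd p)) \<in> measurable (borel \<Otimes>\<^sub>M borel) (borel \<Otimes>\<^sub>M borel :: (real \<times> real) measure)"
      by measurable
    from measurable_compose[OF this ldens_measurable] show ?thesis by simp
  qed
  then show "(\<lambda>p. (ldens (fst p + ?h k) (snd p) - ldens (fst p) (snd p)) / ?h k) \<in> borel_measurable (borel \<Otimes>\<^sub>M borel)" for k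
    by measurable
  fix p :: "real \<times> real"
  show "(\<lambda>k. (ldens (fst p + ?h k) (snd p) - ldens (fst p) (snd p)) / ?h k) \<longlonglongrightarrow> (case p of (t, r) \<Rightarrow> ldens_deriv t r)"
  proof (cases "0 < snd p")
    case True
    have "((\<lambda>h. (ldens (fst p + h) (snd p) - ldens (fst p) (snd p)) / h) \<longlongrightarrow> ldens_deriv (fst p) (snd p)) (at 0)"
      using ldens_deriv_has[OF True, of "fst p"] by (simp add: DERIV_def)
    moreover have "filterlim ?h (at 0) sequentially"
      using LIMSEQ_inverse_real_of_nat by (auto simp: filterlim_at inverse_eq_divide)
    ultimately have "(\<lambda>k. (ldens (fst p + ?h k) (snd p) - ldens (fst p) (snd p)) / ?h k) \<longlonglongrightarrow> ldens_deriv (fst p) (snd p)"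
      by (rule filterlim_compose)
    then show ?thesis by (simp add: case_prod_unfold)
  next
    case False
    then show ?thesis by (simp add: case_prod_unfold ldens_def ldens_deriv_def)
  qed
qed

lemma ldens_bound: obtains C where "0 \<le> C" "\<And>t. (\<integral>\<^sup>+r. ennreal (min 1 r * ldens t r) \<partial>lborel) \<le> ennreal C"
proof -
  define s where "s = (SUP t. \<integral>\<^sup>+r\<in>{0<..}. ennreal (min 1 r * \<nu> t r) \<partial>lborel)"
  have "s < \<infinity>" using H0 unfolding H0_def s_def by (elim conjE)
  then have s: "s = ennreal (enn2real s)" by simp
  have "(\<integral>\<^sup>+r. ennreal (min 1 r * ldens t r) \<partial>lborel) \<le> ennreal (enn2real s)" for t
  proof -
    have "(\<integral>\<^sup>+r. ennreal (min 1 r * ldens t r) \<partial>lborel) = (\<integral>\<^sup>+r\<in>{0<..}. ennreal (min 1 r * \<nu> t r) \<partial>lborel)"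
      by (rule nn_integral_cong) (auto simp: ldens_def indicator_def)
    also have "\<dots> \<le> s" unfolding s_def by (rule SUP_upper) simp
    finally show ?thesis using s by simp
  qed
  then show thesis by (intro that[of "enn2real s"]) auto
qed

lemma ldens_deriv_bound: obtains C where "0 \<le> C" "\<And>t. (\<integral>\<^sup>+r. ennreal (min 1 r * \<bar>ldens_deriv t r\<bar>) \<partial>lborel) \<le> ennreal C"
proof -
  define s where "s = (SUP t. \<integral>\<^sup>+r\<in>{0<..}. ennreal (min 1 r * \<bar>deriv (\<lambda>t. \<nu> t r) t\<bar>) \<partial>lborel)"
  have "s < \<infinity>" using H0 unfolding H0_def s_def by (elim conjE)
  then have s: "s = ennreal (enn2real s)" by simp
  have "(\<integral>\<^sup>+r. ennreal (min 1 r * \<bar>ldens_deriv t r\<bar>) \<partial>lborel) \<le> ennreal (enn2real s)" for t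
  proof -
    have "(\<integral>\<^sup>+r. ennreal (min 1 r * \<bar>ldens_deriv t r\<bar>) \<partial>lborel) = (\<integral>\<^sup>+r\<in>{0<..}. ennreal (min 1 r * \<bar>deriv (\<lambda>t. \<nu> t r) t\<bar>) \<partial>lborel)"
      by (rule nn_integral_cong) (auto simp: ldens_deriv_def indicator_def)
    also have "\<dots> \<le> s" unfolding s_def by (rule SUP_upper) simp
    finally show ?thesis using s by simp
  qed
  then show thesis by (intro that[of "enn2real s"]) auto
qed

context
  fixes \<mu> :: real assumes \<mu>: "0 < \<mu>"
begin

definition "expw r = (if 0 < r then 1 - exp (- (\<mu> * r)) else 0)"
text \<open>The Laplace exponent at \<mu> of the jump measure with density \<open>\<nu> t\<close>,
  frozen at \<open>t\<close>: the exponential exp(\<mu> t) is multiplied by - lexp t when - D_+ acts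
  on it.\<close>

definition "lexp t = (LINT r|lborel. expw r * ldens t r)"

lemma expw_measurable [measurable]: "expw \<in> borel_measurable borel"
  unfolding expw_def by measurable

lemma expw_bounds: "0 \<le> expw r" "0 < r \<Longrightarrow> expw r \<le> max 1 \<mu> * min 1 r"
  using one_minus_exp_le[OF \<mu>, of r] by (auto simp: expw_def)

lemma expw_ldens_nonneg: "0 \<le> expw r * ldens t r"
  using nn expw_bounds by (auto simp: ldens_def)

lemma expw_ldens_nn_integral:
  assumes C: "\<And>t. (\<integral>\<^sup>+r. ennreal (min 1 r * ldens t r) \<partial>lborel) \<le> ennreal C"
  shows "(\<integral>\<^sup>+r. ennreal (expw r * ldens t r) \<partial>lborel) \<le> ennreal (max 1 \<mu> * C)"
proof -
  have "(\<integral>\<^sup>+r. ennreal (expw r * ldens t r) \<partial>lborel) \<le> (\<integral>\<^sup>+r. ennreal (max 1 \<mu>) * ennreal (min 1 r * ldens t r) \<partial>lborel)"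
  proof (rule nn_integral_mono)
    fix r
    have "expw r * ldens t r \<le> (max 1 \<mu> * min 1 r) * ldens t r"
      using nn expw_bounds by (cases "0 < r") (auto simp: ldens_def intro!: mult_right_mono)
    then show "ennreal (expw r * ldens t r) \<le> ennreal (max 1 \<mu>) * ennreal (min 1 r * ldens t r)"
      using \<mu> by (subst ennreal_mult'[symmetric]) (auto intro!: ennreal_leI simp: mult.assoc)
  qed
  also have "\<dots> = ennreal (max 1 \<mu>) * (\<integral>\<^sup>+r. ennreal (min 1 r * ldens t r) \<partial>lborel)"
    by (rule nn_integral_cmult) measurable
  also have "\<dots> \<le> ennreal (max 1 \<mu>) * ennreal C" by (intro mult_left_mono C) simp
  also have "\<dots> = ennreal (max 1 \<mu> * C)" using \<mu> by (simp add: ennreal_mult')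
  finally show ?thesis .
qed

lemma expw_ldens_integrable: "integrable lborel (\<lambda>r. expw r * ldens t r)"
proof -
  obtain C where C: "0 \<le> C" "\<And>t. (\<integral>\<^sup>+r. ennreal (min 1 r * ldens t r) \<partial>lborel) \<le> ennreal C" using ldens_bound by blast
  show ?thesis
    by (rule integrableI_nonneg) (use expw_ldens_nonneg expw_ldens_nn_integral[OF C(2), of t] in \<open>auto intro: le_less_trans\<close>)
qed

lemma lexp_bound: obtains C where "0 \<le> C" "\<And>t. \<bar>lexp t\<bar> \<le> C"
proof -
  obtain C where C: "0 \<le> C" "\<And>t. (\<integral>\<^sup>+r. ennreal (min 1 r * ldens t r) \<partial>lborel) \<le> ennreal C" using ldens_bound by blast
  have "\<bar>lexp t\<bar> \<le> max 1 \<mu> * C" for t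
  proof -
    have "0 \<le> lexp t" unfolding lexp_def by (rule integral_nonneg_AE) (use expw_ldens_nonneg in auto)
    moreover have "ennreal (lexp t) \<le> ennreal (max 1 \<mu> * C)"
      unfolding lexp_def using nn_integral_eq_integral[OF expw_ldens_integrable, of t] expw_ldens_nonneg expw_ldens_nn_integral[OF C(2), of t] by simp
    ultimately show ?thesis using C \<mu> by (subst (asm) ennreal_le_iff) auto
  qed
  then show thesis using C by (intro that[of "max 1 \<mu> * C"]) auto
qed

lemma ldens_increment:
  assumes "t \<le> t'"
  shows "ennreal \<bar>ldens t' r - ldens t r\<bar> \<le> (\<integral>\<^sup>+v\<in>{t..t'}. ennreal \<bar>ldens_deriv v r\<bar> \<partial>lborel)"
proof (cases "0 < r")
  case True
  have cont: "isCont (\<lambda>t. ldens_deriv t r) v" for v using ldens_deriv_cont[OF True] continuous_on_eq_continuous_at by blast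
  have "has_bochner_integral lborel (\<lambda>v. ldens_deriv v r * indicator {t..t'} v) (ldens t' r - ldens t r)"
    by (rule has_bochner_integral_FTC_Icc_real[OF assms ldens_deriv_has[OF True] cont])
  then have i: "integrable lborel (\<lambda>v. ldens_deriv v r * indicator {t..t'} v)" "(LINT v|lborel. ldens_deriv v r * indicator {t..t'} v) = ldens t' r - ldens t r"
    by (auto simp: has_bochner_integral_iff)
  have "ennreal (norm (LINT v|lborel. ldens_deriv v r * indicator {t..t'} v)) \<le> (\<integral>\<^sup>+v. ennreal (norm (ldens_deriv v r * indicator {t..t'} v)) \<partial>lborel)"
    by (rule integral_norm_bound_ennreal[OF i(1)])
  also have "\<dots> = (\<integral>\<^sup>+v\<in>{t..t'}. ennreal \<bar>ldens_deriv v r\<bar> \<partial>lborel)"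
    by (rule nn_integral_cong) (auto simp: indicator_def)
  finally show ?thesis by (simp add: i)
qed (simp add: ldens_def)

text \<open>The increment of the density is an integral of its \<open>t\<close>-derivative;
  exchanging the integrals over \<open>r\<close> and over [t, t'] leaves the uniform bound from
  \<open>H0\<close> times t' - t. Continuity of \<open>lexp\<close> follows, without which the
  exponentials could not be placed in the core.\<close>

lemma lexp_lipschitz:
  obtains C where "0 \<le> C" "\<And>t t'. t \<le> t' \<Longrightarrow> \<bar>lexp t' - lexp t\<bar> \<le> C * (t' - t)"
proof -
  obtain C where C: "0 \<le> C" "\<And>t. (\<integral>\<^sup>+r. ennreal (min 1 r * \<bar>ldens_deriv t r\<bar>) \<partial>lborel) \<le> ennreal C" using ldens_deriv_bound by blast
  have [measurable]: "(\<lambda>p. ldens_deriv (fst p) (snd p)) \<in> borel_measurable (borel \<Otimes>\<^sub>M borel)"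
    using ldens_deriv_measurable by (simp add: case_prod_unfold)
  have [measurable]: "ldens_deriv v \<in> borel_measurable borel" for v
    using measurable_compose[OF measurable_Pair1' ldens_deriv_measurable, of v] by simp
  have [measurable]: "(\<lambda>v. ldens_deriv v r) \<in> borel_measurable borel" for r
    using measurable_compose[OF measurable_Pair2' ldens_deriv_measurable, of r] by simp
  have "\<bar>lexp t' - lexp t\<bar> \<le> (max 1 \<mu> * C) * (t' - t)" if t: "t \<le> t'" for t t'
  proof -
    have eq: "lexp t' - lexp t = (LINT r|lborel. expw r * (ldens t' r - ldens t r))"
      unfolding lexp_def by (subst Bochner_Integration.integral_diff[symmetric]) (auto intro: expw_ldens_integrable simp: right_diff_distrib)
    have int: "integrable lborel (\<lambda>r. expw r * (ldens t' r - ldens t r))"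
      using Bochner_Integration.integrable_diff[OF expw_ldens_integrable[of t'] expw_ldens_integrable[of t]] by (simp add: right_diff_distrib)
    have "ennreal \<bar>lexp t' - lexp t\<bar> \<le> (\<integral>\<^sup>+r. ennreal (norm (expw r * (ldens t' r - ldens t r))) \<partial>lborel)"
      unfolding eq real_norm_def[symmetric] by (rule integral_norm_bound_ennreal[OF int])
    also have "\<dots> \<le> (\<integral>\<^sup>+r. \<integral>\<^sup>+v. ennreal (max 1 \<mu>) * (ennreal (min 1 r * \<bar>ldens_deriv v r\<bar>) * indicator {t..t'} v) \<partial>lborel \<partial>lborel)"
    proof (rule nn_integral_mono)
      fix r
      show "ennreal (norm (expw r * (ldens t' r - ldens t r))) \<le> (\<integral>\<^sup>+v. ennreal (max 1 \<mu>) * (ennreal (min 1 r * \<bar>ldens_deriv v r\<bar>) * indicator {t..t'} v) \<partial>lborel)"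
      proof (cases "0 < r")
        case True
        have "ennreal (norm (expw r * (ldens t' r - ldens t r))) = ennreal (expw r) * ennreal \<bar>ldens t' r - ldens t r\<bar>"
          using expw_bounds by (simp add: abs_mult ennreal_mult')
        also have "\<dots> \<le> ennreal (max 1 \<mu> * min 1 r) * (\<integral>\<^sup>+v\<in>{t..t'}. ennreal \<bar>ldens_deriv v r\<bar> \<partial>lborel)"
          by (intro mult_mono ldens_increment[OF t] ennreal_leI expw_bounds True) auto
        also have "\<dots> = (\<integral>\<^sup>+v. ennreal (max 1 \<mu> * min 1 r) * (ennreal \<bar>ldens_deriv v r\<bar> * indicator {t..t'} v) \<partial>lborel)"
          by (intro nn_integral_cmult[symmetric]) measurable
        also have "\<dots> = (\<integral>\<^sup>+v. ennreal (max 1 \<mu>) * (ennreal (min 1 r * \<bar>ldens_deriv v r\<bar>) * indicator {t..t'} v) \<partial>lborel)"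
          using True \<mu> by (intro nn_integral_cong) (simp add: ennreal_mult' mult.assoc)
        finally show ?thesis .
      qed (simp add: expw_def)
    qed
    also have "\<dots> = (\<integral>\<^sup>+v. \<integral>\<^sup>+r. ennreal (max 1 \<mu>) * (ennreal (min 1 r * \<bar>ldens_deriv v r\<bar>) * indicator {t..t'} v) \<partial>lborel \<partial>lborel)"
      by (rule lborel_pair.Fubini') measurable
    also have "\<dots> = (\<integral>\<^sup>+v. ennreal (max 1 \<mu>) * ((\<integral>\<^sup>+r. ennreal (min 1 r * \<bar>ldens_deriv v r\<bar>) \<partial>lborel) * indicator {t..t'} v) \<partial>lborel)"
      by (intro nn_integral_cong, subst nn_integral_cmult, measurable, subst nn_integral_multc, measurable)
    also have "\<dots> \<le> (\<integral>\<^sup>+v. ennreal (max 1 \<mu>) * (ennreal C * indicator {t..t'} v) \<partial>lborel)"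
      by (intro nn_integral_mono mult_left_mono mult_right_mono C) auto
    also have "\<dots> = ennreal (max 1 \<mu>) * (ennreal C * ennreal (t' - t))"
      using t by (simp add: nn_integral_cmult)
    also have "\<dots> = ennreal ((max 1 \<mu> * C) * (t' - t))"
      using C t \<mu> by (simp add: ennreal_mult' mult.assoc)
    finally show ?thesis
      using C t \<mu> by (subst (asm) ennreal_le_iff) auto
  qed
  then show thesis using C by (intro that[of "max 1 \<mu> * C"]) auto
qed

lemma lexp_continuous: "continuous_on UNIV lexp"
proof -
  obtain C where C: "0 \<le> C" "\<And>t t'. t \<le> t' \<Longrightarrow> \<bar>lexp t' - lexp t\<bar> \<le> C * (t' - t)" using lexp_lipschitz by blast
  have "C-lipschitz_on UNIV lexp"
  proof (rule lipschitz_onI)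
    fix x y :: real
    show "dist (lexp x) (lexp y) \<le> C * dist x y"
      using C(2)[of x y] C(2)[of y x] by (cases "x \<le> y") (auto simp: dist_real_def abs_minus_commute)
  qed fact
  then show ?thesis by (rule lipschitz_on_continuous_on)
qed

text \<open>Only jumps of size about 1/\<mu> are kept. On [1/(2\<mu>), 1/\<mu>] the weight is at
  least 1 - exp(-1/2) >= 1/3 and the kernel at least C \<mu>^(1+\<beta>); the interval has length
  1/(2\<mu>), and 1/3 times 1/2 is the constant 1/6.\<close>

lemma lexp_lower:
  assumes C: "0 < C" "0 < \<beta>" and H: "\<And>t r. 0 < r \<Longrightarrow> C * r powr (- 1 - \<beta>) \<le> \<nu> t r"
  shows "C * \<mu> powr \<beta> / 6 \<le> lexp t"
proof -
  let ?I = "{1 / (2 * \<mu>) .. 1 / \<mu>}"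
  have p: "0 < 1 / (2 * \<mu>)" "1 / (2 * \<mu>) \<le> 1 / \<mu>" using \<mu> by (auto simp: field_simps)
  have "(LINT r|lborel. (C / 3 * \<mu> powr (1 + \<beta>)) * indicator ?I r) \<le> lexp t"
    unfolding lexp_def
  proof (rule integral_mono[OF _ expw_ldens_integrable])
    show "integrable lborel (\<lambda>r. (C / 3 * \<mu> powr (1 + \<beta>)) * indicator ?I r)"
      using p by (intro integrable_mult_right integrable_real_indicator) auto
    fix r :: real
    show "(C / 3 * \<mu> powr (1 + \<beta>)) * indicator ?I r \<le> expw r * ldens t r"
    proof (cases "r \<in> ?I")
      case True
      then have r: "0 < r" "r \<le> 1 / \<mu>" "1 / (2 * \<mu>) \<le> r"
        using less_le_trans[OF p(1)] by auto
      then have "1 / 2 \<le> \<mu> * r" using \<mu> by (simp add: field_simps)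
      then have "exp (- (\<mu> * r)) \<le> exp (- (1 / 2))" by simp
      moreover have "exp (- (1 / 2)) \<le> (2 / 3 :: real)"
        using exp_ge_add_one_self[of "1 / 2 :: real"] by (simp add: exp_minus field_simps)
      ultimately have "exp (- (\<mu> * r)) \<le> 2 / 3" by (rule order_trans)
      then have "1 / 3 \<le> expw r" using r(1) unfolding expw_def by simp
      have "(1 / \<mu>) powr (- 1 - \<beta>) \<le> r powr (- 1 - \<beta>)"
        using r C \<mu> by (intro powr_mono2') auto
      also have "(1 / \<mu>) powr (- 1 - \<beta>) = \<mu> powr (1 + \<beta>)"
        using \<mu> powr_minus[of \<mu> "1 + \<beta>"] powr_minus[of "1 / \<mu>" "1 + \<beta>"] by (simp add: powr_divide)
      finally have "C * \<mu> powr (1 + \<beta>) \<le> ldens t r"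
        using H[OF r(1), of t] C r unfolding ldens_def by (simp add: order_trans[OF mult_left_mono])
      then have "1 / 3 * (C * \<mu> powr (1 + \<beta>)) \<le> expw r * ldens t r"
        using \<open>1 / 3 \<le> expw r\<close> C by (intro mult_mono) auto
      then show ?thesis using True by simp
    qed (use expw_ldens_nonneg in simp)
  qed
  moreover have "(LINT r|lborel. (C / 3 * \<mu> powr (1 + \<beta>)) * indicator ?I r) = (C / 3 * \<mu> powr (1 + \<beta>)) * (1 / \<mu> - 1 / (2 * \<mu>))"
    using p by simp
  moreover have "\<dots> = C * \<mu> powr \<beta> / 6"
    using \<mu> by (simp add: powr_add field_simps)
  ultimately show ?thesis by simp
qed

lemma minus_D_exp:
  "minus_D b \<nu> (\<lambda>t. if t \<le> b then exp (\<mu> * t) else 0) = (\<lambda>t. if t \<le> b then - exp (\<mu> * t) * lexp t else 0)"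
proof
  fix t
  let ?u = "\<lambda>t. if t \<le> b then exp (\<mu> * t) else 0"
  have "(LINT r:{0<..}|lborel. (?u (t - r) - ?u t) * \<nu> t r) = (LINT r|lborel. - exp (\<mu> * t) * (expw r * ldens t r))" if "t \<le> b"
    unfolding set_lebesgue_integral_def
    using that by (intro Bochner_Integration.integral_cong) 
      (auto simp: expw_def ldens_def indicator_def exp_diff exp_minus field_simps)
  then show "minus_D b \<nu> ?u t = (if t \<le> b then - exp (\<mu> * t) * lexp t else 0)"
    by (simp add: minus_D_def lexp_def)
qed

text \<open>The exponential, its derivative and its image under - D_+ are all bounded by a multiple
  of exp(\<mu> t), so they vanish at minus infinity; the end point \<open>b\<close> belongs to the
  state space and imposes no decay.\<close>

lemma exp_in_D_core: "(\<lambda>t. if t \<le> b then exp (\<mu> * t) else 0) \<in> D_core b \<nu>"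
proof -
  obtain C where C: "0 \<le> C" "\<And>t. \<bar>lexp t\<bar> \<le> C" using lexp_bound by blast
  have 1: "(\<lambda>t. if t \<le> b then exp (\<mu> * t) else 0) \<in> C_inf {..b}"
    by (rule C_inf_of_exp_bound[OF _ _ \<mu>, of _ _ 1]) (auto intro!: continuous_intros)
  have 2: "(\<lambda>t. if t \<le> b then \<mu> * exp (\<mu> * t) else 0) \<in> C_inf {..b}"
    by (rule C_inf_of_exp_bound[OF _ _ \<mu>, of _ _ \<mu>]) (use \<mu> in \<open>auto intro!: continuous_intros simp: abs_mult\<close>)
  have 3: "(\<lambda>t. if t \<le> b then - exp (\<mu> * t) * lexp t else 0) \<in> C_inf {..b}"
  proof (rule C_inf_of_exp_bound[OF _ _ \<mu> C(1)])
    show "continuous_on {..b} (\<lambda>t. - exp (\<mu> * t) * lexp t)"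
      by (intro continuous_intros continuous_on_subset[OF lexp_continuous]) auto
    show "\<bar>- exp (\<mu> * t) * lexp t\<bar> \<le> C * exp (\<mu> * t)" for t
      using mult_left_mono[OF C(2)[of t], of "exp (\<mu> * t)"] by (simp add: abs_mult mult.commute)
  qed
  have 4: "((\<lambda>t. if t \<le> b then exp (\<mu> * t) else 0) has_real_derivative (if t \<le> b then \<mu> * exp (\<mu> * t) else 0)) (at t within {..b})" if "t \<le> b" for t
  proof -
    have "((\<lambda>t. exp (\<mu> * t)) has_real_derivative \<mu> * exp (\<mu> * t)) (at t within {..b})"
      by (auto intro!: derivative_eq_intros)
    then have "((\<lambda>t. if t \<le> b then exp (\<mu> * t) else 0) has_real_derivative \<mu> * exp (\<mu> * t)) (at t within {..b})"
      by (rule has_field_derivative_transform_within[where d = 1]) (use that in auto)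
    then show ?thesis using that by simp
  qed
  show ?thesis
    unfolding D_core_def C1_inf_def minus_D_exp
    using 1 3[folded minus_D_exp] by (intro CollectI conjI bexI[OF _ 2] allI impI 4) auto
qed

end

lemma ex_lyapunov:
  assumes H1b: "H1b \<nu>" and K: "0 < K"
  obtains \<mu> where "0 < \<mu>" "(\<lambda>t. if t \<le> b then exp (\<mu> * t) else 0) \<in> D_core b \<nu>"
    "\<forall>t\<le>b. minus_D b \<nu> (\<lambda>t. if t \<le> b then exp (\<mu> * t) else 0) t \<le> - K * exp (\<mu> * t)"
proof -
  obtain C \<beta> where C: "0 < C" "0 < \<beta>" "\<And>t r. 0 < r \<Longrightarrow> C * r powr (- 1 - \<beta>) \<le> \<nu> t r"
    using H1b unfolding H1b_def by force
  \<comment> \<open>Solves C \<mu>^\<beta> / 6 = K, with the bound of \<open>lexp_lower\<close> on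
    the left. Every \<open>K\<close> is reached because \<beta> > 0.\<close>
  define \<mu> where "\<mu> = (6 * K / C) powr (1 / \<beta>)"
  have \<mu>: "0 < \<mu>" using C K by (simp add: \<mu>_def)
  have "\<mu> powr \<beta> = 6 * K / C" using C K by (simp add: \<mu>_def powr_powr)
  then have "K \<le> lexp \<mu> t" for t
    using lexp_lower[OF \<mu> C, of t] C by simp
  then have "\<forall>t\<le>b. minus_D b \<nu> (\<lambda>t. if t \<le> b then exp (\<mu> * t) else 0) t \<le> - K * exp (\<mu> * t)"
    by (simp add: minus_D_exp[OF \<mu>] mult.commute)
  with \<mu> exp_in_D_core[OF \<mu>] that show thesis by blast
qed

end

text \<open>Read off from the representation as an expectation; \<open>0 \<le> c\<close> accounts
  for the cemetery, where the function counts as 0.\<close>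

lemma feller_process_upper:
  assumes M: "prob_space M" and X: "feller_process M E T x X" and E: "closed E" "x \<in> E"
    and f: "f \<in> C_inf E" and u: "0 \<le> u" and c: "0 \<le> c" "\<And>y. y \<in> E \<Longrightarrow> f y \<le> c"
  shows "T u f x \<le> c"
proof -
  interpret prob_space M by (rule M)
  have "(LINT \<omega>|M. extend0 f (X u \<omega>)) \<le> c"
  proof (rule integral_le_const)
    have [measurable]: "X u \<in> measurable M option_borel" using X u by (simp add: feller_process_def)
    obtain B where B: "0 \<le> B" "\<forall>x. \<bar>f x\<bar> \<le> B" by (rule C_inf_bounded[OF f])
    show "integrable M (\<lambda>\<omega>. extend0 f (X u \<omega>))"
    proof (rule integrable_const_bound[where B = B])
      show "(\<lambda>\<omega>. extend0 f (X u \<omega>)) \<in> borel_measurable M"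
        by (rule measurable_compose[OF _ extend0_measurable[OF C_inf_borel[OF f E(1)]]]) measurable
      show "AE \<omega> in M. norm (extend0 f (X u \<omega>)) \<le> B"
        using B by (auto split: option.split)
    qed
    show "AE \<omega> in M. extend0 f (X u \<omega>) \<le> c"
      using c C_inf_outside[OF f] by (intro AE_I2) (auto split: option.split, metis)
  qed
  then show ?thesis by (simp add: feller_process_expectation[OF M X E f u])
qed

text \<open>A discrete Gronwall argument. Over a short step r the Lyapunov inequality gives T_r u <=
  (1 - K r) u + r e uniformly on \<open>E\<close>, because the generator is a uniform limit. Pushing
  this through T_v and iterating n = s/r times gives (1 - K r)^n u + s e, and 1 - K r <= exp(- K
  r).\<close>

lemma semigroup_exp_decay:
  assumes T: "feller_semigroup E T"
    and upper: "\<And>s f c. 0 \<le> s \<Longrightarrow> f \<in> C_inf E \<Longrightarrow> 0 \<le> c \<Longrightarrow> (\<And>y. y \<in> E \<Longrightarrow> f y \<le> c) \<Longrightarrow> T s f x \<le> c"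
    and gr: "(u, h) \<in> generator_graph E T" and u: "\<And>y. y \<in> E \<Longrightarrow> 0 \<le> u y" and x: "x \<in> E"
    and h: "\<And>y. y \<in> E \<Longrightarrow> h y \<le> - K * u y" and K: "0 < K" and s: "0 \<le> s"
  shows "T s u x \<le> exp (- (K * s)) * u x"
proof -
  have uC: "u \<in> C_inf E" and lim: "uniform_limit E (\<lambda>s x. (T s u x - u x) / s) h (at_right 0)"
    using gr by (auto simp: generator_graph_def)
  have TC: "T r u \<in> C_inf E" if "0 \<le> r" for r
    using T uC that by (simp add: feller_semigroup_def)
  have step: "\<exists>d>0. \<forall>r v. 0 < r \<longrightarrow> r < d \<longrightarrow> 0 \<le> v \<longrightarrow> T (v + r) u x \<le> (1 - K * r) * T v u x + r * e" if e: "0 < e" for e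
  proof -
    from uniform_limitD[OF lim e] obtain d where d: "0 < d"
      "\<And>r. 0 < r \<Longrightarrow> r < d \<Longrightarrow> \<forall>y\<in>E. dist ((T r u y - u y) / r) (h y) < e"
      by (auto simp: eventually_at_right_field)
    have "T (v + r) u x \<le> (1 - K * r) * T v u x + r * e" if r: "0 < r" "r < d" and v: "0 \<le> v" for r v
    proof -
      \<comment> \<open>With the whole inequality on one side, linearity of \<open>T v\<close> and
        the upper bound by a constant suffice.\<close>
      let ?f = "\<lambda>y. (- (1 - K * r)) * u y + T r u y"
      have "?f y \<le> r * e" if y: "y \<in> E" for y
      proof -
        have "(T r u y - u y) / r < h y + e" using d(2)[OF r] y by (auto simp: dist_real_def abs_less_iff)
        then have "T r u y - u y < r * (h y + e)" using r by (simp add: pos_divide_less_eq mult.commute)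
        moreover have "r * h y \<le> r * (- K * u y)" using h[OF y] r by (intro mult_left_mono) auto
        ultimately show ?thesis by (simp add: algebra_simps)
      qed
      then have "T v ?f x \<le> r * e"
        using r e v by (intro upper C_inf_add C_inf_scale uC TC) auto
      moreover have "T v ?f = (\<lambda>x. (- (1 - K * r)) * T v u x + T v (T r u) x)"
        using T v uC TC[of r] r by (simp only: feller_semigroup_def)
      moreover have "T (v + r) u = T v (T r u)"
        using T v uC r by (simp add: feller_semigroup_def)
      ultimately show ?thesis by (simp add: algebra_simps)
    qed
    with d(1) show ?thesis by blast
  qed
  have bound: "T s u x \<le> exp (- (K * s)) * u x + s * e" if e: "0 < e" for e
  proof (cases "s = 0")
    case True
    then show ?thesis using T uC by (simp add: feller_semigroup_def)
  next
    case False
    then have s: "0 < s" using s by simp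
    obtain d where d: "0 < d" "\<And>r v. 0 < r \<Longrightarrow> r < d \<Longrightarrow> 0 \<le> v \<Longrightarrow> T (v + r) u x \<le> (1 - K * r) * T v u x + r * e"
      using step[OF e] by blast
    \<comment> \<open>So many steps that their length is below \<open>d\<close>, for the one-step
      estimate, and below 1 / K, for a nonnegative factor 1 - K r.\<close>
    obtain n :: nat where n: "s / min d (1 / K) < real n"
      using reals_Archimedean2 by blast
    have m: "0 < min d (1 / K)" using d K by simp
    then have n0: "0 < real n" using n s by (meson divide_pos_pos less_trans)
    define r where "r = s / real n"
    have "s < real n * min d (1 / K)" using n m by (simp add: pos_divide_less_eq)
    then have r: "0 < r" "r < min d (1 / K)"
      unfolding r_def using n0 s by (simp_all only: pos_divide_less_eq mult.commute divide_pos_pos)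
    then have r': "r < d" "0 \<le> 1 - K * r" "1 - K * r \<le> 1"
      using K by (auto simp: pos_less_divide_eq mult.commute)
    have "T (real j * r) u x \<le> (1 - K * r) ^ j * u x + real j * r * e" for j
    proof (induction j)
      case 0
      then show ?case using T uC by (simp add: feller_semigroup_def)
    next
      case (Suc j)
      have "T (real (Suc j) * r) u x = T (real j * r + r) u x" by (simp add: algebra_simps)
      also have "\<dots> \<le> (1 - K * r) * T (real j * r) u x + r * e"
        using d(2)[OF r(1) r'(1)] r by simp
      also have "\<dots> \<le> (1 - K * r) * ((1 - K * r) ^ j * u x + real j * r * e) + r * e"
        using r' Suc by (intro add_right_mono mult_left_mono) auto
      also have "\<dots> \<le> (1 - K * r) ^ Suc j * u x + real j * r * e + r * e"
        using mult_right_mono[OF r'(3), of "real j * r * e"] r e by (simp add: algebra_simps)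
      finally show ?case by (simp add: algebra_simps)
    qed
    from this[of n] have "T s u x \<le> (1 - K * r) ^ n * u x + s * e"
      using n0 by (simp add: r_def)
    also have "(1 - K * r) ^ n \<le> exp (- (K * r)) ^ n"
      using r'(2) exp_ge_add_one_self[of "- (K * r)"] by (intro power_mono) auto
    also have "exp (- (K * r)) ^ n = exp (- (K * s))"
      using n0 by (simp add: exp_of_nat_mult[symmetric] r_def)
    finally show ?thesis using u[OF x] by (simp add: mult_right_mono)
  qed
  show ?thesis
  proof (rule field_le_epsilon)
    fix e :: real assume e: "0 < e"
    have "T s u x \<le> exp (- (K * s)) * u x + s * (e / (s + 1))" using e s by (intro bound) auto
    also have "s * (e / (s + 1)) \<le> e" using e s by (simp add: field_simps)
    finally show "T s u x \<le> exp (- (K * s)) * u x + e" by simp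
  qed
qed

section \<open>The killed process and its iterated potentials\<close>

text \<open>The kernel of (n+1)-fold integration in time. The cutoff at negative times lets
  convolutions run over the whole line; \<open>tpow 0\<close> is the indicator of [0,
  \<infinity>).\<close>

definition tpow :: "nat \<Rightarrow> real \<Rightarrow> real" where
  "tpow n s = (if 0 \<le> s then s ^ n / fact n else 0)"

definition texp :: "real \<Rightarrow> real \<Rightarrow> real" where
  "texp c s = (if 0 \<le> s then exp (- (c * s)) else 0)"

lemma tpow_measurable [measurable]: "tpow n \<in> borel_measurable borel"
  unfolding tpow_def by measurable

lemma texp_measurable [measurable]: "texp c \<in> borel_measurable borel"
  unfolding texp_def by measurable

lemma tpow_nonneg: "0 \<le> tpow n s" by (simp add: tpow_def)
lemma texp_nonneg: "0 \<le> texp c s" by (simp add: texp_def)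

lemma power_over_fact_le_exp: 
  assumes "0 \<le> (s::real)" shows "s ^ n / fact n \<le> exp s"
proof -
  have "(\<Sum>k\<in>{n}. s ^ k /\<^sub>R fact k) \<le> (\<Sum>k. s ^ k /\<^sub>R fact k)"
    by (rule sum_le_suminf[OF summable_exp_generic]) (use assms in auto)
  then show ?thesis by (simp add: exp_def divide_inverse mult.commute)
qed

lemma tpow_le_exp: "tpow n s \<le> (if 0 \<le> s then exp s else 0)"
  by (simp add: tpow_def power_over_fact_le_exp)

lemma texp_integrable:
  assumes "0 < c" shows "integrable lborel (texp c)"
proof -
  have "integrable lborel (\<lambda>s. indicator {0<..} s *\<^sub>R exp (- (s * c)))"
    using integrable_I0i_exp_mscale[OF assms] by (simp add: set_integrable_def)
  moreover have "AE s in lborel. indicator {0<..} s *\<^sub>R exp (- (s * c)) = texp c s"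
    using AE_lborel_singleton[of "0::real"]
    by eventually_elim (auto simp: texp_def indicator_def mult.commute)
  ultimately show ?thesis by (subst (asm) integrable_cong_AE) auto
qed

text \<open>Convolution of \<open>tpow n\<close> with \<open>tpow 0\<close>, the step from one
  iterate to the next.\<close>

lemma integral_tpow: "0 \<le> v \<Longrightarrow> (LINT u|lborel. tpow n u * indicator {..v} u) = tpow (Suc n) v"
proof -
  assume v: "0 \<le> v"
  have "(LINT u|lborel. tpow n u * indicator {..v} u) = (LINT u|lborel. (1 / fact n) * (u ^ n * indicator {0..v} u))"
    by (rule Bochner_Integration.integral_cong) (auto simp: tpow_def indicator_def)
  also have "\<dots> = (1 / fact n) * (v ^ Suc n / real (Suc n))"
    using integral_power[OF v, of n] by (subst integral_mult_right_zero) simp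
  also have "\<dots> = tpow (Suc n) v" using v by (simp add: tpow_def mult.commute)
  finally show ?thesis .
qed

text \<open>The integrability test behind the exchanges of integrals in
  \<open>\<Phi>_Suc\<close>.\<close>

lemma (in pair_sigma_finite) integrable_product_bound:
  fixes f :: "_ \<Rightarrow> real"
  assumes [measurable]: "f \<in> borel_measurable (M1 \<Otimes>\<^sub>M M2)"
    and g: "integrable M1 g" and h: "integrable M2 h"
    and bd: "\<And>x y. x \<in> space M1 \<Longrightarrow> y \<in> space M2 \<Longrightarrow> \<bar>f (x, y)\<bar> \<le> g x * h y"
  shows "integrable (M1 \<Otimes>\<^sub>M M2) f"
proof (rule Bochner_Integration.integrable_bound)
  have [measurable]: "g \<in> borel_measurable M1" "h \<in> borel_measurable M2" using g h by auto
  show "integrable (M1 \<Otimes>\<^sub>M M2) (\<lambda>p. g (fst p) * h (snd p))"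
  proof (rule Fubini_integrable)
    show "integrable M1 (\<lambda>x. LINT y|M2. norm (g (fst (x, y)) * h (snd (x, y))))"
      using g by (simp add: abs_mult)
    show "AE x in M1. integrable M2 (\<lambda>y. g (fst (x, y)) * h (snd (x, y)))"
      using h by simp
  qed measurable
  show "AE p in M1 \<Otimes>\<^sub>M M2. norm (f p) \<le> norm (g (fst p) * h (snd p))"
    using bd by (intro AE_I2) (force simp: space_pair_measure intro: order_trans)
qed measurable

text \<open>The kernel \<nu> acts on the rest of the argument through \<open>tail\<close>: survival
  decays in time faster than every exponential, uniformly in the starting point.\<close>

locale killed_process = prob_space M for M :: "'w measure" +
  fixes a b :: real and T :: "real semigroup" and X :: "real \<Rightarrow> real \<Rightarrow> 'w \<Rightarrow> real"
  assumes ab: "a < b"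
    and T_feller: "feller_semigroup {..b} T"
    and X_process: "\<And>t. t \<le> b \<Longrightarrow> feller_process M {..b} T t (lift_process (X t))"
    and X_mono: "\<And>t s u \<omega>. t \<le> b \<Longrightarrow> 0 \<le> s \<Longrightarrow> s \<le> u \<Longrightarrow> \<omega> \<in> space M \<Longrightarrow> X t u \<omega> \<le> X t s \<omega>"
    and tail: "\<And>K. 0 < K \<Longrightarrow> \<exists>C\<ge>0. \<forall>t\<le>b. \<forall>s\<ge>0. prob {\<omega>\<in>space M. a < X t s \<omega>} \<le> C * exp (- (K * s))"
begin

lemma X_measurable [measurable]: "t \<le> b \<Longrightarrow> 0 \<le> s \<Longrightarrow> X t s \<in> borel_measurable M"
  by (rule measurable_the_Some) (use X_process[of t] in \<open>simp add: feller_process_def\<close>)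

lemma X_le_b: "t \<le> b \<Longrightarrow> 0 \<le> s \<Longrightarrow> \<omega> \<in> space M \<Longrightarrow> X t s \<omega> \<le> b"
  using X_process[of t] unfolding feller_process_def by auto

lemma X_rc: "t \<le> b \<Longrightarrow> 0 \<le> s \<Longrightarrow> \<omega> \<in> space M \<Longrightarrow> ((\<lambda>u. X t u \<omega>) \<longlongrightarrow> X t s \<omega>) (at_right s)"
  by (rule cadlag_Some[where E = "{..b}"])
    (use X_process[of t] X_le_b[of t s \<omega>] in \<open>auto simp: feller_process_def\<close>)

lemma X0: "t \<le> b \<Longrightarrow> AE \<omega> in M. X t 0 \<omega> = t"
  using X_process[of t] by (simp add: feller_process_def)

lemma X_le: "t \<le> b \<Longrightarrow> AE \<omega> in M. \<forall>s\<ge>0. X t s \<omega> \<le> t"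
proof -
  assume t: "t \<le> b"
  show ?thesis using X0[OF t] AE_space by eventually_elim (use X_mono[OF t, of 0] in force)
qed

lemma X_joint: "t \<le> b \<Longrightarrow> (\<lambda>p. X t (max (fst p) 0) (snd p)) \<in> borel_measurable (borel \<Otimes>\<^sub>M M)"
  using right_continuous_jointly_measurable[of "X t" M] X_rc by (simp add: case_prod_unfold)

lemma X_joint' [measurable]: "t \<le> b \<Longrightarrow> (\<lambda>p. X t (max (fst p) 0) (snd p)) \<in> borel_measurable (lborel \<Otimes>\<^sub>M M)"
  using X_joint[of t] by (simp add: measurable_cong_sets[OF sets_pair_measure_cong[OF sets_lborel refl] refl])

text \<open>The truncations make the transition kernel total.\<close>

definition \<kappa> :: "real \<Rightarrow> real \<Rightarrow> real measure" where
  "\<kappa> s y = distr M borel (X (min y b) (max s 0))"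

lemma prob_space_\<kappa>: "prob_space (\<kappa> s y)"
  unfolding \<kappa>_def by (rule prob_space_distr) simp

lemma sets_\<kappa> [simp, measurable_cong]: "sets (\<kappa> s y) = sets borel"
  and space_\<kappa> [simp]: "space (\<kappa> s y) = UNIV"
  by (simp_all add: \<kappa>_def)

lemma integral_\<kappa>:
  fixes f :: "real \<Rightarrow> real"
  assumes "f \<in> borel_measurable borel" "0 \<le> s" "y \<le> b"
  shows "(LINT z|\<kappa> s y. f z) = (LINT \<omega>|M. f (X y s \<omega>))"
  unfolding \<kappa>_def using assms by (subst integral_distr) auto

lemma AE_\<kappa>_le: "t \<le> b \<Longrightarrow> 0 \<le> s \<Longrightarrow> AE z in \<kappa> s t. z \<le> t"
  unfolding \<kappa>_def using X_le[of t] by (subst AE_distr_iff) (auto elim!: eventually_mono)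

lemma integral_\<kappa>_T:
  assumes "f \<in> C_inf {..b}" "0 \<le> s" "y \<le> b"
  shows "(LINT z|\<kappa> s y. f z) = T s f y"
  using feller_process_expectation[OF prob_space_axioms X_process[OF assms(3)] _ _ assms(1,2)] assms
  by (simp add: integral_\<kappa>[OF C_inf_borel[OF assms(1)]])

text \<open>The semigroup is specified on \<open>C_inf\<close> only. Ramps belong to this space and
  approach the indicator of (c, b]; since rays generate the Borel sets, identities and measurability
  reach \<kappa> through them.\<close>

definition ramp :: "real \<Rightarrow> nat \<Rightarrow> real \<Rightarrow> real" where
  "ramp c k y = (if y \<le> b then min 1 (real k * max 0 (y - c)) else 0)"

lemma ramp_C_inf: "ramp c k \<in> C_inf {..b}"
proof (rule C_infI)
  show "continuous_on {..b} (ramp c k)"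
    by (rule continuous_on_eq[where f = "\<lambda>y. min 1 (real k * max 0 (y - c))"])
      (auto simp: ramp_def intro!: continuous_intros)
  show "\<exists>K. compact K \<and> K \<subseteq> {..b} \<and> (\<forall>x\<in>{..b} - K. \<bar>ramp c k x\<bar> < e)" if "0 < e" for e
    using that by (intro exI[of _ "{c..b}"]) (auto simp: ramp_def)
qed (simp add: ramp_def)

lemma ramp_borel [measurable]: "ramp c k \<in> borel_measurable borel"
  by (rule C_inf_borel[OF ramp_C_inf]) simp

lemma ramp_bounds: "0 \<le> ramp c k y" "ramp c k y \<le> 1"
  by (auto simp: ramp_def)

lemma ramp_tendsto: "y \<le> b \<Longrightarrow> (\<lambda>k. ramp c k y) \<longlonglongrightarrow> indicator {c<..} y"
proof (cases "c < y")
  case True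
  assume y: "y \<le> b"
  have "filterlim (\<lambda>k. real k * (y - c)) at_top sequentially"
    using True by (intro filterlim_tendsto_pos_mult_at_top[OF tendsto_const _ filterlim_real_sequentially, of "y - c", simplified mult.commute]) auto
  then have "\<forall>\<^sub>F k in sequentially. 1 \<le> real k * (y - c)" by (simp add: filterlim_at_top)
  then have "\<forall>\<^sub>F k in sequentially. ramp c k y = 1"
    by eventually_elim (use True y in \<open>simp add: ramp_def\<close>)
  then show ?thesis using True by (auto intro: tendsto_eventually)
qed (simp add: ramp_def)

lemma T_jointly_measurable:
  assumes f: "f \<in> C_inf {..b}"
  shows "(\<lambda>p. T (max (fst p) 0) f (min (snd p) b)) \<in> borel_measurable (borel \<Otimes>\<^sub>M borel)"
proof -
  have TC: "T s f \<in> C_inf {..b}" if "0 \<le> s" for s using T_feller f that by (simp add: feller_semigroup_def)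
  have "(\<lambda>(s, y). T (max s 0) f (min y b)) \<in> borel_measurable (borel \<Otimes>\<^sub>M borel)"
  proof (rule right_continuous_jointly_measurable[where f = "\<lambda>s y. T s f (min y b)"])
    show "(\<lambda>y. T s f (min y b)) \<in> borel_measurable borel" if "0 \<le> s" for s
      by (rule measurable_compose[OF _ C_inf_borel[OF TC[OF that]]]) auto
    fix s y :: real assume s: "0 \<le> s"
    have "uniform_limit {..b} (\<lambda>h. T h (T s f)) (T s f) (at_right 0)"
      using T_feller TC[OF s] by (simp add: feller_semigroup_def)
    then have "((\<lambda>h. T h (T s f) (min y b)) \<longlongrightarrow> T s f (min y b)) (at_right 0)"
      by (rule tendsto_uniform_limitI) simp
    then have "((\<lambda>h. T (s + h) f (min y b)) \<longlongrightarrow> T s f (min y b)) (at_right 0)"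
    proof (rule Lim_transform_eventually, intro eventually_mono[OF eventually_at_right_less[of "0::real"]])
      fix h :: real assume h: "0 < h"
      have "T (h + s) f = T h (T s f)" using T_feller f s h by (simp add: feller_semigroup_def)
      then show "T h (T s f) (min y b) = T (s + h) f (min y b)" by (simp add: add.commute)
    qed
    then show "((\<lambda>u. T u f (min y b)) \<longlongrightarrow> T s f (min y b)) (at_right s)"
      unfolding filterlim_at_right_to_0[of _ _ s] by (simp add: add.commute)
  qed
  then show ?thesis by (simp add: case_prod_unfold)
qed

lemma \<kappa>_ray_tendsto: "(\<lambda>k. LINT z|\<kappa> s y. ramp c k z) \<longlonglongrightarrow> measure (\<kappa> s y) {c<..}"
proof -
  interpret K: prob_space "\<kappa> s y" by (rule prob_space_\<kappa>)
  have "(\<lambda>k. LINT z|\<kappa> s y. ramp c k z) \<longlonglongrightarrow> (LINT z|\<kappa> s y. indicator {c<..} z)"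
  proof (rule integral_dominated_convergence[where w = "\<lambda>_. 1"])
    have "AE z in \<kappa> s y. z \<le> b"
      unfolding \<kappa>_def using X_le_b[of "min y b" "max s 0"] by (subst AE_distr_iff) auto
    then show "AE z in \<kappa> s y. (\<lambda>k. ramp c k z) \<longlonglongrightarrow> indicator {c<..} z"
      by eventually_elim (rule ramp_tendsto)
    show "AE z in \<kappa> s y. norm (ramp c k z) \<le> 1" for k using ramp_bounds[of c k] by (auto simp: abs_le_iff)
  qed auto
  then show ?thesis by simp
qed

lemma integral_ramp: "(LINT z|\<kappa> s y. ramp c k z) = T (max s 0) (ramp c k) (min y b)"
  using integral_\<kappa>_T[OF ramp_C_inf, of "max s 0" "min y b"] by (simp add: \<kappa>_def)

lemma \<kappa>_ray_measurable: "(\<lambda>p. measure (\<kappa> (fst p) (snd p)) {c<..}) \<in> borel_measurable (borel \<Otimes>\<^sub>M borel)"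
  by (rule borel_measurable_LIMSEQ_real[OF \<kappa>_ray_tendsto])
    (simp add: integral_ramp T_jointly_measurable[OF ramp_C_inf])

text \<open>Nothing relates the variables \<open>X y s\<close> for different \<open>y\<close>, so
  measurability in the starting point cannot come from the paths. It comes from \<open>T\<close>:
  ray probabilities are limits of the values of \<open>T\<close> on ramps, and rays form an
  intersection-stable generator.\<close>

lemma \<kappa>_measurable: "(\<lambda>p. \<kappa> (fst p) (snd p)) \<in> measurable (borel \<Otimes>\<^sub>M borel) (subprob_algebra borel)"
proof (rule measurable_subprob_algebra_generated[where \<Omega> = UNIV and G = "range greaterThan"])
  show "sets borel = sigma_sets UNIV (range greaterThan :: real set set)"
    by (simp add: borel_Ioi)
  show "Int_stable (range greaterThan :: real set set)"
  proof (rule Int_stableI_image)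
    fix c d :: real
    show "\<exists>k\<in>UNIV. {c<..} \<inter> {d<..} = {k<..}" by (intro bexI[of _ "max c d"]) auto
  qed
  fix p :: "real \<times> real"
  show "subprob_space (\<kappa> (fst p) (snd p))"
    by (rule prob_space_imp_subprob_space[OF prob_space_\<kappa>])
next
  fix A :: "real set" assume "A \<in> range greaterThan"
  then obtain c where A: "A = {c<..}" by auto
  have "emeasure (\<kappa> (fst p) (snd p)) A = ennreal (measure (\<kappa> (fst p) (snd p)) {c<..})" for p
    using prob_space.axioms(1)[OF prob_space_\<kappa>] by (simp add: A finite_measure.emeasure_eq_measure)
  then show "(\<lambda>p. emeasure (\<kappa> (fst p) (snd p)) A) \<in> borel_measurable (borel \<Otimes>\<^sub>M borel)"
    using \<kappa>_ray_measurable[of c] by simp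
next
  have "emeasure (\<kappa> (fst p) (snd p)) UNIV = 1" for p
    using prob_space.emeasure_space_1[OF prob_space_\<kappa>, of "fst p" "snd p"] by simp
  then show "(\<lambda>p. emeasure (\<kappa> (fst p) (snd p)) UNIV) \<in> borel_measurable (borel \<Otimes>\<^sub>M borel)" by simp
qed auto

lemma \<kappa>_measurable2 [measurable]: "\<kappa> s \<in> measurable borel (subprob_algebra borel)"
  using measurable_compose[OF measurable_Pair1' \<kappa>_measurable, of s] by simp

text \<open>The semigroup law is tested on ramps and passed to rays by dominated convergence; finite
  measures that agree on rays coincide.\<close>

lemma chapman_kolmogorov:
  assumes s: "0 \<le> s" and u: "0 \<le> u" and t: "t \<le> b"
  shows "\<kappa> (s + u) t = \<kappa> s t \<bind> \<kappa> u"
proof (rule measure_eqI_lessThan)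
  interpret K: prob_space "\<kappa> s t" by (rule prob_space_\<kappa>)
  show "sets (\<kappa> s t \<bind> \<kappa> u) = sets borel"
    by (subst sets_bind[where N = borel]) auto
  fix c :: real
  interpret K': prob_space "\<kappa> (s + u) t" by (rule prob_space_\<kappa>)
  show "emeasure (\<kappa> (s + u) t) {c<..} < \<infinity>" by (simp add: less_top[symmetric])
  have TC: "T u (ramp c k) \<in> C_inf {..b}" for k
    using T_feller ramp_C_inf u by (simp add: feller_semigroup_def)
  have eq: "T u (ramp c k) y = (LINT z|\<kappa> u y. ramp c k z)" if "y \<le> b" for y k
    using integral_\<kappa>_T[OF ramp_C_inf u that] by simp
  have "(\<lambda>k. LINT y|\<kappa> s t. T u (ramp c k) y) \<longlonglongrightarrow> (LINT y|\<kappa> s t. measure (\<kappa> u y) {c<..})"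
  proof (rule integral_dominated_convergence[where w = "\<lambda>_. 1"])
    have le: "AE y in \<kappa> s t. y \<le> b" using AE_\<kappa>_le[OF t s] t by (auto elim: eventually_mono)
    show "AE y in \<kappa> s t. (\<lambda>k. T u (ramp c k) y) \<longlonglongrightarrow> measure (\<kappa> u y) {c<..}"
      using le by eventually_elim (use \<kappa>_ray_tendsto[of u _ c] in \<open>simp add: eq\<close>)
    show "AE y in \<kappa> s t. norm (T u (ramp c k) y) \<le> 1" for k
      using le
    proof eventually_elim
      case (elim y)
      interpret U: prob_space "\<kappa> u y" by (rule prob_space_\<kappa>)
      have i: "integrable (\<kappa> u y) (ramp c k)"
        by (rule U.integrable_const_bound[where B = 1]) (use ramp_bounds[of c k] in \<open>auto simp: abs_le_iff\<close>)
      have "0 \<le> (LINT z|\<kappa> u y. ramp c k z)" by (rule integral_nonneg_AE) (use ramp_bounds in auto)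
      moreover have "(LINT z|\<kappa> u y. ramp c k z) \<le> 1"
        by (rule U.integral_le_const[OF i]) (use ramp_bounds in auto)
      ultimately show ?case using eq[OF elim] by simp
    qed
    show "(\<lambda>y. measure (\<kappa> u y) {c<..}) \<in> borel_measurable (\<kappa> s t)"
      using measurable_compose[OF measurable_Pair1' \<kappa>_ray_measurable, of u c] by simp
    show "T u (ramp c k) \<in> borel_measurable (\<kappa> s t)" for k
      using C_inf_borel[OF TC] by simp
  qed auto
  moreover have "(LINT y|\<kappa> s t. T u (ramp c k) y) = (LINT z|\<kappa> (s + u) t. ramp c k z)" for k
    using integral_\<kappa>_T[OF TC s t] integral_\<kappa>_T[OF ramp_C_inf, of "s + u" t] s u t T_feller ramp_C_inf
    by (simp add: feller_semigroup_def)
  ultimately have "measure (\<kappa> (s + u) t) {c<..} = (LINT y|\<kappa> s t. measure (\<kappa> u y) {c<..})"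
    using LIMSEQ_unique[OF \<kappa>_ray_tendsto] by simp
  moreover have "emeasure (\<kappa> s t \<bind> \<kappa> u) {c<..} = (\<integral>\<^sup>+y. ennreal (measure (\<kappa> u y) {c<..}) \<partial>\<kappa> s t)"
    using prob_space.axioms(1)[OF prob_space_\<kappa>]
    by (subst emeasure_bind[where N = borel]) (auto simp: finite_measure.emeasure_eq_measure)
  moreover have "\<dots> = ennreal (LINT y|\<kappa> s t. measure (\<kappa> u y) {c<..})"
  proof (rule nn_integral_eq_integral[OF K.integrable_const_bound[where B = 1]])
    show "AE y in \<kappa> s t. norm (measure (\<kappa> u y) {c<..}) \<le> 1"
      using prob_space.prob_le_1[OF prob_space_\<kappa>] by auto
    show "(\<lambda>y. measure (\<kappa> u y) {c<..}) \<in> borel_measurable (\<kappa> s t)"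
      using measurable_compose[OF measurable_Pair1' \<kappa>_ray_measurable, of u c] by simp
  qed auto
  ultimately show "emeasure (\<kappa> (s + u) t) {c<..} = emeasure (\<kappa> s t \<bind> \<kappa> u) {c<..}"
    by (simp add: K'.emeasure_eq_measure)
qed simp

text \<open>The transition operator of the process killed on entering (-\<infinity>, a]. Paths do
  not increase, so one that is above \<open>a\<close> at time \<open>s\<close> has been there all
  along, and inspecting the terminal state is enough.\<close>

definition Q :: "real \<Rightarrow> (real \<Rightarrow> real) \<Rightarrow> real \<Rightarrow> real" where
  "Q s f y = (LINT z|\<kappa> s y. indicator {a<..} z * f z)"

text \<open>Index \<open>n\<close> belongs to the (n+1)-st iterate of the potential operator;
  \<open>\<Phi>_Suc\<close> is the induction step.\<close>

definition \<Phi> :: "nat \<Rightarrow> (real \<Rightarrow> real) \<Rightarrow> real \<Rightarrow> real" where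
  "\<Phi> n f t = (LINT s|lborel. tpow n s * Q s f t)"

lemma Q_X: "f \<in> borel_measurable borel \<Longrightarrow> 0 \<le> s \<Longrightarrow> t \<le> b \<Longrightarrow>
    Q s f t = (LINT \<omega>|M. indicator {a<..} (X t s \<omega>) * f (X t s \<omega>))"
  unfolding Q_def by (rule integral_\<kappa>) auto

lemma Q_eq_0:
  assumes "t \<le> a" "0 \<le> s" shows "Q s f t = 0"
proof -
  have "AE z in \<kappa> s t. z \<le> t" using assms ab by (intro AE_\<kappa>_le) auto
  then have "AE z in \<kappa> s t. indicator {a<..} z * f z = 0"
    by eventually_elim (use assms in auto)
  then show ?thesis unfolding Q_def by (rule integral_eq_zero_AE)
qed

lemma Q_measurable: "f \<in> borel_measurable borel \<Longrightarrow> (\<lambda>p. Q (fst p) f (snd p)) \<in> borel_measurable (borel \<Otimes>\<^sub>M borel)"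
  unfolding Q_def
  by (rule measurable_compose[OF \<kappa>_measurable integral_measurable_subprob_algebra]) measurable

lemma Q_measurable1 [measurable]: "f \<in> borel_measurable borel \<Longrightarrow> (\<lambda>s. Q s f t) \<in> borel_measurable borel"
  using measurable_compose[OF measurable_Pair2' Q_measurable, of t] by simp

lemma Q_measurable2 [measurable]: "f \<in> borel_measurable borel \<Longrightarrow> Q s f \<in> borel_measurable borel"
  using measurable_compose[OF measurable_Pair1' Q_measurable, of s] by simp

lemma measure_\<kappa>_tail: "t \<le> b \<Longrightarrow> 0 \<le> s \<Longrightarrow> measure (\<kappa> s t) {a<..} = prob {\<omega>\<in>space M. a < X t s \<omega>}"
  unfolding \<kappa>_def by (subst measure_distr) (auto intro!: arg_cong[where f = prob])

text \<open>The constant depends on \<open>K\<close> alone, which is why \<open>f\<close>,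
  \<open>t\<close> and \<open>s\<close> are quantified inside: the majorants must be uniform along
  the iteration.\<close>

lemma Q_bound:
  assumes K: "0 < K"
  obtains C where "0 \<le> C" "\<forall>f B t s. f \<in> borel_measurable borel \<longrightarrow> (\<forall>x. \<bar>f x\<bar> \<le> B) \<longrightarrow> t \<le> b \<longrightarrow> 0 \<le> s \<longrightarrow> \<bar>Q s f t\<bar> \<le> B * (C * exp (- (K * s)))"
proof -
  obtain C where C: "0 \<le> C" "\<forall>t\<le>b. \<forall>s\<ge>0. prob {\<omega>\<in>space M. a < X t s \<omega>} \<le> C * exp (- (K * s))"
    using tail[OF K] by blast
  have "\<bar>Q s f t\<bar> \<le> B * (C * exp (- (K * s)))"
    if f[measurable]: "f \<in> borel_measurable borel" and B: "\<forall>x. \<bar>f x\<bar> \<le> B" and t: "t \<le> b" and s: "0 \<le> s" for f B t s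
  proof -
    interpret K: prob_space "\<kappa> s t" by (rule prob_space_\<kappa>)
    have B0: "0 \<le> B" using B[rule_format, of 0] by linarith
    have i: "integrable (\<kappa> s t) (\<lambda>z. indicator {a<..} z * f z)"
      by (rule K.integrable_const_bound[where B = B]) (use B B0 in \<open>auto simp: indicator_def\<close>)
    have i2: "integrable (\<kappa> s t) (\<lambda>z. B * indicator {a<..} z)"
      by (rule K.integrable_const_bound[where B = B]) (use B0 in \<open>auto simp: indicator_def\<close>)
    have "\<bar>Q s f t\<bar> \<le> (LINT z|\<kappa> s t. \<bar>indicator {a<..} z * f z\<bar>)"
      unfolding Q_def by (rule integral_abs_bound)
    also have "\<dots> \<le> (LINT z|\<kappa> s t. B * indicator {a<..} z)"
      using B by (intro integral_mono integrable_abs i i2) (auto simp: indicator_def)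
    also have "\<dots> = B * prob {\<omega>\<in>space M. a < X t s \<omega>}" by (simp add: measure_\<kappa>_tail[OF t s])
    also have "\<dots> \<le> B * (C * exp (- (K * s)))" using C(2) t s B0 by (intro mult_left_mono) auto
    finally show ?thesis .
  qed
  with C(1) show thesis by (intro that[of C]) auto
qed

text \<open>Chapman-Kolmogorov for \<kappa> has no indicator at the intermediate time; inserting one
  is free, because a path that starts at or below \<open>a\<close> contributes 0 afterwards.\<close>

lemma Q_semigroup:
  assumes f [measurable]: "f \<in> borel_measurable borel" and B: "\<forall>x. \<bar>f x\<bar> \<le> B"
    and s: "0 \<le> s" and u: "0 \<le> u" and t: "t \<le> b"
  shows "Q (s + u) f t = (LINT y|\<kappa> s t. indicator {a<..} y * Q u f y)"
proof -
  have B0: "0 \<le> B" using B[rule_format, of 0] by linarith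
  have "Q (s + u) f t = (LINT z|(\<kappa> s t \<bind> \<kappa> u). indicator {a<..} z * f z)"
    unfolding Q_def chapman_kolmogorov[OF s u t] ..
  also have "\<dots> = (LINT y|\<kappa> s t. (LINT z|\<kappa> u y. indicator {a<..} z * f z))"
  proof (rule integral_bind[where K = borel and B = B and B' = 1])
    show "(\<lambda>z. indicator {a<..} z * f z) \<in> borel_measurable borel" by measurable
    show "\<bar>indicator {a<..} z * f z\<bar> \<le> B" for z using B B0 by (auto simp: indicator_def)
    show "finite_measure (\<kappa> s t)" by (rule prob_space.axioms(1)[OF prob_space_\<kappa>])
    show "\<kappa> u \<in> measurable (\<kappa> s t) (subprob_algebra borel)" by measurable
    show "AE y in \<kappa> s t. emeasure (\<kappa> u y) (space (\<kappa> u y)) \<le> ennreal 1"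
      using prob_space.emeasure_space_1[OF prob_space_\<kappa>] by simp
  qed
  also have "\<dots> = (LINT y|\<kappa> s t. indicator {a<..} y * Q u f y)"
  proof (rule Bochner_Integration.integral_cong[OF refl])
    fix y
    have "(LINT z|\<kappa> u y. indicator {a<..} z * f z) = Q u f y" by (simp only: Q_def)
    also have "\<dots> = indicator {a<..} y * Q u f y" using Q_eq_0[of y u f] u by (cases "a < y") auto
    finally show "(LINT z|\<kappa> u y. indicator {a<..} z * f z) = indicator {a<..} y * Q u f y" .
  qed
  finally show ?thesis .
qed

lemma tpow_Q_bound:
  obtains C where "0 \<le> C" "\<forall>n f B t s. f \<in> borel_measurable borel \<longrightarrow> (\<forall>x. \<bar>f x\<bar> \<le> B) \<longrightarrow> t \<le> b \<longrightarrow> \<bar>tpow n s * Q s f t\<bar> \<le> B * C * texp 1 s"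
proof -
  \<comment> \<open>Rate 2 pays for s^n / n! <= exp s and still leaves exp(-s), uniformly in
    \<open>n\<close>.\<close>
  obtain C where C: "0 \<le> C" "\<forall>f B t s. f \<in> borel_measurable borel \<longrightarrow> (\<forall>x. \<bar>f x\<bar> \<le> B) \<longrightarrow> t \<le> b \<longrightarrow> 0 \<le> s \<longrightarrow> \<bar>Q s f t\<bar> \<le> B * (C * exp (- (2 * s)))"
    by (rule Q_bound[of 2]) simp
  have "\<bar>tpow n s * Q s f t\<bar> \<le> B * C * texp 1 s"
    if f: "f \<in> borel_measurable borel" and B: "\<forall>x. \<bar>f x\<bar> \<le> B" and t: "t \<le> b" for n f B t s
  proof (cases "0 \<le> s")
    case True
    have "\<bar>tpow n s * Q s f t\<bar> \<le> exp s * (B * (C * exp (- (2 * s))))"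
      unfolding abs_mult using tpow_le_exp[of n s] tpow_nonneg[of n s] C(2) f B t True by (intro mult_mono) auto
    also have "\<dots> = B * C * texp 1 s" using True by (simp add: texp_def exp_add[symmetric])
    finally show ?thesis .
  qed (simp add: tpow_def texp_def)
  with C(1) show thesis by (intro that[of C]) auto
qed

lemma \<Phi>_integrable:
  assumes f: "f \<in> borel_measurable borel" and B: "\<forall>x. \<bar>f x\<bar> \<le> B" and t: "t \<le> b"
  shows "integrable lborel (\<lambda>s. tpow n s * Q s f t)"
proof -
  obtain C where C: "0 \<le> C" "\<forall>n f B t s. f \<in> borel_measurable borel \<longrightarrow> (\<forall>x. \<bar>f x\<bar> \<le> B) \<longrightarrow> t \<le> b \<longrightarrow> \<bar>tpow n s * Q s f t\<bar> \<le> B * C * texp 1 s"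
    by (rule tpow_Q_bound)
  show ?thesis
  proof (rule Bochner_Integration.integrable_bound[OF integrable_mult_right[OF texp_integrable[of 1], of "B * C"]])
    show "(\<lambda>s. tpow n s * Q s f t) \<in> borel_measurable lborel" using f by measurable
    show "AE s in lborel. norm (tpow n s * Q s f t) \<le> norm (B * C * texp 1 s)"
      using C(2) f B t by (intro AE_I2) (simp add: order_trans[OF _ abs_ge_self])
  qed simp
qed

lemma \<Phi>_measurable: "f \<in> borel_measurable borel \<Longrightarrow> \<Phi> n f \<in> borel_measurable borel"
proof -
  assume f [measurable]: "f \<in> borel_measurable borel"
  have [measurable]: "(\<lambda>p. Q (snd p) f (fst p)) \<in> borel_measurable (borel \<Otimes>\<^sub>M lborel)"
    using measurable_compose[OF _ Q_measurable[OF f], of "\<lambda>p. (snd p, fst p)" "borel \<Otimes>\<^sub>M lborel"] by simp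
  have "(\<lambda>t. LINT s|lborel. (\<lambda>p. tpow n (snd p) * Q (snd p) f (fst p)) (t, s)) \<in> borel_measurable borel"
    by (rule lborel.borel_measurable_lebesgue_integral) (simp add: case_prod_unfold)
  then show ?thesis by (simp add: \<Phi>_def[abs_def])
qed

lemma \<Phi>_eq_0: "t \<le> a \<Longrightarrow> \<Phi> n f t = 0"
proof -
  assume "t \<le> a"
  then have "(\<lambda>s. tpow n s * Q s f t) = (\<lambda>s. 0)" using Q_eq_0 by (auto simp: tpow_def)
  then show ?thesis by (simp add: \<Phi>_def)
qed

lemma \<Phi>_bound:
  obtains C where "0 \<le> C" "\<forall>n f B t. f \<in> borel_measurable borel \<longrightarrow> (\<forall>x. \<bar>f x\<bar> \<le> B) \<longrightarrow> t \<le> b \<longrightarrow> \<bar>\<Phi> n f t\<bar> \<le> B * C"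
proof -
  obtain C where C: "0 \<le> C" "\<forall>n f B t s. f \<in> borel_measurable borel \<longrightarrow> (\<forall>x. \<bar>f x\<bar> \<le> B) \<longrightarrow> t \<le> b \<longrightarrow> \<bar>tpow n s * Q s f t\<bar> \<le> B * C * texp 1 s"
    by (rule tpow_Q_bound)
  have "\<bar>\<Phi> n f t\<bar> \<le> B * (C * (LINT s|lborel. texp 1 s))"
    if f: "f \<in> borel_measurable borel" and B: "\<forall>x. \<bar>f x\<bar> \<le> B" and t: "t \<le> b" for n f B t
  proof -
    have "\<bar>\<Phi> n f t\<bar> \<le> (LINT s|lborel. \<bar>tpow n s * Q s f t\<bar>)" unfolding \<Phi>_def by (rule integral_abs_bound)
    also have "\<dots> \<le> (LINT s|lborel. (B * C) * texp 1 s)"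
      by (intro integral_mono integrable_abs \<Phi>_integrable[OF that] integrable_mult_right texp_integrable)
        (use C(2) f B t in auto)
    also have "\<dots> = B * (C * (LINT s|lborel. texp 1 s))" by simp
    finally show ?thesis .
  qed
  moreover have "0 \<le> C * (LINT s|lborel. texp 1 s)"
    using C(1) by (intro mult_nonneg_nonneg integral_nonneg_AE) (auto simp: texp_nonneg)
  ultimately show thesis by (intro that[of "C * (LINT s|lborel. texp 1 s)"]) auto
qed

lemma \<Phi>_add:
  assumes "f \<in> borel_measurable borel" "\<forall>x. \<bar>f x\<bar> \<le> B" "g \<in> borel_measurable borel" "\<forall>x. \<bar>g x\<bar> \<le> B'" "t \<le> b"
  shows "\<Phi> n (\<lambda>x. f x + c * g x) t = \<Phi> n f t + c * \<Phi> n g t"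
proof -
  have Q: "Q s (\<lambda>x. f x + c * g x) t = Q s f t + c * Q s g t" for s
  proof -
    interpret K: prob_space "\<kappa> s t" by (rule prob_space_\<kappa>)
    have i: "integrable (\<kappa> s t) (\<lambda>z. indicator {a<..} z * f z)" if "f \<in> borel_measurable borel" "\<forall>x. \<bar>f x\<bar> \<le> B" for f :: "real \<Rightarrow> real" and B
    proof (rule K.integrable_const_bound[where B = B])
      show "AE z in \<kappa> s t. norm (indicator {a<..} z * f z) \<le> B"
        using that(2) order_trans[OF abs_ge_zero that(2)[rule_format]] by (auto simp: indicator_def)
    qed (use that in measurable)
    have "Q s (\<lambda>x. f x + c * g x) t = (LINT z|\<kappa> s t. indicator {a<..} z * f z + c * (indicator {a<..} z * g z))"
      unfolding Q_def by (simp add: algebra_simps)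
    then show ?thesis
      using i[OF assms(1,2)] i[OF assms(3,4)] by (simp add: Q_def)
  qed
  have "\<Phi> n (\<lambda>x. f x + c * g x) t = (LINT s|lborel. tpow n s * Q s f t + c * (tpow n s * Q s g t))"
    unfolding \<Phi>_def Q by (simp add: algebra_simps)
  then show ?thesis
    using \<Phi>_integrable[OF assms(1,2,5)] \<Phi>_integrable[OF assms(3,4,5)] by (simp add: \<Phi>_def)
qed

text \<open>The left side is the double integral of tpow n u times Q_(s+u) f over s, u >= 0.
  Substituting v = s + u and integrating u over [0, v] first produces \<open>tpow (Suc n) v\<close>.
  Only the values of \<open>h\<close> on (a, b] are constrained, as only there the iterates are
  known; the indicator and the bound of the paths by \<open>b\<close> hide the rest.\<close>

lemma \<Phi>_Suc:
  assumes f [measurable]: "f \<in> borel_measurable borel" and B: "\<forall>x. \<bar>f x\<bar> \<le> B" and t: "t \<le> b"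
    and h: "\<And>y. a < y \<Longrightarrow> y \<le> b \<Longrightarrow> h y = \<Phi> n f y"
  shows "(LINT s|lborel. tpow 0 s * (LINT \<omega>|M. indicator {a<..} (X t s \<omega>) * h (X t s \<omega>))) = \<Phi> (Suc n) f t"
proof -
  obtain C where C: "0 \<le> C" "\<forall>f B t s. f \<in> borel_measurable borel \<longrightarrow> (\<forall>x. \<bar>f x\<bar> \<le> B) \<longrightarrow> t \<le> b \<longrightarrow> 0 \<le> s \<longrightarrow> \<bar>Q s f t\<bar> \<le> B * (C * exp (- (2 * s)))"
    by (rule Q_bound[of 2]) simp
  have Qb: "\<bar>Q s f t\<bar> \<le> B * (C * exp (- (2 * s)))" if "t \<le> b" "0 \<le> s" for s t
    using C(2) f B that by blast
  have B0: "0 \<le> B" using B[rule_format, of 0] by linarith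
  define D where "D = B * C"
  have D: "0 \<le> D" using B0 C by (simp add: D_def)
  have [measurable]: "\<Phi> n f \<in> borel_measurable borel" by (rule \<Phi>_measurable[OF f])
  have [measurable]: "(\<lambda>p. Q (snd p) f (fst p)) \<in> borel_measurable (\<kappa> s t \<Otimes>\<^sub>M lborel)" for s t
    using measurable_compose[OF _ Q_measurable[OF f], of "\<lambda>p. (snd p, fst p)" "\<kappa> s t \<Otimes>\<^sub>M lborel"] by simp
  have 1: "(LINT \<omega>|M. indicator {a<..} (X t s \<omega>) * h (X t s \<omega>)) = (LINT u|lborel. tpow n u * Q (s + u) f t)" if s: "0 \<le> s" for s
  proof -
    interpret K: prob_space "\<kappa> s t" by (rule prob_space_\<kappa>)
    interpret P: pair_sigma_finite "\<kappa> s t" lborel ..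
    have "(LINT \<omega>|M. indicator {a<..} (X t s \<omega>) * h (X t s \<omega>)) = (LINT \<omega>|M. indicator {a<..} (X t s \<omega>) * \<Phi> n f (X t s \<omega>))"
      using h X_le_b[OF t s] by (intro Bochner_Integration.integral_cong) (auto simp: indicator_def)
    also have "\<dots> = (LINT y|\<kappa> s t. indicator {a<..} y * \<Phi> n f y)"
      by (rule integral_\<kappa>[OF _ s t, symmetric]) measurable
    also have "\<dots> = (LINT y|\<kappa> s t. (LINT u|lborel. indicator {a<..} y * (tpow n u * Q u f y)))"
      unfolding \<Phi>_def by simp
    \<comment> \<open>The decay bound holds for starting points up to \<open>b\<close>; cutting the
      indicator there makes the majorant valid for every \<open>y\<close>.\<close>
    also have "\<dots> = (LINT y|\<kappa> s t. (LINT u|lborel. indicator {a<..b} y * (tpow n u * Q u f y)))"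
    proof (rule integral_cong_AE)
      have [measurable]: "(\<lambda>y. LINT u|lborel. indicator A y * (tpow n u * Q u f y)) \<in> borel_measurable borel"
        if "A \<in> sets borel" for A
      proof -
        have "(\<lambda>y. indicator A y * \<Phi> n f y) \<in> borel_measurable borel" using that by measurable
        then show ?thesis by (simp add: \<Phi>_def)
      qed
      show "(\<lambda>y. LINT u|lborel. indicator {a<..} y * (tpow n u * Q u f y)) \<in> borel_measurable (\<kappa> s t)"
        "(\<lambda>y. LINT u|lborel. indicator {a<..b} y * (tpow n u * Q u f y)) \<in> borel_measurable (\<kappa> s t)" by measurable
      show "AE y in \<kappa> s t. (LINT u|lborel. indicator {a<..} y * (tpow n u * Q u f y)) = (LINT u|lborel. indicator {a<..b} y * (tpow n u * Q u f y))"
        using AE_\<kappa>_le[OF t s] by eventually_elim (use t in \<open>auto simp: indicator_def\<close>)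
    qed
    also have "\<dots> = (LINT u|lborel. (LINT y|\<kappa> s t. indicator {a<..b} y * (tpow n u * Q u f y)))"
    proof (rule P.Fubini_integral[symmetric])
      show "integrable (\<kappa> s t \<Otimes>\<^sub>M lborel) (\<lambda>(y, u). indicator {a<..b} y * (tpow n u * Q u f y))"
      proof (rule P.integrable_product_bound[where g = "\<lambda>_. D" and h = "texp 1"])
        show "(\<lambda>(y, u). indicator {a<..b} y * (tpow n u * Q u f y)) \<in> borel_measurable (\<kappa> s t \<Otimes>\<^sub>M lborel)"
          by (simp add: case_prod_unfold)
        fix y u :: real
        show "\<bar>case (y, u) of (y, u) \<Rightarrow> indicator {a<..b} y * (tpow n u * Q u f y)\<bar> \<le> D * texp 1 u"
        proof (cases "y \<in> {a<..b} \<and> 0 \<le> u")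
          case True
          have "\<bar>tpow n u * Q u f y\<bar> \<le> exp u * (B * (C * exp (- (2 * u))))"
            unfolding abs_mult using tpow_le_exp[of n u] tpow_nonneg[of n u] Qb True by (intro mult_mono) auto
          also have "\<dots> = D * texp 1 u" using True by (simp add: texp_def exp_add[symmetric] D_def)
          finally show ?thesis using True by simp
        next
          case False
          then show ?thesis using D texp_nonneg[of 1 u] by (auto simp: tpow_def indicator_def)
        qed
      qed (auto intro: texp_integrable)
    qed
    also have "\<dots> = (LINT u|lborel. tpow n u * Q (s + u) f t)"
    proof (rule Bochner_Integration.integral_cong[OF refl])
      fix u :: real
      show "(LINT y|\<kappa> s t. indicator {a<..b} y * (tpow n u * Q u f y)) = tpow n u * Q (s + u) f t"
      proof (cases "0 \<le> u")
        case True
        have "(LINT y|\<kappa> s t. indicator {a<..b} y * (tpow n u * Q u f y)) = (LINT y|\<kappa> s t. tpow n u * (indicator {a<..} y * Q u f y))"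
        proof (rule integral_cong_AE)
          show "AE y in \<kappa> s t. indicator {a<..b} y * (tpow n u * Q u f y) = tpow n u * (indicator {a<..} y * Q u f y)"
            using AE_\<kappa>_le[OF t s] by eventually_elim (use t in \<open>auto simp: indicator_def\<close>)
        qed measurable
        then show ?thesis using Q_semigroup[OF f B s True t] by simp
      qed (simp add: tpow_def)
    qed
    finally show ?thesis .
  qed
  let ?q = "\<lambda>v. Q v f t"
  have "(LINT s|lborel. tpow 0 s * (LINT \<omega>|M. indicator {a<..} (X t s \<omega>) * h (X t s \<omega>)))
      = (LINT s|lborel. (LINT u|lborel. tpow 0 s * (tpow n u * ?q (s + u))))"
    by (rule Bochner_Integration.integral_cong[OF refl]) (use 1 in \<open>auto simp: tpow_def[of 0]\<close>)
  also have "\<dots> = (LINT u|lborel. (LINT s|lborel. tpow 0 s * (tpow n u * ?q (s + u))))"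
  proof (rule lborel_pair.Fubini_integral[symmetric], rule lborel_pair.integrable_product_bound[where g = "\<lambda>s. D * texp 1 s" and h = "texp 1"])
    show "(\<lambda>(s, u). tpow 0 s * (tpow n u * ?q (s + u))) \<in> borel_measurable (lborel \<Otimes>\<^sub>M lborel)" by measurable
    fix s u :: real
    show "\<bar>case (s, u) of (s, u) \<Rightarrow> tpow 0 s * (tpow n u * ?q (s + u))\<bar> \<le> D * texp 1 s * texp 1 u"
    proof (cases "0 \<le> s \<and> 0 \<le> u")
      case True
      have "\<bar>tpow n u * ?q (s + u)\<bar> \<le> exp u * (B * (C * exp (- (2 * (s + u)))))"
        unfolding abs_mult using tpow_le_exp[of n u] tpow_nonneg[of n u] Qb[of t "s + u"] True t by (intro mult_mono) auto
      \<comment> \<open>Giving up a factor exp(-s) leaves exp(-s) exp(-u), a product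
        majorant.\<close>
      also have "\<dots> \<le> exp u * (B * (C * exp (- (s + 2 * u))))"
        using True B0 C by (intro mult_left_mono) auto
      also have "\<dots> = D * texp 1 s * texp 1 u" using True by (simp add: texp_def exp_add[symmetric] D_def)
      finally show ?thesis using True by (simp add: tpow_def[of 0])
    qed (auto simp: tpow_def texp_def)
  qed (auto intro: texp_integrable)
  also have "\<dots> = (LINT u|lborel. (LINT v|lborel. tpow n u * indicator {..v} u * ?q v))"
  proof (rule Bochner_Integration.integral_cong[OF refl])
    fix u :: real
    have "(LINT s|lborel. tpow 0 s * (tpow n u * ?q (s + u))) = (LINT s|lborel. tpow n u * indicator {..u + s} u * ?q (u + s))"
      by (rule Bochner_Integration.integral_cong[OF refl]) (auto simp: tpow_def[of 0] indicator_def add.commute)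
    also have "\<dots> = (LINT v|lborel. tpow n u * indicator {..v} u * ?q v)"
      using lborel_integral_real_affine[of 1 "\<lambda>v. tpow n u * indicator {..v} u * ?q v" u] by simp
    finally show "(LINT s|lborel. tpow 0 s * (tpow n u * ?q (s + u))) = (LINT v|lborel. tpow n u * indicator {..v} u * ?q v)" .
  qed
  also have "\<dots> = (LINT v|lborel. (LINT u|lborel. tpow n u * indicator {..v} u * ?q v))"
  proof (rule lborel_pair.Fubini_integral[symmetric], rule lborel_pair.integrable_product_bound[where g = "\<lambda>s. D * texp (1/2) s" and h = "texp (1/2)"])
    have "(\<lambda>(u, v). tpow n u * (if u \<le> v then 1 else 0) * ?q v) \<in> borel_measurable (lborel \<Otimes>\<^sub>M lborel)" by measurable
    then show "(\<lambda>(u, v). tpow n u * indicator {..v} u * ?q v) \<in> borel_measurable (lborel \<Otimes>\<^sub>M lborel)"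
      by (simp add: indicator_def of_bool_def)
    fix u v :: real
    show "\<bar>case (u, v) of (u, v) \<Rightarrow> tpow n u * indicator {..v} u * ?q v\<bar> \<le> D * texp (1/2) u * texp (1/2) v"
    proof (cases "0 \<le> u \<and> u \<le> v")
      case True
      have "\<bar>tpow n u * ?q v\<bar> \<le> exp u * (B * (C * exp (- (2 * v))))"
        unfolding abs_mult using tpow_le_exp[of n u] tpow_nonneg[of n u] Qb[of t v] True t by (intro mult_mono) auto
      also have "\<dots> = D * exp (u - 2 * v)" by (simp add: D_def exp_add[symmetric])
      \<comment> \<open>For u <= v the exponent u - 2 v is at most - u/2 - v/2: the decay in
        \<open>v\<close> is shared with \<open>u\<close>, in which the majorant has to be integrable
        too.\<close>
      also have "\<dots> \<le> D * exp (- (1 / 2 * u) + - (1 / 2 * v))"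
        using True D by (intro mult_left_mono) auto
      also have "\<dots> = D * texp (1/2) u * texp (1/2) v" using True by (simp add: texp_def exp_add[symmetric])
      finally show ?thesis using True by simp
    next
      case False
      then show ?thesis using D texp_nonneg[of "1/2"] by (auto simp: tpow_def indicator_def)
    qed
  qed (auto intro: texp_integrable)
  also have "\<dots> = (LINT v|lborel. tpow (Suc n) v * ?q v)"
  proof (rule Bochner_Integration.integral_cong[OF refl])
    fix v :: real
    show "(LINT u|lborel. tpow n u * indicator {..v} u * ?q v) = tpow (Suc n) v * ?q v"
    proof (cases "0 \<le> v")
      case True then show ?thesis using integral_tpow[OF True, of n] by simp
    next
      case False
      then have "(\<lambda>u. tpow n u * indicator {..v} u * ?q v) = (\<lambda>u. 0)" by (auto simp: tpow_def indicator_def)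
      then show ?thesis using False by (simp add: tpow_def)
    qed
  qed
  finally show ?thesis by (simp add: \<Phi>_def)
qed

end

lemma exp_partial_sum_le: 
  assumes "0 \<le> (s::real)" shows "(\<Sum>n\<le>N. s ^ n / fact n) \<le> exp s"
proof -
  have "(\<Sum>n\<le>N. s ^ n /\<^sub>R fact n) \<le> (\<Sum>n. s ^ n /\<^sub>R fact n)"
    by (rule sum_le_suminf[OF summable_exp_generic]) (use assms in auto)
  then show ?thesis by (simp add: exp_def divide_inverse mult.commute)
qed

lemma curve_step:
  fixes \<gamma> :: "real \<Rightarrow> 'c::real_normed_vector"
  assumes ab: "a < b" and \<gamma>: "continuous_on {a..b} \<gamma>" "\<And>r. r \<notin> {a..b} \<Longrightarrow> \<gamma> r = 0" and e: "0 < e"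
  shows "\<exists>m A c. (\<forall>i::nat. A i \<in> sets borel) \<and> (\<forall>r. norm (\<gamma> r - (\<Sum>i<m. indicator (A i) r *\<^sub>R c i)) \<le> e)"
proof -
  have "uniformly_continuous_on {a..b} \<gamma>" using \<gamma>(1) by (rule compact_uniformly_continuous) simp
  from this[unfolded uniformly_continuous_on_def, rule_format, OF e]
  obtain d where d: "0 < d" "\<And>x y. x \<in> {a..b} \<Longrightarrow> y \<in> {a..b} \<Longrightarrow> dist y x < d \<Longrightarrow> dist (\<gamma> y) (\<gamma> x) < e" by metis
  obtain m :: nat where m: "(b - a) / d < real m" using reals_Archimedean2 by blast
  have "0 < (b - a) / d" using ab d by simp
  then have m0: "0 < real m" using m by linarith
  define h where "h = (b - a) / real m"
  have h: "0 < h" "h < d" using m m0 ab d by (auto simp: h_def field_simps)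
  define idx where "idx r = nat \<lfloor>(r - a) / h\<rfloor>" for r
  define A where "A i = {a..b} \<inter> idx -` {i}" for i
  define c where "c i = \<gamma> (a + real i * h)" for i
  have [measurable]: "idx \<in> measurable borel (count_space UNIV)" unfolding idx_def by measurable
  have "A i \<in> sets borel" for i
    unfolding A_def using measurable_sets[of idx borel "count_space UNIV" "{i}"] by auto
  \<comment> \<open>There are \<open>Suc m\<close> pieces because the end point \<open>b\<close> has
    index \<open>m\<close>.\<close>
  moreover have "norm (\<gamma> r - (\<Sum>i<Suc m. indicator (A i) r *\<^sub>R c i)) \<le> e" for r
  proof (cases "r \<in> {a..b}")
    case False
    then have "(\<Sum>i<Suc m. indicator (A i) r *\<^sub>R c i) = 0" by (intro sum.neutral ballI) (use False in \<open>auto simp: A_def indicator_def\<close>)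
    then show ?thesis using \<gamma>(2)[OF False] e by simp
  next
    case True
    have fl: "real (idx r) \<le> (r - a) / h" "(r - a) / h < real (idx r) + 1"
      unfolding idx_def using True h by (simp_all add: of_nat_nat)
    then have i: "a + real (idx r) * h \<le> r" "r < a + real (idx r) * h + h"
      using h by (simp_all add: pos_le_divide_eq pos_divide_less_eq algebra_simps)
    have "(r - a) / h \<le> real m" using True h m0 by (simp add: h_def field_simps)
    then have "idx r < Suc m" using fl(1) by linarith
    then have "(\<Sum>i<Suc m. indicator (A i) r *\<^sub>R c i) = (\<Sum>i<Suc m. if i = idx r then c i else 0)"
      using True by (intro sum.cong) (auto simp: A_def)
    also have "\<dots> = c (idx r)" using \<open>idx r < Suc m\<close> by (subst sum.delta) auto
    finally have "(\<Sum>i<Suc m. indicator (A i) r *\<^sub>R c i) = c (idx r)" .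
    moreover have "dist (\<gamma> r) (c (idx r)) < e"
      unfolding c_def using i h True by (intro d(2)) (auto simp: dist_real_def intro: order_trans)
    ultimately show ?thesis by (simp add: dist_norm less_imp_le)
  qed
  ultimately show ?thesis by blast
qed

section \<open>Iterated potentials on the product of time and probability space\<close>

context killed_process
begin

interpretation LM: pair_sigma_finite lborel M ..

abbreviation PM :: "(real \<times> 'w) measure" where "PM \<equiv> lborel \<Otimes>\<^sub>M M"

text \<open>A form of survival whose joint measurability is inherited from \<open>X_joint\<close>.
  By \<open>alive_eq_indicator\<close> it describes the times up to \<tau>, apart from null
  sets.\<close>

definition alive :: "real \<Rightarrow> real \<times> 'w \<Rightarrow> real" where
  "alive t p = (if 0 \<le> fst p \<and> a < X t (max (fst p) 0) (snd p) then 1 else 0)"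

lemma alive_measurable [measurable]: "t \<le> b \<Longrightarrow> alive t \<in> borel_measurable PM"
proof -
  assume t: "t \<le> b"
  note [measurable] = X_joint'[OF t]
  show ?thesis unfolding alive_def by measurable
qed

lemma alive_nonneg: "0 \<le> alive t p" by (simp add: alive_def)

lemma integrable_alive_exp:
  assumes t: "t \<le> b" and c: "0 \<le> c"
  shows "integrable PM (\<lambda>p. alive t p * exp (c * fst p))"
proof (rule LM.Fubini_integrable)
  show "(\<lambda>p. alive t p * exp (c * fst p)) \<in> borel_measurable PM" using t by measurable
  \<comment> \<open>Rate c + 1 leaves exp(-s) against the weight exp(c s).\<close>
  obtain C where C: "0 \<le> C" "\<forall>t\<le>b. \<forall>s\<ge>0. prob {\<omega>\<in>space M. a < X t s \<omega>} \<le> C * exp (- ((c + 1) * s))"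
  proof -
    have "0 < c + 1" using c by simp
    from tail[OF this] show thesis by (elim exE conjE) (rule that)
  qed
  have inner: "(LINT \<omega>|M. norm (alive t (s, \<omega>) * exp (c * fst (s, \<omega>)))) = (if 0 \<le> s then exp (c * s) * prob {\<omega>\<in>space M. a < X t s \<omega>} else 0)" for s
  proof (cases "0 \<le> s")
    case True
    have "(LINT \<omega>|M. norm (alive t (s, \<omega>) * exp (c * fst (s, \<omega>)))) = (LINT \<omega>|M. exp (c * s) * indicator {\<omega>\<in>space M. a < X t s \<omega>} \<omega>)"
    proof (rule Bochner_Integration.integral_cong[OF refl])
      fix \<omega> assume "\<omega> \<in> space M"
      then show "norm (alive t (s, \<omega>) * exp (c * fst (s, \<omega>))) = exp (c * s) * indicator {\<omega>\<in>space M. a < X t s \<omega>} \<omega>"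
        using True by (simp add: alive_def indicator_def)
    qed
    moreover have "{\<omega>\<in>space M. a < X t s \<omega>} \<in> events" using t True by measurable
    ultimately show ?thesis using True by simp
  qed (simp add: alive_def)
  show "integrable lborel (\<lambda>s. LINT \<omega>|M. norm (alive t (s, \<omega>) * exp (c * fst (s, \<omega>))))"
  proof (rule Bochner_Integration.integrable_bound[OF integrable_mult_right[OF texp_integrable[of 1], of C]])
    have "(\<lambda>p. norm (alive t p * exp (c * fst p))) \<in> borel_measurable PM" using t by measurable
    then have "(\<lambda>(s, \<omega>). norm (alive t (s, \<omega>) * exp (c * fst (s, \<omega>)))) \<in> borel_measurable PM"
      by (simp only: case_prod_unfold prod.collapse)
    then show "(\<lambda>s. LINT \<omega>|M. norm (alive t (s, \<omega>) * exp (c * fst (s, \<omega>)))) \<in> borel_measurable lborel"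
      by (rule borel_measurable_lebesgue_integral)
    have "(if 0 \<le> s then exp (c * s) * prob {\<omega>\<in>space M. a < X t s \<omega>} else 0) \<le> C * texp 1 s" for s
    proof (cases "0 \<le> s")
      case True
      then have "exp (c * s) * prob {\<omega>\<in>space M. a < X t s \<omega>} \<le> exp (c * s) * (C * exp (- ((c + 1) * s)))"
        using C t by (intro mult_left_mono) auto
      also have "\<dots> = C * texp 1 s" using True by (simp add: texp_def exp_add[symmetric] algebra_simps)
      finally show ?thesis using True by simp
    qed (use C texp_nonneg in simp)
    note le = this
    show "AE s in lborel. norm (LINT \<omega>|M. norm (alive t (s, \<omega>) * exp (c * fst (s, \<omega>)))) \<le> norm (C * texp 1 s)"
    proof (rule AE_I2)
      fix s
      have "0 \<le> (if 0 \<le> s then exp (c * s) * prob {\<omega>\<in>space M. a < X t s \<omega>} else 0)" by simp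
      then show "norm (LINT \<omega>|M. norm (alive t (s, \<omega>) * exp (c * fst (s, \<omega>)))) \<le> norm (C * texp 1 s)"
        unfolding inner unfolding real_norm_def using le[of s] by linarith
    qed
  qed simp
  show "AE s in lborel. integrable M (\<lambda>\<omega>. alive t (s, \<omega>) * exp (c * fst (s, \<omega>)))"
  proof (rule AE_I2)
    fix s
    have [measurable]: "(\<lambda>\<omega>. alive t (s, \<omega>)) \<in> borel_measurable M"
      using measurable_compose[OF measurable_Pair1' alive_measurable[OF t], of s] by simp
    show "integrable M (\<lambda>\<omega>. alive t (s, \<omega>) * exp (c * fst (s, \<omega>)))"
    proof (rule integrable_const_bound[where B = "exp (c * s)"])
      show "AE \<omega> in M. norm (alive t (s, \<omega>) * exp (c * fst (s, \<omega>))) \<le> exp (c * s)"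
        by (rule AE_I2) (simp add: alive_def)
    qed measurable
  qed
qed

lemma integrable_alive:
  fixes h :: "real \<times> 'w \<Rightarrow> real"
  assumes t: "t \<le> b" and c: "0 \<le> c" and h: "h \<in> borel_measurable PM"
    and bd: "\<And>p. \<bar>h p\<bar> \<le> alive t p * (B * exp (c * fst p))"
  shows "integrable PM h"
proof (rule Bochner_Integration.integrable_bound[OF integrable_mult_right[OF integrable_alive_exp[OF t c], of B] h])
  show "AE p in PM. norm (h p) \<le> norm (B * (alive t p * exp (c * fst p)))"
  proof (rule AE_I2)
    fix p
    have "\<bar>h p\<bar> \<le> B * (alive t p * exp (c * fst p))" using bd[of p] by (simp add: mult.left_commute)
    then show "norm (h p) \<le> norm (B * (alive t p * exp (c * fst p)))" unfolding real_norm_def by linarith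
  qed
qed

text \<open>With time and chance in a single integral, the series over \<open>n\<close> can later be
  summed pointwise under it.\<close>

lemma \<Phi>_prod:
  assumes f [measurable]: "f \<in> borel_measurable borel" and B: "\<forall>x. \<bar>f x\<bar> \<le> B" and t: "t \<le> b"
  shows "integrable PM (\<lambda>p. alive t p * (tpow n (fst p) * f (X t (max (fst p) 0) (snd p))))"
    and "\<Phi> n f t = (LINT p|PM. alive t p * (tpow n (fst p) * f (X t (max (fst p) 0) (snd p))))"
proof -
  let ?h = "\<lambda>p. alive t p * (tpow n (fst p) * f (X t (max (fst p) 0) (snd p)))"
  have B0: "0 \<le> B" using B[rule_format, of 0] by linarith
  show int: "integrable PM ?h"
  proof (rule integrable_alive[OF t, of 1 _ B])
    show "?h \<in> borel_measurable PM" using t by measurable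
    fix p :: "real \<times> 'w"
    have "tpow n (fst p) * \<bar>f (X t (max (fst p) 0) (snd p))\<bar> \<le> exp (fst p) * B"
    proof (intro mult_mono)
      show "tpow n (fst p) \<le> exp (fst p)" by (simp add: tpow_def power_over_fact_le_exp)
    qed (use B in auto)
    then have "alive t p * (tpow n (fst p) * \<bar>f (X t (max (fst p) 0) (snd p))\<bar>) \<le> alive t p * (exp (fst p) * B)"
      by (rule mult_left_mono[OF _ alive_nonneg])
    then show "\<bar>?h p\<bar> \<le> alive t p * (B * exp (1 * fst p))"
      using alive_nonneg[of t p] tpow_nonneg[of n "fst p"] by (simp add: abs_mult mult.commute)
  qed simp
  have "\<Phi> n f t = (LINT s|lborel. (LINT \<omega>|M. ?h (s, \<omega>)))"
    unfolding \<Phi>_def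
  proof (rule Bochner_Integration.integral_cong[OF refl])
    fix s :: real
    show "tpow n s * Q s f t = (LINT \<omega>|M. ?h (s, \<omega>))"
    proof (cases "0 \<le> s")
      case True
      have "tpow n s * Q s f t = (LINT \<omega>|M. tpow n s * (indicator {a<..} (X t s \<omega>) * f (X t s \<omega>)))"
        by (simp add: Q_X[OF f True t])
      also have "\<dots> = (LINT \<omega>|M. ?h (s, \<omega>))"
        using True by (intro Bochner_Integration.integral_cong) (auto simp: alive_def indicator_def)
      finally show ?thesis .
    qed (simp add: tpow_def)
  qed
  then show "\<Phi> n f t = (LINT p|PM. ?h p)"
    using LM.integral_fst'[OF int] by simp
qed

abbreviation "p_law \<equiv> \<lambda>s t. distr M borel (X t s)"

text \<open>\<open>measure_of\<close> returns the intended values only for a countably additive set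
  function. Additivity holds because the set function is the image of Lebesgue measure on [0,
  \<infinity>) times \<open>M\<close> under evaluation of the path.\<close>

lemma potential_measure_eq:
  assumes t: "t \<le> b"
  shows "potential_measure p_law t = distr (density PM (\<lambda>p. ennreal (indicator {0..} (fst p)))) borel (\<lambda>p. X t (max (fst p) 0) (snd p))"
    (is "_ = distr ?L borel ?g")
proof -
  have [measurable]: "?g \<in> borel_measurable PM" using t by measurable
  have g: "?g \<in> measurable ?L borel" by measurable
  have "potential_measure p_law t = measure_of UNIV (sets borel) (emeasure (distr ?L borel ?g))"
    unfolding potential_measure_def
  proof (rule measure_of_eq)
    fix B :: "real set" assume "B \<in> sigma_sets UNIV (sets borel)"
    then have B [measurable]: "B \<in> sets borel" by (metis sets.sigma_sets_eq space_borel)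
    have "emeasure (distr ?L borel ?g) B = (\<integral>\<^sup>+p. ennreal (indicator {0..} (fst p)) * indicator (?g -` B \<inter> space ?L) p \<partial>PM)"
      using measurable_sets[OF g B] by (subst emeasure_distr[OF g B], subst emeasure_density) auto
    also have "\<dots> = (\<integral>\<^sup>+p. ennreal (indicator {0..} (fst p)) * indicator B (?g p) \<partial>PM)"
      by (rule nn_integral_cong) (auto simp: indicator_def)
    also have "\<dots> = (\<integral>\<^sup>+s. \<integral>\<^sup>+\<omega>. ennreal (indicator {0..} s) * indicator B (?g (s, \<omega>)) \<partial>M \<partial>lborel)"
      by (subst nn_integral_fst[symmetric]) (simp_all, measurable)
    also have "\<dots> = (\<integral>\<^sup>+s\<in>{0..}. emeasure (distr M borel (X t s)) B \<partial>lborel)"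
    proof (rule nn_integral_cong)
      fix s :: real
      show "(\<integral>\<^sup>+\<omega>. ennreal (indicator {0..} s) * indicator B (?g (s, \<omega>)) \<partial>M) = emeasure (distr M borel (X t s)) B * indicator {0..} s"
      proof (cases "0 \<le> s")
        case True
        have "(\<integral>\<^sup>+\<omega>. indicator B (X t s \<omega>) \<partial>M) = (\<integral>\<^sup>+y. indicator B y \<partial>distr M borel (X t s))"
          using True t by (subst nn_integral_distr) auto
        then show ?thesis using True by simp
      qed simp
    qed
    finally show "(\<integral>\<^sup>+s\<in>{0..}. emeasure (distr M borel (X t s)) B \<partial>lborel) = emeasure (distr ?L borel ?g) B" ..
  qed simp
  also have "\<dots> = distr ?L borel ?g"
    using measure_of_of_measure[of "distr ?L borel ?g"] by simp
  finally show ?thesis .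
qed

text \<open>The domain (a, t] may be replaced by (a, \<infinity>), since the process never exceeds
  \<open>t\<close> almost surely. The auxiliary \<open>h'\<close> is bounded and Borel everywhere,
  while the functions \<open>h\<close> that arise in the iteration are controlled on (a, b]
  only.\<close>

lemma frac_int_eq:
  assumes t: "t \<le> b" and h' [measurable]: "h' \<in> borel_measurable borel" and B: "\<forall>x. \<bar>h' x\<bar> \<le> B"
    and eq: "\<And>y. a < y \<Longrightarrow> y \<le> b \<Longrightarrow> h y = h' y"
  shows "frac_int p_law a h t = \<Phi> 0 h' t"
proof (cases "a < t")
  case False
  then show ?thesis by (simp add: frac_int_def \<Phi>_eq_0)
next
  case True
  let ?g = "\<lambda>p. X t (max (fst p) 0) (snd p)"
  let ?L = "density PM (\<lambda>p. ennreal (indicator {0..} (fst p)))"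
  have [measurable]: "?g \<in> borel_measurable PM" using t by measurable
  have "frac_int p_law a h t = (LINT y|potential_measure p_law t. indicator {a<..t} y *\<^sub>R h' y)"
    using True t eq by (auto simp: frac_int_def set_lebesgue_integral_def indicator_def intro!: Bochner_Integration.integral_cong)
  also have "\<dots> = (LINT p|?L. indicator {a<..t} (?g p) *\<^sub>R h' (?g p))"
    unfolding potential_measure_eq[OF t] by (rule integral_distr) measurable
  also have "\<dots> = (LINT p|PM. indicator {0..} (fst p) *\<^sub>R (indicator {a<..t} (?g p) *\<^sub>R h' (?g p)))"
    by (rule integral_density) (auto, measurable)
  also have "\<dots> = (LINT p|PM. alive t p * (tpow 0 (fst p) * h' (?g p)))"
  proof (rule integral_cong_AE)
    have "AE p in PM. ?g p \<le> t"
    proof -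
      have "AE s in lborel. AE \<omega> in M. ?g (s, \<omega>) \<le> t"
      proof (rule always_eventually, rule allI)
        fix s :: real
        show "AE \<omega> in M. ?g (s, \<omega>) \<le> t" using X_le[OF t] by eventually_elim simp
      qed
      moreover have "{p \<in> space PM. ?g p \<le> t} \<in> sets PM" by measurable
      ultimately show ?thesis using LM.AE_pair_iff[of "\<lambda>s \<omega>. X t (max s 0) \<omega> \<le> t"] by simp
    qed
    then show "AE p in PM. indicator {0..} (fst p) *\<^sub>R (indicator {a<..t} (?g p) *\<^sub>R h' (?g p)) = alive t p * (tpow 0 (fst p) * h' (?g p))"
      by eventually_elim (auto simp: alive_def tpow_def indicator_def)
  qed (use t in measurable)
  also have "\<dots> = \<Phi> 0 h' t" by (rule \<Phi>_prod(2)[OF h' B t, symmetric])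
  finally show ?thesis .
qed

lemma frac_int_\<Phi>:
  assumes t: "t \<le> b" and f: "f \<in> borel_measurable borel" and B: "\<forall>x. \<bar>f x\<bar> \<le> B"
    and eq: "\<And>y. a < y \<Longrightarrow> y \<le> b \<Longrightarrow> h y = \<Phi> n f y"
  shows "frac_int p_law a h t = \<Phi> (Suc n) f t"
proof -
  have [measurable]: "\<Phi> n f \<in> borel_measurable borel" by (rule \<Phi>_measurable[OF f])
  \<comment> \<open>The bound on \<Phi> covers arguments up to \<open>b\<close>; the cutoff makes it
    global.\<close>
  define h' where "h' y = indicator {a<..b} y * \<Phi> n f y" for y
  have h' [measurable]: "h' \<in> borel_measurable borel" unfolding h'_def by measurable
  obtain C where C: "0 \<le> C" "\<forall>n f B t. f \<in> borel_measurable borel \<longrightarrow> (\<forall>x. \<bar>f x\<bar> \<le> B) \<longrightarrow> t \<le> b \<longrightarrow> \<bar>\<Phi> n f t\<bar> \<le> B * C"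
    by (rule \<Phi>_bound)
  have B0: "0 \<le> B" using B[rule_format, of 0] by linarith
  have bd: "\<forall>x. \<bar>h' x\<bar> \<le> B * C" using C f B B0 by (auto simp: h'_def indicator_def)
  have "frac_int p_law a h t = \<Phi> 0 h' t"
    by (rule frac_int_eq[OF t h' bd]) (simp add: eq h'_def)
  also have "\<dots> = (LINT s|lborel. tpow 0 s * (LINT \<omega>|M. indicator {a<..} (X t s \<omega>) * h' (X t s \<omega>)))"
    unfolding \<Phi>_def
  proof (rule Bochner_Integration.integral_cong[OF refl])
    fix s
    show "tpow 0 s * Q s h' t = tpow 0 s * (LINT \<omega>|M. indicator {a<..} (X t s \<omega>) * h' (X t s \<omega>))"
      using Q_X[OF h' _ t, of s] by (cases "0 \<le> s") (simp_all add: tpow_def)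
  qed
  also have "\<dots> = \<Phi> (Suc n) f t"
    by (rule \<Phi>_Suc[OF f B t]) (simp add: h'_def)
  finally show ?thesis .
qed

text \<open>\<open>\<Phi> 0\<close> is already one application of the operator, hence the shift
  between exponent and index.\<close>

lemma frac_int_pow_one:
  "t \<le> b \<Longrightarrow> (frac_int p_law a ^^ Suc n) (\<lambda>_. 1) t = \<Phi> n (\<lambda>_. 1) t"
proof (induction n arbitrary: t)
  case 0
  then show ?case using frac_int_eq[of t "\<lambda>_. 1" 1 "\<lambda>_. 1"] by simp
next
  case (Suc n)
  have "frac_int p_law a ((frac_int p_law a ^^ Suc n) (\<lambda>_. 1)) t = \<Phi> (Suc n) (\<lambda>_. 1) t"
    by (rule frac_int_\<Phi>[OF Suc.prems, of _ 1]) (use Suc.IH in auto)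
  then show ?case by simp
qed

text \<open>Stands for a function of time and space, the value at \<open>r\<close> being its space
  section. Vanishing outside [a, b] makes the evaluations bounded Borel functions on the whole
  line.\<close>

definition curve :: "(real \<Rightarrow> 'c::metric_space c0) \<Rightarrow> bool" where
  "curve \<gamma> \<longleftrightarrow> continuous_on {a..b} \<gamma> \<and> (\<forall>r. r \<notin> {a..b} \<longrightarrow> \<gamma> r = 0)"

lemma curve_compose: "curve \<gamma> \<Longrightarrow> bounded_linear L \<Longrightarrow> curve (\<lambda>r. L (\<gamma> r))"
  unfolding curve_def
  by (auto intro: bounded_linear.continuous_on linear_0 bounded_linear.linear)

lemma curve_bounded:
  assumes "curve \<gamma>" obtains B where "0 \<le> B" "\<forall>r. norm (\<gamma> r) \<le> B"
proof -
  have "bounded (\<gamma> ` {a..b})"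
    using assms by (intro compact_imp_bounded compact_continuous_image) (auto simp: curve_def)
  then obtain B where B: "\<forall>r\<in>{a..b}. norm (\<gamma> r) \<le> B" unfolding bounded_iff by auto
  have "norm (\<gamma> r) \<le> max B 0" for r
    using assms B by (cases "r \<in> {a..b}") (auto simp: curve_def max.coboundedI1)
  then show thesis by (intro that[of "max B 0"]) auto
qed

lemma curve_ev_measurable:
  assumes "curve \<gamma>" shows "(\<lambda>r. ev (\<gamma> r) x) \<in> borel_measurable borel"
proof -
  have "continuous_on {a..b} (\<lambda>r. ev (\<gamma> r) x)"
    using assms by (intro bounded_linear.continuous_on[OF bounded_linear_ev]) (simp add: curve_def)
  then have "(\<lambda>r. indicator {a..b} r *\<^sub>R ev (\<gamma> r) x) \<in> borel_measurable borel"
    by (intro borel_measurable_continuous_on_indicator) auto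
  moreover have "(\<lambda>r. indicator {a..b} r *\<^sub>R ev (\<gamma> r) x) = (\<lambda>r. ev (\<gamma> r) x)"
    using assms by (auto simp: curve_def indicator_def fun_eq_iff)
  ultimately show ?thesis by simp
qed

lemma \<Phi>_sum_indicator:
  fixes m :: nat and A :: "nat \<Rightarrow> real set" and c :: "nat \<Rightarrow> real"
  assumes "\<And>i. i < m \<Longrightarrow> A i \<in> sets borel" and t: "t \<le> b"
  shows "\<Phi> n (\<lambda>r. \<Sum>i<m. indicator (A i) r * c i) t = (\<Sum>i<m. c i * \<Phi> n (indicator (A i)) t)"
  using assms(1)
proof (induction m)
  case 0
  show ?case by (simp add: \<Phi>_def Q_def)
next
  case (Suc m)
  have [measurable]: "A i \<in> sets borel" if "i < Suc m" for i using Suc.prems that .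
  have 1: "(\<lambda>r. \<Sum>i<m. indicator (A i) r * c i) \<in> borel_measurable borel"
    by (intro borel_measurable_sum borel_measurable_times borel_measurable_indicator) auto
  have 2: "\<forall>r. \<bar>\<Sum>i<m. indicator (A i) r * c i\<bar> \<le> (\<Sum>i<m. \<bar>c i\<bar>)"
  proof (intro allI order_trans[OF sum_abs] sum_mono)
    fix r i show "\<bar>indicator (A i) r * c i\<bar> \<le> \<bar>c i\<bar>" by (simp add: indicator_def)
  qed
  have 3: "indicator (A m) \<in> borel_measurable borel" by (intro borel_measurable_indicator) auto
  have 4: "\<forall>r. \<bar>indicator (A m) r\<bar> \<le> (1::real)" by (simp add: indicator_def)
  show ?case
    using \<Phi>_add[OF 1 2 3 4 t, where c = "c m" and n = n] Suc by (simp add: mult.commute)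
qed

text \<open>Approximating the curve uniformly by step functions, the functional \<open>f \<mapsto> \<Phi> n f t\<close> can be
  interchanged with bounded operators on the space variable.\<close>

lemma \<Phi>_curve:
  fixes \<gamma> :: "real \<Rightarrow> 'c::metric_space c0"
  assumes \<gamma>: "curve \<gamma>" and t: "t \<le> b"
  obtains G where "\<forall>L x. bounded_linear L \<longrightarrow> ev (L G) x = \<Phi> n (\<lambda>r. ev ((L (\<gamma> r)) :: 'c c0) x) t"
proof -
  obtain C where C: "0 \<le> C" "\<forall>n f B t. f \<in> borel_measurable borel \<longrightarrow> (\<forall>x. \<bar>f x\<bar> \<le> B) \<longrightarrow> t \<le> b \<longrightarrow> \<bar>\<Phi> n f t\<bar> \<le> B * C"
    by (rule \<Phi>_bound)
  define e where "e k = 1 / real (Suc k)" for k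
  have e: "0 < e k" for k by (simp add: e_def)
  have e_lim: "e \<longlonglongrightarrow> 0" using LIMSEQ_inverse_real_of_nat by (simp add: e_def[abs_def] inverse_eq_divide)
  have "\<forall>k. \<exists>G. \<forall>L x. bounded_linear L \<longrightarrow> \<bar>\<Phi> n (\<lambda>r. ev ((L (\<gamma> r)) :: 'c c0) x) t - ev (L G) x\<bar> \<le> (onorm L * e k) * C"
  proof
    fix k
    have "\<exists>m A c. (\<forall>i::nat. A i \<in> sets borel) \<and> (\<forall>r. norm (\<gamma> r - (\<Sum>i<m. indicator (A i) r *\<^sub>R c i)) \<le> e k)"
      using \<gamma> e by (intro curve_step[OF ab]) (auto simp: curve_def)
    then obtain m A c where A: "\<forall>i::nat. A i \<in> sets borel"
      and step: "\<forall>r. norm (\<gamma> r - (\<Sum>i<m. indicator (A i) r *\<^sub>R c i)) \<le> e k" by (elim exE conjE)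
    \<comment> \<open>On a step function \<Phi> acts on scalar indicators, so the same vector works
      for every \<open>L\<close> and \<open>x\<close>.\<close>
    define G where "G = (\<Sum>i<m. \<Phi> n (indicator (A i)) t *\<^sub>R c i)"
  have close: "\<bar>\<Phi> n (\<lambda>r. ev (L (\<gamma> r)) x) t - ev (L G) x\<bar> \<le> (onorm L * e k) * C"
    if L: "bounded_linear L" for L :: "'c c0 \<Rightarrow> 'c c0" and x
  proof -
    interpret L: bounded_linear L by (rule L)
    let ?st = "\<lambda>r. \<Sum>i<m. indicator (A i) r * ev (L (c i)) x"
    have stm: "?st \<in> borel_measurable borel"
      using A by (intro borel_measurable_sum borel_measurable_times borel_measurable_indicator) auto
    have stb: "\<forall>r. \<bar>?st r\<bar> \<le> (\<Sum>i<m. \<bar>ev (L (c i)) x\<bar>)"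
      by (intro allI order_trans[OF sum_abs] sum_mono) (simp add: indicator_def)
    have cm: "(\<lambda>r. ev (L (\<gamma> r)) x) \<in> borel_measurable borel"
      by (rule curve_ev_measurable[OF curve_compose[OF \<gamma> L]])
    obtain B where B: "\<forall>r. norm (L (\<gamma> r)) \<le> B" by (rule curve_bounded[OF curve_compose[OF \<gamma> L]])
    have cb: "\<forall>r. \<bar>ev (L (\<gamma> r)) x\<bar> \<le> B" using order_trans[OF abs_ev_le B[rule_format]] by simp
    have diff: "\<bar>ev (L (\<gamma> r)) x + (-1) * ?st r\<bar> \<le> onorm L * e k" for r
    proof -
      have "ev (L (\<gamma> r)) x + (-1) * ?st r = ev (L (\<gamma> r - (\<Sum>i<m. indicator (A i) r *\<^sub>R c i))) x"
        by (simp add: L.diff L.sum L.scaleR ev_sum)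
      also have "\<bar>\<dots>\<bar> \<le> onorm L * norm (\<gamma> r - (\<Sum>i<m. indicator (A i) r *\<^sub>R c i))"
        by (rule order_trans[OF abs_ev_le onorm[OF L]])
      also have "\<dots> \<le> onorm L * e k" by (intro mult_left_mono step[rule_format] onorm_pos_le[OF L])
      finally show ?thesis .
    qed
    have "ev (L G) x = \<Phi> n ?st t"
      using A by (subst \<Phi>_sum_indicator[OF _ t]) (auto simp: G_def L.sum L.scaleR ev_sum mult.commute)
    then have "\<Phi> n (\<lambda>r. ev (L (\<gamma> r)) x) t - ev (L G) x = \<Phi> n (\<lambda>r. ev (L (\<gamma> r)) x + (-1) * ?st r) t"
      by (subst \<Phi>_add[OF cm cb stm stb t]) simp
    moreover have "(\<lambda>r. ev (L (\<gamma> r)) x + (-1) * ?st r) \<in> borel_measurable borel"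
      using cm stm by measurable
    ultimately show ?thesis
      using C(2)[rule_format, of "\<lambda>r. ev (L (\<gamma> r)) x + (-1) * ?st r" "onorm L * e k" t n] diff t by simp
  qed
  then show "\<exists>G. \<forall>L x. bounded_linear L \<longrightarrow> \<bar>\<Phi> n (\<lambda>r. ev ((L (\<gamma> r)) :: 'c c0) x) t - ev (L G) x\<bar> \<le> (onorm L * e k) * C"
    by (intro exI[of _ G] allI impI)
  qed
  from choice[OF this] obtain G where G: "\<forall>k L x. bounded_linear L \<longrightarrow> \<bar>\<Phi> n (\<lambda>r. ev ((L (\<gamma> r)) :: 'c c0) x) t - ev (L (G k)) x\<bar> \<le> (onorm L * e k) * C" ..
  note close = G[rule_format]
  have lim: "(\<lambda>k. ev (L (G k)) x) \<longlonglongrightarrow> \<Phi> n (\<lambda>r. ev (L (\<gamma> r)) x) t" if L: "bounded_linear L" for L :: "'c c0 \<Rightarrow> 'c c0" and x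
  proof (rule LIM_zero_cancel, rule Lim_null_comparison)
    show "\<forall>\<^sub>F k in sequentially. norm (ev (L (G k)) x - \<Phi> n (\<lambda>r. ev (L (\<gamma> r)) x) t) \<le> (onorm L * e k) * C"
      using close[OF L, of x] by (intro always_eventually allI) (simp add: abs_minus_commute)
    show "(\<lambda>k. (onorm L * e k) * C) \<longlonglongrightarrow> 0"
      using tendsto_mult[OF tendsto_mult[OF tendsto_const e_lim] tendsto_const, of "onorm L" C] by simp
  qed
  \<comment> \<open>With the identity for \<open>L\<close>, the bounds are uniform in
    \<open>x\<close> and thus bounds in the sup norm.\<close>
  have "Cauchy G"
  proof (rule CauchyI)
    fix \<epsilon> :: real assume \<epsilon>: "0 < \<epsilon>"
    define D where "D = onorm (\<lambda>x::'c c0. x) * C + 1"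
    have D: "0 < D" unfolding D_def
      by (intro add_nonneg_pos mult_nonneg_nonneg onorm_pos_le[OF bounded_linear_ident] C(1)) simp
    have nb: "norm (G k - G l) \<le> D * e k + D * e l" for k l
    proof (rule norm_c0_leI)
      fix x
      have "\<bar>\<Phi> n (\<lambda>r. ev (\<gamma> r) x) t - ev (G k) x\<bar> \<le> D * e k" for k
        using close[OF bounded_linear_ident, of x k] e[of k] by (simp add: D_def algebra_simps)
      from this[of k] this[of l] show "\<bar>ev (G k - G l) x\<bar> \<le> D * e k + D * e l" by simp
    qed
    have "eventually (\<lambda>k. e k < \<epsilon> / (2 * D)) sequentially"
      using order_tendstoD(2)[OF e_lim] \<epsilon> D by simp
    then obtain N where N: "\<forall>k\<ge>N. e k < \<epsilon> / (2 * D)" unfolding eventually_sequentially ..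
    have "norm (G k - G l) < \<epsilon>" if "N \<le> k" "N \<le> l" for k l
    proof -
      have "D * e k < \<epsilon> / 2" "D * e l < \<epsilon> / 2"
        using N[rule_format, OF that(1)] N[rule_format, OF that(2)] D by (simp_all add: pos_less_divide_eq mult.commute mult.left_commute)
      then show ?thesis using nb[of k l] by linarith
    qed
    then show "\<exists>N. \<forall>k\<ge>N. \<forall>l\<ge>N. norm (G k - G l) < \<epsilon>" by (intro exI[of _ N] allI impI)
  qed
  from Cauchy_convergent_iff[THEN iffD1, OF this] obtain G' where G': "G \<longlonglongrightarrow> G'"
    unfolding convergent_def ..
  have "ev (L G') x = \<Phi> n (\<lambda>r. ev (L (\<gamma> r)) x) t" if L: "bounded_linear L" for L :: "'c c0 \<Rightarrow> 'c c0" and x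
    by (rule LIMSEQ_unique[OF bounded_linear.tendsto[OF bounded_linear_compose[OF bounded_linear_ev L] G'] lim[OF L]])
  then show thesis by (intro that[of G'] allI impI)
qed

end

text \<open>The absolute series is dominated by exp(s) W. In the applications \<open>s\<close> is 2
  lam times the time, as dictated by the norm bound on powers of \<open>yos\<close>.\<close>

lemma sums_integral_exp:
  fixes h :: "nat \<Rightarrow> 'z \<Rightarrow> real"
  assumes h [measurable]: "\<And>n. h n \<in> borel_measurable N"
    and s: "\<And>z. 0 \<le> s z" and W: "\<And>z. 0 \<le> W z"
    and bd: "\<And>n z. \<bar>h n z\<bar> \<le> s z ^ n / fact n * W z"
    and int: "integrable N (\<lambda>z. exp (s z) * W z)"
  shows "(\<lambda>n. LINT z|N. h n z) sums (LINT z|N. (\<Sum>n. h n z))" "integrable N (\<lambda>z. \<Sum>n. h n z)"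
proof -
  have i: "integrable N (h n)" for n
  proof (rule Bochner_Integration.integrable_bound[OF int h], rule AE_I2)
    fix z
    have "\<bar>h n z\<bar> \<le> exp (s z) * W z"
      by (rule order_trans[OF bd mult_right_mono[OF power_over_fact_le_exp[OF s] W]])
    then show "norm (h n z) \<le> norm (exp (s z) * W z)" unfolding real_norm_def by linarith
  qed
  have sm: "AE z in N. summable (\<lambda>n. norm (h n z))"
  proof (rule AE_I2, rule summable_comparison_test')
    fix z n
    show "summable (\<lambda>n. s z ^ n / fact n * W z)"
      using summable_exp[of "s z"] by (intro summable_mult2) (simp add: divide_inverse mult.commute)
    show "norm (norm (h n z)) \<le> s z ^ n / fact n * W z" using bd by simp
  qed
  have si: "summable (\<lambda>n. LINT z|N. norm (h n z))"
  proof (rule bounded_imp_summable)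
    show "0 \<le> (LINT z|N. norm (h n z))" for n by simp
    fix K
    have "(\<Sum>n\<le>K. LINT z|N. norm (h n z)) = (LINT z|N. (\<Sum>n\<le>K. norm (h n z)))"
      using i by (intro Bochner_Integration.integral_sum[symmetric] integrable_norm)
    also have "\<dots> \<le> (LINT z|N. exp (s z) * W z)"
    proof (rule integral_mono[OF _ int])
      show "integrable N (\<lambda>z. \<Sum>n\<le>K. norm (h n z))" using i by (intro Bochner_Integration.integrable_sum integrable_norm)
      fix z
      have "(\<Sum>n\<le>K. norm (h n z)) \<le> (\<Sum>n\<le>K. s z ^ n / fact n) * W z"
        unfolding sum_distrib_right using bd by (intro sum_mono) simp
      also have "\<dots> \<le> exp (s z) * W z" by (rule mult_right_mono[OF exp_partial_sum_le[OF s] W])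
      finally show "(\<Sum>n\<le>K. norm (h n z)) \<le> exp (s z) * W z" .
    qed
    finally show "(\<Sum>n\<le>K. LINT z|N. norm (h n z)) \<le> (LINT z|N. exp (s z) * W z)" .
  qed
  show "(\<lambda>n. LINT z|N. h n z) sums (LINT z|N. (\<Sum>n. h n z))" by (rule sums_integral[OF i sm si])
  show "integrable N (\<lambda>z. \<Sum>n. h n z)" by (rule integrable_suminf[OF i sm si])
qed

section \<open>The hitting time\<close>

lemma hitting_time_nonneg: "0 \<le> hitting_time c w \<omega>"
  unfolding hitting_time_def by (rule Inf_greatest) auto

lemma hitting_time_le: "0 \<le> s \<Longrightarrow> w s \<omega> \<le> c \<Longrightarrow> hitting_time c w \<omega> \<le> ereal s"
  unfolding hitting_time_def by (rule Inf_lower) auto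

lemma ereal_hitting_time:
  "hitting_time c w \<omega> \<noteq> \<infinity> \<Longrightarrow> ereal (real_of_ereal (hitting_time c w \<omega>)) = hitting_time c w \<omega>"
  using hitting_time_nonneg[of c w \<omega>] by (intro ereal_real') auto

context killed_process
begin

interpretation LM: pair_sigma_finite lborel M ..

context
  fixes t :: real assumes t: "t \<le> b"
begin

text \<open>On the event of an infinite hitting time this is 0, the default of
  \<open>real_of_ereal\<close>; the event is null by \<open>AE_hitting_time_finite\<close>.\<close>

definition "\<tau> \<omega> = real_of_ereal (hitting_time a (X t) \<omega>)"

lemma tau_nonneg: "0 \<le> \<tau> \<omega>"
  unfolding \<tau>_def by (rule real_of_ereal_pos[OF hitting_time_nonneg])

lemma hitting_time_eq_tau: "hitting_time a (X t) \<omega> \<noteq> \<infinity> \<Longrightarrow> hitting_time a (X t) \<omega> = ereal (\<tau> \<omega>)"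
  unfolding \<tau>_def by (rule ereal_hitting_time[symmetric])

lemma hitting_time_lessD:
  assumes "\<omega> \<in> space M" "hitting_time a (X t) \<omega> < ereal s"
  shows "X t s \<omega> \<le> a"
proof -
  obtain s' where s': "0 \<le> s'" "X t s' \<omega> \<le> a" "s' < s"
    using assms(2) unfolding hitting_time_def Inf_less_iff by auto
  then show ?thesis using X_mono[OF t s'(1), of s \<omega>] assms(1) by simp
qed

text \<open>Monotonicity reduces a condition at all times to integer times, hence to a measurable
  event.\<close>

lemma hitting_time_infinite_iff:
  assumes "\<omega> \<in> space M"
  shows "hitting_time a (X t) \<omega> = \<infinity> \<longleftrightarrow> (\<forall>n::nat. a < X t (real n) \<omega>)"
proof
  assume inf: "hitting_time a (X t) \<omega> = \<infinity>"
  show "\<forall>n::nat. a < X t (real n) \<omega>"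
  proof (rule allI, rule ccontr)
    fix n :: nat assume "\<not> a < X t (real n) \<omega>"
    then have "hitting_time a (X t) \<omega> \<le> ereal (real n)" by (intro hitting_time_le) auto
    then show False using inf by simp
  qed
next
  assume al: "\<forall>n::nat. a < X t (real n) \<omega>"
  show "hitting_time a (X t) \<omega> = \<infinity>"
  proof (rule ccontr)
    assume fin: "hitting_time a (X t) \<omega> \<noteq> \<infinity>"
    obtain n :: nat where n: "\<tau> \<omega> < real n" using reals_Archimedean2 by blast
    have "hitting_time a (X t) \<omega> < ereal (real n)"
      using n unfolding hitting_time_eq_tau[OF fin] by simp
    from hitting_time_lessD[OF assms this] al show False by (simp add: not_less[symmetric])
  qed
qed

lemma AE_hitting_time_finite: "AE \<omega> in M. hitting_time a (X t) \<omega> \<noteq> \<infinity>"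
proof -
  obtain C where C: "0 \<le> C" "\<forall>t\<le>b. \<forall>s\<ge>0. prob {\<omega>\<in>space M. a < X t s \<omega>} \<le> C * exp (- (1 * s))"
    using tail[OF zero_less_one] by (elim exE conjE)
  let ?Z = "{\<omega>\<in>space M. \<forall>n::nat. a < X t (real n) \<omega>}"
  have [measurable]: "X t (real n) \<in> borel_measurable M" for n using t by simp
  have Z: "?Z \<in> events" by measurable
  have "prob ?Z \<le> C * exp (- real n)" for n :: nat
  proof -
    have "prob ?Z \<le> prob {\<omega>\<in>space M. a < X t (real n) \<omega>}" by (rule finite_measure_mono) auto
    also have "\<dots> \<le> C * exp (- real n)" using C(2) t by simp
    finally show ?thesis .
  qed
  moreover have "(\<lambda>n. C * exp (- real n)) \<longlonglongrightarrow> C * 0"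
    by (intro tendsto_mult tendsto_const filterlim_compose[OF exp_at_bot] filterlim_compose[OF filterlim_uminus_at_bot_at_top] filterlim_real_sequentially)
  ultimately have "prob ?Z \<le> 0"
    by (intro LIMSEQ_le_const[of "\<lambda>n. C * exp (- real n)" 0]) auto
  then have "prob ?Z = 0" using measure_nonneg[of M ?Z] by linarith
  then have "AE \<omega> in M. \<omega> \<notin> ?Z"
    using prob_eq_0[OF Z] by simp
  then show ?thesis using AE_space by eventually_elim (auto simp: hitting_time_infinite_iff)
qed

context
  fixes F :: "'w measure"
  assumes sp: "space F = space M" and F: "\<And>s. 0 \<le> s \<Longrightarrow> X t s \<in> borel_measurable F"
begin

lemma infinite_hitting_time_sets: "{\<omega>\<in>space F. hitting_time a (X t) \<omega> = \<infinity>} \<in> sets F"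
proof -
  have [measurable]: "X t (real n) \<in> borel_measurable F" for n by (rule F) simp
  have "{\<omega>\<in>space F. \<forall>n::nat. a < X t (real n) \<omega>} \<in> sets F" by measurable
  also have "{\<omega>\<in>space F. \<forall>n::nat. a < X t (real n) \<omega>} = {\<omega>\<in>space F. hitting_time a (X t) \<omega> = \<infinity>}"
    using hitting_time_infinite_iff sp by auto
  finally show ?thesis .
qed

text \<open>The \<sigma>-algebra is left general because two are used: that of \<open>M\<close>, and
  the one generated by the path of \<open>X t\<close>, which is independent of the path of
  \<open>Y x\<close>.\<close>

lemma tau_measurable: "\<tau> \<in> borel_measurable F"
proof (rule borel_measurableI_less)
  fix c :: real
  \<comment> \<open>The default value 0 puts the infinite hitting times into the event for every
    positive \<open>c\<close>. For finite ones, monotonicity and a rational time between \<tau> and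
    \<open>c\<close> suffice.\<close>
  have eq: "{\<omega>\<in>space F. \<tau> \<omega> < c} = (if c \<le> 0 then {} else
      {\<omega>\<in>space F. hitting_time a (X t) \<omega> = \<infinity>} \<union> (\<Union>q\<in>{q\<in>\<rat>. 0 \<le> q \<and> q < c}. {\<omega>\<in>space F. X t q \<omega> \<le> a}))"
  proof (cases "c \<le> 0")
    case True then show ?thesis using tau_nonneg by (auto simp: not_less intro: order_trans)
  next
    case c: False
    have "\<tau> \<omega> < c \<longleftrightarrow> hitting_time a (X t) \<omega> = \<infinity> \<or> (\<exists>q\<in>{q\<in>\<rat>. 0 \<le> q \<and> q < c}. X t q \<omega> \<le> a)"
      if \<omega>: "\<omega> \<in> space M" for \<omega>
    proof (cases "hitting_time a (X t) \<omega> = \<infinity>")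
      case True then show ?thesis using c by (simp add: \<tau>_def)
    next
      case False
      note fin = hitting_time_eq_tau[OF False]
      show ?thesis
      proof
        assume "\<tau> \<omega> < c"
        then obtain q where q: "q \<in> \<rat>" "\<tau> \<omega> < q" "q < c" using Rats_dense_in_real by blast
        have "hitting_time a (X t) \<omega> < ereal q" using q(2) unfolding fin by simp
        then have "X t q \<omega> \<le> a" by (rule hitting_time_lessD[OF \<omega>])
        then show "hitting_time a (X t) \<omega> = \<infinity> \<or> (\<exists>q\<in>{q\<in>\<rat>. 0 \<le> q \<and> q < c}. X t q \<omega> \<le> a)"
          using q tau_nonneg[of \<omega>] by auto
      next
        assume "hitting_time a (X t) \<omega> = \<infinity> \<or> (\<exists>q\<in>{q\<in>\<rat>. 0 \<le> q \<and> q < c}. X t q \<omega> \<le> a)"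
        then obtain q where q: "0 \<le> q" "q < c" "X t q \<omega> \<le> a" using False by auto
        have "hitting_time a (X t) \<omega> \<le> ereal q" by (rule hitting_time_le[OF q(1)]) (rule q(3))
        then have "\<tau> \<omega> \<le> q" unfolding fin by simp
        then show "\<tau> \<omega> < c" using q by simp
      qed
    qed
    then show ?thesis using c sp by auto
  qed
  have "countable {q\<in>\<rat>. 0 \<le> q \<and> q < c}" by (rule countable_subset[OF _ countable_rat]) auto
  then have "(\<Union>q\<in>{q\<in>\<rat>. 0 \<le> q \<and> q < c}. {\<omega>\<in>space F. X t q \<omega> \<le> a}) \<in> sets F"
  proof (rule sets.countable_UN'')
    fix q assume "q \<in> {q\<in>\<rat>. 0 \<le> q \<and> q < c}"
    then have [measurable]: "X t q \<in> borel_measurable F" by (intro F) simp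
    show "{\<omega>\<in>space F. X t q \<omega> \<le> a} \<in> sets F" by measurable
  qed
  then show "{\<omega>\<in>space F. \<tau> \<omega> < c} \<in> sets F"
    unfolding eq using infinite_hitting_time_sets by auto
qed

end

lemma tau_measurable_M [measurable]: "\<tau> \<in> borel_measurable M"
  by (rule tau_measurable) (use t in auto)

text \<open>Monotone paths are above \<open>a\<close> strictly before the hitting time and at most
  \<open>a\<close> strictly after it; the one time left open is a Lebesgue null set.\<close>

lemma alive_eq_indicator:
  assumes \<omega>: "\<omega> \<in> space M" and fin: "hitting_time a (X t) \<omega> \<noteq> \<infinity>" and s: "s \<noteq> \<tau> \<omega>"
  shows "alive t (s, \<omega>) = indicator {0..\<tau> \<omega>} s"
proof (cases "0 \<le> s")
  case True
  have "a < X t s \<omega> \<longleftrightarrow> s < \<tau> \<omega>"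
  proof
    assume "a < X t s \<omega>"
    then have "\<not> hitting_time a (X t) \<omega> < ereal s" using hitting_time_lessD[OF \<omega>, of s] by linarith
    then have "\<not> \<tau> \<omega> < s" unfolding hitting_time_eq_tau[OF fin] by simp
    then show "s < \<tau> \<omega>" using s by simp
  next
    assume "s < \<tau> \<omega>"
    then have "\<not> hitting_time a (X t) \<omega> \<le> ereal s" unfolding hitting_time_eq_tau[OF fin] by simp
    then have "\<not> X t s \<omega> \<le> a" using hitting_time_le[OF True, of "X t" \<omega> a] by blast
    then show "a < X t s \<omega>" by simp
  qed
  then show ?thesis using True s by (simp add: alive_def indicator_def)
qed (simp add: alive_def)

lemma integral_alive:
  fixes h :: "real \<Rightarrow> real"
  assumes "\<omega> \<in> space M" "hitting_time a (X t) \<omega> \<noteq> \<infinity>" and h: "h \<in> borel_measurable borel"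
  shows "(LINT s|lborel. alive t (s, \<omega>) * h s) = (LINT s|lborel. indicator {0..\<tau> \<omega>} s * h s)"
proof (rule integral_cong_AE)
  have [measurable]: "(\<lambda>s. X t (max s 0) \<omega>) \<in> borel_measurable borel"
    using measurable_compose[OF measurable_Pair2' X_joint[OF t], of \<omega>] assms(1) by simp
  have [measurable]: "(\<lambda>s. alive t (s, \<omega>)) \<in> borel_measurable lborel"
    unfolding alive_def by simp measurable
  show "(\<lambda>s. alive t (s, \<omega>) * h s) \<in> borel_measurable lborel" using h by measurable
  show "AE s in lborel. alive t (s, \<omega>) * h s = indicator {0..\<tau> \<omega>} s * h s"
    using AE_lborel_singleton[of "\<tau> \<omega>"] by eventually_elim (simp add: alive_eq_indicator[OF assms(1,2)])
qed (use h in measurable)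

text \<open>Pathwise, exp(c \<tau>) is 1 plus c times the integral of exp(c s) over [0, \<tau>], and
  \<open>integrable_alive_exp\<close> controls the latter through the survival
  probabilities.\<close>

lemma integrable_exp_tau:
  assumes c: "0 < c" shows "integrable M (\<lambda>\<omega>. exp (c * \<tau> \<omega>))"
proof -
  have int: "integrable PM (\<lambda>(s, \<omega>). alive t (s, \<omega>) * exp (c * s))"
    using integrable_alive_exp[OF t, of c] c by (simp add: case_prod_unfold)
  have "AE \<omega> in M. c * (LINT s|lborel. alive t (s, \<omega>) * exp (c * s)) + 1 = exp (c * \<tau> \<omega>)"
    using AE_hitting_time_finite AE_space
  proof eventually_elim
    case (elim \<omega>)
    have "(LINT s|lborel. alive t (s, \<omega>) * exp (c * s)) = (LINT s|lborel. exp (c * s) * indicator {0..\<tau> \<omega>} s)"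
      by (subst integral_alive[OF elim(2,1)]) (simp_all add: mult.commute)
    also have "\<dots> = exp (c * \<tau> \<omega>) / c - exp (c * 0) / c"
      by (rule integral_FTC_Icc_real[OF tau_nonneg]) (use c in \<open>auto intro!: derivative_eq_intros\<close>)
    finally show ?case using c by (simp add: right_diff_distrib)
  qed
  note AE = this
  have i: "integrable M (\<lambda>\<omega>. c * (LINT s|lborel. alive t (s, \<omega>) * exp (c * s)) + 1)"
    using LM.integrable_snd[OF int] by simp
  show ?thesis
    using integrable_cong_AE[OF borel_measurable_integrable[OF i] _ AE] i by simp
qed

lemma integrable_tau: "integrable M \<tau>"
proof (rule Bochner_Integration.integrable_bound[OF integrable_exp_tau[of 1] tau_measurable_M])
  show "AE \<omega> in M. norm (\<tau> \<omega>) \<le> norm (exp (1 * \<tau> \<omega>))"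
  proof (rule AE_I2)
    fix \<omega>
    have "\<tau> \<omega> \<le> exp (\<tau> \<omega>)" using exp_ge_add_one_self[of "\<tau> \<omega>"] by linarith
    then show "norm (\<tau> \<omega>) \<le> norm (exp (1 * \<tau> \<omega>))" using tau_nonneg[of \<omega>] by simp
  qed
qed simp

text \<open>Pathwise, the power of \<tau> is the integral of \<open>tpow n\<close> over [0, \<tau>];
  Fubini then gives the time integral of killed expectations.\<close>

lemma expectation_tpow_tau: "(LINT \<omega>|M. tpow (Suc n) (\<tau> \<omega>)) = \<Phi> n (\<lambda>_. 1) t"
proof -
  have int: "integrable PM (\<lambda>(s, \<omega>). alive t (s, \<omega>) * tpow n s)"
    using \<Phi>_prod(1)[of "\<lambda>_. 1" 1 t n] t by (simp add: case_prod_unfold)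
  have "\<Phi> n (\<lambda>_. 1) t = (LINT p|PM. (\<lambda>(s, \<omega>). alive t (s, \<omega>) * tpow n s) p)"
    using \<Phi>_prod(2)[of "\<lambda>_. 1" 1 t n] t by (simp add: case_prod_unfold)
  also have "\<dots> = (LINT \<omega>|M. LINT s|lborel. alive t (s, \<omega>) * tpow n s)"
    using LM.integral_snd[OF int] by simp
  also have "\<dots> = (LINT \<omega>|M. tpow (Suc n) (\<tau> \<omega>))"
  proof (rule integral_cong_AE)
    show "(\<lambda>\<omega>. LINT s|lborel. alive t (s, \<omega>) * tpow n s) \<in> borel_measurable M"
      using LM.integrable_snd[OF int] by simp
    show "AE \<omega> in M. (LINT s|lborel. alive t (s, \<omega>) * tpow n s) = tpow (Suc n) (\<tau> \<omega>)"
      using AE_hitting_time_finite AE_space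
    proof eventually_elim
      case (elim \<omega>)
      have "(LINT s|lborel. alive t (s, \<omega>) * tpow n s) = (LINT s|lborel. tpow n s * indicator {..\<tau> \<omega>} s)"
        by (subst integral_alive[OF elim(2,1)]) (auto simp: tpow_def indicator_def intro!: Bochner_Integration.integral_cong)
      then show ?case by (simp add: integral_tpow[OF tau_nonneg])
    qed
  qed measurable
  finally show ?thesis ..
qed

text \<open>Turns the first series into an expected exponential series in \<tau>. Exponent 0 is
  treated apart because \<Phi> begins with the first power.\<close>

lemma frac_int_pow_moment: "(frac_int p_law a ^^ n) (\<lambda>_. 1) t = (LINT \<omega>|M. tpow n (\<tau> \<omega>))"
proof (cases n)
  case 0
  have "tpow 0 (\<tau> \<omega>) = 1" for \<omega> using tau_nonneg by (simp add: tpow_def)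
  then show ?thesis using 0 by (simp add: prob_space)
next
  case (Suc m)
  then show ?thesis using frac_int_pow_one[OF t, of m] expectation_tpow_tau[of m] by simp
qed

text \<open>Since \<tau> is a function of the path of \<open>X t\<close>, its joint law with the
  path of \<open>Y\<close> is a product; Fubini then averages \<open>Y\<close> at a frozen time,
  which yields \<open>S s f x\<close>.\<close>

lemma at_time_expectation:
  fixes Y :: "real \<Rightarrow> 'w \<Rightarrow> 'c::metric_space option"
  assumes Y: "feller_process M UNIV S x Y" and indep: "indep_processes M (lift_process (X t)) Y"
    and f: "f \<in> C_inf UNIV"
  shows "integrable M (\<lambda>\<omega>. extend0 f (at_time Y (hitting_time a (X t)) \<omega>))"
    and "(LINT \<omega>|M. extend0 f (at_time Y (hitting_time a (X t)) \<omega>)) = (LINT \<omega>|M. S (\<tau> \<omega>) f x)"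
    and "(\<lambda>\<omega>. S (\<tau> \<omega>) f x) \<in> borel_measurable M"
proof -
  let ?FX = "path_sigma M (lift_process (X t)) {0..}" and ?FY = "path_sigma M Y {0..}"
  have Ym: "Y s \<in> measurable M option_borel" if "0 \<le> s" for s
    using Y that by (simp add: feller_process_def)
  have ind: "indep_set (sets ?FX) (sets ?FY)"
    using indep by (simp add: indep_processes_def)
  have fb: "extend0 f \<in> borel_measurable option_borel"
    by (rule extend0_measurable[OF C_inf_borel[OF f]]) simp
  \<comment> \<open>Joint measurability is required relative to the path \<sigma>-algebra of
    \<open>Y\<close>, since independence is a statement about that one.\<close>
  define G where "G p = extend0 f (Y (max (fst p) 0) (snd p))" for p
  have G: "G \<in> borel_measurable (borel \<Otimes>\<^sub>M ?FY)"
  proof -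
    have "(\<lambda>(s, \<omega>). extend0 f (Y (max s 0) \<omega>)) \<in> borel_measurable (borel \<Otimes>\<^sub>M ?FY)"
    proof (rule right_continuous_jointly_measurable[where f = "\<lambda>s \<omega>. extend0 f (Y s \<omega>)"])
      show "(\<lambda>\<omega>. extend0 f (Y s \<omega>)) \<in> borel_measurable ?FY" if "0 \<le> s" for s
        by (rule measurable_compose[OF path_sigma_component fb]) (use that in simp)
      fix s \<omega> assume "0 \<le> (s::real)" "\<omega> \<in> space ?FY"
      then show "((\<lambda>u. extend0 f (Y u \<omega>)) \<longlongrightarrow> extend0 f (Y s \<omega>)) (at_right s)"
        using Y by (intro cadlag_extend0[where E = UNIV] f) (auto simp: feller_process_def)
    qed
    then show ?thesis by (simp add: G_def[abs_def] case_prod_unfold)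
  qed
  obtain B where B: "0 \<le> B" "\<forall>y. \<bar>f y\<bar> \<le> B" by (rule C_inf_bounded[OF f])
  have Gb: "\<bar>G p\<bar> \<le> B" for p using B by (auto simp: G_def split: option.split)
  have FYM: "sets ?FY \<subseteq> sets M" by (rule path_sigma_subset) (simp add: Ym)
  \<comment> \<open>The identity plays the part of the path of \<open>Y\<close> as a random element:
    its law is \<open>M\<close> restricted to the path \<sigma>-algebra.\<close>
  have idm: "(\<lambda>\<omega>. \<omega>) \<in> measurable M ?FY" 
  proof (rule measurableI)
    fix A assume A: "A \<in> sets ?FY"
    have "(\<lambda>\<omega>. \<omega>) -` A \<inter> space M = A" using sets.sets_into_space[OF A] by auto
    then show "(\<lambda>\<omega>. \<omega>) -` A \<inter> space M \<in> sets M" using A FYM by auto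
  qed simp
  have \<tau>FX: "\<tau> \<in> borel_measurable ?FX"
  proof (rule tau_measurable)
    fix s :: real assume "0 \<le> s"
    then show "X t s \<in> borel_measurable ?FX"
      by (intro measurable_the_Some path_sigma_component[where X = "lift_process (X t)" and u = s]) simp
  qed simp
  have pm: "(\<lambda>\<omega>. (\<tau> \<omega>, \<omega>)) \<in> measurable M (borel \<Otimes>\<^sub>M ?FY)"
    by (rule measurable_Pair[OF tau_measurable_M idm])
  have prod: "distr M borel \<tau> \<Otimes>\<^sub>M distr M ?FY (\<lambda>\<omega>. \<omega>) = distr M (borel \<Otimes>\<^sub>M ?FY) (\<lambda>\<omega>. (\<tau> \<omega>, \<omega>))"
  proof (rule pair_measure_eqI)
    show "sigma_finite_measure (distr M borel \<tau>)"
      by (intro prob_space_imp_sigma_finite prob_space_distr tau_measurable_M)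
    show "sigma_finite_measure (distr M ?FY (\<lambda>\<omega>. \<omega>))"
      by (intro prob_space_imp_sigma_finite prob_space_distr idm)
    show "sets (distr M borel \<tau> \<Otimes>\<^sub>M distr M ?FY (\<lambda>\<omega>. \<omega>)) = sets (distr M (borel \<Otimes>\<^sub>M ?FY) (\<lambda>\<omega>. (\<tau> \<omega>, \<omega>)))"
      by (simp cong: sets_pair_measure_cong)
    fix A B assume A: "A \<in> sets (distr M borel \<tau>)" and B: "B \<in> sets (distr M ?FY (\<lambda>\<omega>. \<omega>))"
    then have A': "A \<in> sets borel" and B': "B \<in> sets ?FY" by simp_all
    have BM: "B \<inter> space M = B" using sets.sets_into_space[OF B'] by (simp add: Int_absorb2)
    have "\<tau> -` A \<inter> space M \<in> sets ?FX" using measurable_sets[OF \<tau>FX A'] by simp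
    then have "prob ((\<tau> -` A \<inter> space M) \<inter> B) = prob (\<tau> -` A \<inter> space M) * prob B"
      using ind B' unfolding indep_sets2_eq by simp
    moreover have "emeasure (distr M (borel \<Otimes>\<^sub>M ?FY) (\<lambda>\<omega>. (\<tau> \<omega>, \<omega>))) (A \<times> B) = emeasure M ((\<tau> -` A \<inter> space M) \<inter> B)"
    proof -
      have "(\<lambda>\<omega>. (\<tau> \<omega>, \<omega>)) -` (A \<times> B) \<inter> space M = (\<tau> -` A \<inter> space M) \<inter> B" using BM by auto
      then show ?thesis using A' B' by (subst emeasure_distr[OF pm]) auto
    qed
    moreover have "emeasure (distr M ?FY (\<lambda>\<omega>. \<omega>)) B = emeasure M B"
      using B' BM by (subst emeasure_distr[OF idm]) auto
    moreover have "emeasure (distr M borel \<tau>) A = emeasure M (\<tau> -` A \<inter> space M)"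
      by (rule emeasure_distr[OF tau_measurable_M A'])
    ultimately show "emeasure (distr M borel \<tau>) A * emeasure (distr M ?FY (\<lambda>\<omega>. \<omega>)) B = emeasure (distr M (borel \<Otimes>\<^sub>M ?FY) (\<lambda>\<omega>. (\<tau> \<omega>, \<omega>))) (A \<times> B)"
      by (simp add: emeasure_eq_measure ennreal_mult'')
  qed
  have G\<tau>: "(\<lambda>\<omega>. G (\<tau> \<omega>, \<omega>)) \<in> borel_measurable M" by (rule measurable_compose[OF pm G])
  have at: "extend0 f (at_time Y (hitting_time a (X t)) \<omega>) = (if hitting_time a (X t) \<omega> = \<infinity> then 0 else G (\<tau> \<omega>, \<omega>))" for \<omega>
    using tau_nonneg[of \<omega>] by (simp add: at_time_def G_def \<tau>_def[symmetric] max_absorb1)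
  have "{\<omega>\<in>space M. hitting_time a (X t) \<omega> = \<infinity>} \<in> sets M"
    by (rule infinite_hitting_time_sets) (use t in auto)
  then have m: "(\<lambda>\<omega>. extend0 f (at_time Y (hitting_time a (X t)) \<omega>)) \<in> borel_measurable M"
    unfolding at using G\<tau> by (intro measurable_If) auto
  show "integrable M (\<lambda>\<omega>. extend0 f (at_time Y (hitting_time a (X t)) \<omega>))"
  proof (rule integrable_const_bound[OF AE_I2 m])
    fix \<omega>
    show "norm (extend0 f (at_time Y (hitting_time a (X t)) \<omega>)) \<le> B"
      unfolding at using Gb[of "(\<tau> \<omega>, \<omega>)"] B(1) by simp
  qed
  interpret D1: prob_space "distr M borel \<tau>" by (rule prob_space_distr[OF tau_measurable_M])
  interpret D2: prob_space "distr M ?FY (\<lambda>\<omega>. \<omega>)" by (rule prob_space_distr[OF idm])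
  interpret D: pair_prob_space "distr M borel \<tau>" "distr M ?FY (\<lambda>\<omega>. \<omega>)" ..
  have G': "G \<in> borel_measurable (distr M borel \<tau> \<Otimes>\<^sub>M distr M ?FY (\<lambda>\<omega>. \<omega>))"
    unfolding measurable_cong_sets[OF sets_pair_measure_cong[OF sets_distr sets_distr] refl] by (rule G)
  have Gi: "integrable (distr M borel \<tau> \<Otimes>\<^sub>M distr M ?FY (\<lambda>\<omega>. \<omega>)) G"
    by (rule D.integrable_const_bound[OF _ G', of B]) (use Gb in auto)
  have inner: "(LINT \<omega>|distr M ?FY (\<lambda>\<omega>. \<omega>). G (s, \<omega>)) = S s f x" if "0 \<le> s" for s
  proof -
    have "(LINT \<omega>|distr M ?FY (\<lambda>\<omega>. \<omega>). G (s, \<omega>)) = (LINT \<omega>|M. G (s, \<omega>))"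
      by (rule integral_distr[OF idm]) (rule measurable_compose[OF measurable_Pair1' G], simp)
    also have "\<dots> = (LINT \<omega>|M. extend0 f (Y s \<omega>))" using that by (simp add: G_def)
    also have "\<dots> = S s f x"
      by (rule feller_process_expectation[OF prob_space_axioms Y _ _ f that]) auto
    finally show ?thesis .
  qed
  have Sm: "(\<lambda>s. LINT \<omega>|distr M ?FY (\<lambda>\<omega>. \<omega>). G (s, \<omega>)) \<in> borel_measurable borel"
  proof -
    have "(\<lambda>(s, \<omega>). G (s, \<omega>)) \<in> borel_measurable (borel \<Otimes>\<^sub>M distr M ?FY (\<lambda>\<omega>. \<omega>))"
      unfolding measurable_cong_sets[OF sets_pair_measure_cong[OF refl sets_distr] refl] using G by simp
    then show ?thesis by (rule D2.borel_measurable_lebesgue_integral)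
  qed
  have S\<tau>: "(\<lambda>\<omega>. S (\<tau> \<omega>) f x) = (\<lambda>\<omega>'. LINT \<omega>|distr M ?FY (\<lambda>\<omega>. \<omega>). G (\<tau> \<omega>', \<omega>))"
    by (rule ext) (simp add: inner[OF tau_nonneg])
  show "(\<lambda>\<omega>. S (\<tau> \<omega>) f x) \<in> borel_measurable M"
    unfolding S\<tau> by (rule measurable_compose[OF tau_measurable_M Sm])
  have "(LINT \<omega>|M. extend0 f (at_time Y (hitting_time a (X t)) \<omega>)) = (LINT \<omega>|M. G (\<tau> \<omega>, \<omega>))"
  proof (rule integral_cong_AE[OF m G\<tau>])
    show "AE \<omega> in M. extend0 f (at_time Y (hitting_time a (X t)) \<omega>) = G (\<tau> \<omega>, \<omega>)"
      using AE_hitting_time_finite by eventually_elim (simp add: at)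
  qed
  also have "\<dots> = (LINT p|distr M (borel \<Otimes>\<^sub>M ?FY) (\<lambda>\<omega>. (\<tau> \<omega>, \<omega>)). G p)"
    by (rule integral_distr[OF pm G, symmetric])
  also have "\<dots> = (LINT s|distr M borel \<tau>. LINT \<omega>|distr M ?FY (\<lambda>\<omega>. \<omega>). G (s, \<omega>))"
    unfolding prod[symmetric] by (rule D.integral_fst'[OF Gi, symmetric])
  also have "\<dots> = (LINT \<omega>|M. S (\<tau> \<omega>) f x)"
    unfolding S\<tau> by (rule integral_distr[OF tau_measurable_M Sm])
  finally show "(LINT \<omega>|M. extend0 f (at_time Y (hitting_time a (X t)) \<omega>)) = (LINT \<omega>|M. S (\<tau> \<omega>) f x)" .
qed

end

end

section \<open>The limits\<close>

context killed_process
begin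

interpretation LM: pair_sigma_finite lborel M ..

context
  fixes t :: real and S :: "'c::metric_space semigroup"
  assumes t: "t \<le> b" and S: "feller_semigroup UNIV S"
begin

interpretation L: contraction_semigroup "\<lambda>s. lift_op (S s)"
  by (rule contraction_semigroup_lift[OF S])

lemma ev_expo:
  assumes lam: "0 < lam" and s: "0 \<le> s"
  shows "ev (L.expo lam s f) x = (\<Sum>n. tpow n s * ev ((L.yos lam ^^ n) f) x)"
proof -
  have "ev (L.expo lam s f) x = (\<Sum>n. ev ((s ^ n / fact n) *\<^sub>R (L.yos lam ^^ n) f) x)"
    unfolding L.expo_def[OF lam] by (rule bounded_linear.suminf[OF bounded_linear_ev L.summable_expo[OF lam s]])
  then show ?thesis using s by (simp add: tpow_def)
qed

text \<open>The majorant is exponential with rate 2 lam, so \<open>integrable_exp_tau\<close> is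
  used with an exponent that grows with \<open>lam\<close>.\<close>

lemma yosida_time_series:
  assumes lam: "0 < lam"
  shows "(\<lambda>n. (yosida UNIV S lam ^^ n) (ev p) x * (frac_int p_law a ^^ n) (\<lambda>_. 1) t) sums (LINT \<omega>|M. ev (L.expo lam (\<tau> t \<omega>) p) x)"
    and "integrable M (\<lambda>\<omega>. ev (L.expo lam (\<tau> t \<omega>) p) x)"
proof -
  note [measurable] = tau_measurable_M[OF t]
  let ?h = "\<lambda>n \<omega>. tpow n (\<tau> t \<omega>) * ev ((L.yos lam ^^ n) p) x"
  have *: "(\<lambda>n. LINT \<omega>|M. ?h n \<omega>) sums (LINT \<omega>|M. (\<Sum>n. ?h n \<omega>))" "integrable M (\<lambda>\<omega>. \<Sum>n. ?h n \<omega>)"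
  proof -
    have hm: "?h n \<in> borel_measurable M" for n by measurable
    have s: "0 \<le> 2 * lam * \<tau> t \<omega>" for \<omega> using lam tau_nonneg[OF t] by simp
    have bd: "\<bar>?h n \<omega>\<bar> \<le> (2 * lam * \<tau> t \<omega>) ^ n / fact n * norm p" for n \<omega>
    proof -
      have "\<bar>?h n \<omega>\<bar> \<le> tpow n (\<tau> t \<omega>) * ((2 * lam) ^ n * norm p)"
        unfolding abs_mult abs_of_nonneg[OF tpow_nonneg]
        by (rule mult_left_mono[OF order_trans[OF abs_ev_le L.norm_yos_pow[OF lam]] tpow_nonneg])
      also have "\<dots> = (2 * lam * \<tau> t \<omega>) ^ n / fact n * norm p"
        using tau_nonneg[OF t, of \<omega>] by (simp add: tpow_def power_mult_distrib)
      finally show ?thesis .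
    qed
    have int: "integrable M (\<lambda>\<omega>. exp (2 * lam * \<tau> t \<omega>) * norm p)"
      using lam by (intro integrable_mult_left integrable_exp_tau[OF t]) simp
    show "(\<lambda>n. LINT \<omega>|M. ?h n \<omega>) sums (LINT \<omega>|M. (\<Sum>n. ?h n \<omega>))" "integrable M (\<lambda>\<omega>. \<Sum>n. ?h n \<omega>)"
      using sums_integral_exp[of ?h M "\<lambda>\<omega>. 2 * lam * \<tau> t \<omega>" "\<lambda>_. norm p", OF hm s norm_ge_zero bd int] by auto
  qed
  have eq: "(\<Sum>n. ?h n \<omega>) = ev (L.expo lam (\<tau> t \<omega>) p) x" for \<omega>
    by (rule ev_expo[OF lam tau_nonneg[OF t], symmetric])
  have eq2: "(LINT \<omega>|M. ?h n \<omega>) = (yosida UNIV S lam ^^ n) (ev p) x * (frac_int p_law a ^^ n) (\<lambda>_. 1) t" for n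
    unfolding frac_int_pow_moment[OF t] yosida_pow_eq[OF S lam] by simp
  show "(\<lambda>n. (yosida UNIV S lam ^^ n) (ev p) x * (frac_int p_law a ^^ n) (\<lambda>_. 1) t) sums (LINT \<omega>|M. ev (L.expo lam (\<tau> t \<omega>) p) x)"
    using *(1) unfolding eq eq2 .
  show "integrable M (\<lambda>\<omega>. ev (L.expo lam (\<tau> t \<omega>) p) x)"
    using *(2) unfolding eq .
qed

text \<open>In the induction step the inner function is known only pointwise in \<open>y\<close>.
  \<open>\<Phi>_curve\<close> supplies one vector \<open>G\<close> for all bounded operators: taking
  the identity shows that the inner function is \<open>ev G\<close>, and taking \<open>yos\<close>
  evaluates the Yosida operator on it.\<close>

lemma frac_int_yosida_pow:
  assumes lam: "0 < lam" and \<gamma>: "curve \<gamma>" and g: "\<And>r. ev (\<gamma> r) = (\<lambda>y. g (r, y))"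
  shows "r \<le> b \<Longrightarrow> ((\<lambda>F. act_fst (frac_int p_law a) (act_snd (yosida UNIV S lam) F)) ^^ n) (act_fst (frac_int p_law a) g) (r, x)
    = \<Phi> n (\<lambda>q. ev ((L.yos lam ^^ n) (\<gamma> q)) x) r"
proof (induction n arbitrary: r x)
  case 0
  obtain B where B: "0 \<le> B" "\<forall>r. norm (\<gamma> r) \<le> B" by (rule curve_bounded[OF \<gamma>])
  have bd: "\<forall>r. \<bar>ev (\<gamma> r) x\<bar> \<le> B" using order_trans[OF abs_ev_le B(2)[rule_format]] by simp
  have "frac_int p_law a (\<lambda>s. g (s, x)) r = \<Phi> 0 (\<lambda>q. ev (\<gamma> q) x) r"
    by (rule frac_int_eq[OF 0 curve_ev_measurable[OF \<gamma>] bd]) (simp add: g)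
  then show ?case by (simp add: act_fst_def)
next
  case (Suc n)
  let ?Y = "L.yos lam" and ?I = "frac_int p_law a"
  let ?F = "((\<lambda>F. act_fst ?I (act_snd (yosida UNIV S lam) F)) ^^ n) (act_fst ?I g)"
  have bl: "bounded_linear (?Y ^^ n)" for n by (rule L.bounded_linear_yos_pow[OF lam])
  have \<gamma>n: "curve (\<lambda>q. (?Y ^^ n) (\<gamma> q))" for n by (rule curve_compose[OF \<gamma> bl])
  obtain B where B: "0 \<le> B" "\<forall>r. norm ((?Y ^^ Suc n) (\<gamma> r)) \<le> B" by (rule curve_bounded[OF \<gamma>n])
  have bd: "\<forall>r. \<bar>ev ((?Y ^^ Suc n) (\<gamma> r)) x\<bar> \<le> B" using order_trans[OF abs_ev_le B(2)[rule_format]] by simp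
  have "?I (\<lambda>s. yosida UNIV S lam (\<lambda>y. ?F (s, y)) x) r = \<Phi> (Suc n) (\<lambda>q. ev ((?Y ^^ Suc n) (\<gamma> q)) x) r"
  proof (rule frac_int_\<Phi>[OF Suc.prems curve_ev_measurable[OF \<gamma>n] bd])
    fix s assume s: "s \<le> b"
    obtain G where G: "\<forall>L x. bounded_linear L \<longrightarrow> ev (L G) x = \<Phi> n (\<lambda>r. ev ((L ((?Y ^^ n) (\<gamma> r))) :: 'c c0) x) s"
      by (rule \<Phi>_curve[OF \<gamma>n s])
    have "(\<lambda>y. ?F (s, y)) = ev G"
    proof
      fix y show "?F (s, y) = ev G y"
        using G[rule_format, OF bounded_linear_ident, of y] Suc.IH[OF s, of y] by simp
    qed
    then have "yosida UNIV S lam (\<lambda>y. ?F (s, y)) x = ev (?Y G) x" by (simp add: yosida_eq[OF S lam])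
    also have "\<dots> = \<Phi> n (\<lambda>q. ev ((?Y ^^ Suc n) (\<gamma> q)) x) s"
      using G[rule_format, OF L.bounded_linear_yos[OF lam], of x] by simp
    finally show "yosida UNIV S lam (\<lambda>y. ?F (s, y)) x = \<Phi> n (\<lambda>q. ev ((?Y ^^ Suc n) (\<gamma> q)) x) s" .
  qed
  then show ?case by (simp add: act_fst_def act_snd_def)
qed

lemma yosida_space_time_series:
  assumes lam: "0 < lam" and \<gamma>: "curve \<gamma>" and g: "\<And>r. ev (\<gamma> r) = (\<lambda>y. g (r, y))"
  shows "(\<lambda>n. ((\<lambda>F. act_fst (frac_int p_law a) (act_snd (yosida UNIV S lam) F)) ^^ n) (act_fst (frac_int p_law a) g) (t, x))
      sums (LINT p|PM. alive t p * ev (L.expo lam (max (fst p) 0) (\<gamma> (X t (max (fst p) 0) (snd p)))) x)"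
    and "integrable PM (\<lambda>p. alive t p * ev (L.expo lam (max (fst p) 0) (\<gamma> (X t (max (fst p) 0) (snd p)))) x)"
proof -
  let ?X = "\<lambda>p :: real \<times> 'w. X t (max (fst p) 0) (snd p)"
  let ?h = "\<lambda>n p. alive t p * (tpow n (fst p) * ev ((L.yos lam ^^ n) (\<gamma> (?X p))) x)"
  obtain B where B: "0 \<le> B" "\<forall>r. norm (\<gamma> r) \<le> B" by (rule curve_bounded[OF \<gamma>])
  have \<gamma>n: "curve (\<lambda>q. (L.yos lam ^^ n) (\<gamma> q))" for n
    by (rule curve_compose[OF \<gamma> L.bounded_linear_yos_pow[OF lam]])
  have nb: "\<bar>ev ((L.yos lam ^^ n) (\<gamma> q)) x\<bar> \<le> (2 * lam) ^ n * B" for n q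
    by (rule order_trans[OF abs_ev_le order_trans[OF L.norm_yos_pow[OF lam] mult_left_mono[OF B(2)[rule_format]]]])
      (use lam in simp)
  have hm: "?h n \<in> borel_measurable PM" for n
    using \<Phi>_prod(1)[OF curve_ev_measurable[OF \<gamma>n] _ t] nb by (intro borel_measurable_integrable) blast
  \<comment> \<open>\<open>sums_integral_exp\<close> asks for nonnegative times everywhere; at
    negative ones \<open>alive\<close> is 0.\<close>
  have s: "0 \<le> 2 * lam * max (fst p) 0" for p :: "real \<times> 'w" using lam by simp
  have W: "0 \<le> alive t p * B" for p using B alive_nonneg[of t p] by simp
  have bd: "\<bar>?h n p\<bar> \<le> (2 * lam * max (fst p) 0) ^ n / fact n * (alive t p * B)" for n p
  proof (cases "0 \<le> fst p")
    case True
    have "\<bar>?h n p\<bar> = alive t p * (tpow n (fst p) * \<bar>ev ((L.yos lam ^^ n) (\<gamma> (?X p))) x\<bar>)"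
      using alive_nonneg[of t p] tpow_nonneg[of n "fst p"] by (simp add: abs_mult)
    also have "\<dots> \<le> alive t p * (tpow n (fst p) * ((2 * lam) ^ n * B))"
      by (intro mult_left_mono nb alive_nonneg tpow_nonneg)
    also have "\<dots> = (2 * lam * max (fst p) 0) ^ n / fact n * (alive t p * B)"
      using True by (simp add: tpow_def power_mult_distrib)
    finally show ?thesis .
  next
    case False
    then have "alive t p = 0" by (simp add: alive_def)
    then show ?thesis by simp
  qed
  have "integrable PM (\<lambda>p. (alive t p * exp ((2 * lam) * fst p)) * B)"
    using lam by (intro integrable_mult_left integrable_alive_exp[OF t]) simp
  moreover have "(\<lambda>p. (alive t p * exp ((2 * lam) * fst p)) * B) = (\<lambda>p. exp (2 * lam * max (fst p) 0) * (alive t p * B))"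
    by (auto simp: alive_def)
  ultimately have int: "integrable PM (\<lambda>p. exp (2 * lam * max (fst p) 0) * (alive t p * B))" by simp
  have *: "(\<lambda>n. LINT p|PM. ?h n p) sums (LINT p|PM. (\<Sum>n. ?h n p))"
    "integrable PM (\<lambda>p. \<Sum>n. ?h n p)"
    using sums_integral_exp[of ?h "PM" "\<lambda>p. 2 * lam * max (fst p) 0" "\<lambda>p. alive t p * B", OF hm s W bd int] by auto
  have eq: "(\<Sum>n. ?h n p) = alive t p * ev (L.expo lam (max (fst p) 0) (\<gamma> (?X p))) x" for p
  proof (cases "0 \<le> fst p \<and> a < X t (max (fst p) 0) (snd p)")
    case True
    then have m: "max (fst p) 0 = fst p" by simp
    have al: "alive t p = 1" unfolding alive_def using True by (rule if_P)
    show ?thesis using True by (simp add: al m ev_expo[OF lam])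
  next
    case False
    then have "alive t p = 0" by (simp add: alive_def)
    then show ?thesis by simp
  qed
  have eq2: "(LINT p|PM. ?h n p) = ((\<lambda>F. act_fst (frac_int p_law a) (act_snd (yosida UNIV S lam) F)) ^^ n) (act_fst (frac_int p_law a) g) (t, x)" for n
    unfolding frac_int_yosida_pow[OF lam \<gamma> g t]
    by (rule \<Phi>_prod(2)[OF curve_ev_measurable[OF \<gamma>n] _ t, symmetric]) (use nb in blast)
  show "(\<lambda>n. ((\<lambda>F. act_fst (frac_int p_law a) (act_snd (yosida UNIV S lam) F)) ^^ n) (act_fst (frac_int p_law a) g) (t, x))
      sums (LINT p|PM. alive t p * ev (L.expo lam (max (fst p) 0) (\<gamma> (?X p))) x)"
    using *(1) unfolding eq eq2 .
  show "integrable PM (\<lambda>p. alive t p * ev (L.expo lam (max (fst p) 0) (\<gamma> (?X p))) x)"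
    using *(2) unfolding eq .
qed

text \<open>The discretization for right-continuous processes, with the position \<open>r\<close> as
  the random element: strong continuity handles time, continuity of the curve handles
  \<open>r\<close>.\<close>

lemma semigroup_curve_measurable:
  assumes \<gamma>: "curve \<gamma>"
  shows "(\<lambda>p. ev (lift_op (S (max (fst p) 0)) (\<gamma> (snd p))) x) \<in> borel_measurable (borel \<Otimes>\<^sub>M borel)"
proof -
  have "(\<lambda>(s, r). ev (lift_op (S (max s 0)) (\<gamma> r)) x) \<in> borel_measurable (borel \<Otimes>\<^sub>M borel)"
  proof (rule right_continuous_jointly_measurable[where f = "\<lambda>s r. ev (lift_op (S s) (\<gamma> r)) x"])
    show "(\<lambda>r. ev (lift_op (S s) (\<gamma> r)) x) \<in> borel_measurable borel" if "0 \<le> s" for s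
      by (rule curve_ev_measurable[OF curve_compose[OF \<gamma> L.linS[OF that]]])
    fix s r :: real assume s: "0 \<le> s"
    have "((\<lambda>u. lift_op (S u) (\<gamma> r)) \<longlongrightarrow> lift_op (S s) (\<gamma> r)) (at s within {s<..})"
      using L.continuous_on_S[of "\<gamma> r"] s unfolding continuous_on_def
      by (auto intro: tendsto_within_subset[where S = "{0..}"])
    then show "((\<lambda>u. ev (lift_op (S u) (\<gamma> r)) x) \<longlongrightarrow> ev (lift_op (S s) (\<gamma> r)) x) (at_right s)"
      by (rule bounded_linear.tendsto[OF bounded_linear_ev])
  qed
  then show ?thesis by (simp add: case_prod_unfold)
qed

text \<open>Links the integral over time and chance to a nested one. Off the null event of infinite
  hitting times the inner domain is [0, \<tau>], which differs from the times at which the process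
  is alive by at most the single time \<tau>.\<close>

lemma occupation_integral:
  assumes \<gamma>: "curve \<gamma>" and g: "\<And>r. ev (\<gamma> r) = (\<lambda>y. g (r, y))"
  defines "E \<equiv> \<lambda>\<omega>. {s. 0 \<le> s \<and> ereal s \<le> hitting_time a (X t) \<omega>}"
  shows "AE \<omega> in M. set_integrable lborel (E \<omega>) (\<lambda>s. S s (\<lambda>y. g (X t s \<omega>, y)) x)"
    and "integrable M (\<lambda>\<omega>. LINT s:E \<omega>|lborel. S s (\<lambda>y. g (X t s \<omega>, y)) x)"
    and "(LINT \<omega>|M. (LINT s:E \<omega>|lborel. S s (\<lambda>y. g (X t s \<omega>, y)) x))
      = (LINT p|PM. alive t p * ev (lift_op (S (max (fst p) 0)) (\<gamma> (X t (max (fst p) 0) (snd p)))) x)"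
    and "integrable PM (\<lambda>p. alive t p * ev (lift_op (S (max (fst p) 0)) (\<gamma> (X t (max (fst p) 0) (snd p)))) x)"
proof -
  let ?k = "\<lambda>s r. ev (lift_op (S (max s 0)) (\<gamma> r)) x"
  let ?kX = "\<lambda>p. ?k (fst p) (X t (max (fst p) 0) (snd p))"
  obtain B where B: "0 \<le> B" "\<forall>r. norm (\<gamma> r) \<le> B" by (rule curve_bounded[OF \<gamma>])
  have kb: "\<bar>?k s r\<bar> \<le> B" for s r
    by (rule order_trans[OF abs_ev_le order_trans[OF L.normS]]) (use B in auto)
  have kXm: "?kX \<in> borel_measurable (borel \<Otimes>\<^sub>M M)"
    using measurable_compose[OF measurable_Pair[OF measurable_fst X_joint[OF t]] semigroup_curve_measurable[OF \<gamma>, of x]] by simp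
  have kXm' [measurable]: "?kX \<in> borel_measurable PM"
    using kXm by (simp add: measurable_cong_sets[OF sets_pair_measure_cong[OF sets_lborel refl] refl])
  have km: "(\<lambda>s. ?kX (s, \<omega>)) \<in> borel_measurable borel" if "\<omega> \<in> space M" for \<omega>
    by (rule measurable_compose[OF measurable_Pair2'[OF that] kXm])
  show int: "integrable PM (\<lambda>p. alive t p * ?kX p)"
  proof (rule integrable_alive[OF t, of 0 _ B])
    show "(\<lambda>p. alive t p * ?kX p) \<in> borel_measurable PM" using t by measurable
    show "\<bar>alive t p * ?kX p\<bar> \<le> alive t p * (B * exp (0 * fst p))" for p
      using mult_left_mono[OF kb[of "fst p" "X t (max (fst p) 0) (snd p)"] alive_nonneg[of t p]] alive_nonneg[of t p]
      by (simp add: abs_mult)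
  qed simp
  have S_eq: "S s (\<lambda>y. g (X t s \<omega>, y)) x = ?kX (s, \<omega>)" if "0 \<le> s" for s \<omega>
    using that ev_lift_S[OF S that, of "\<gamma> (X t s \<omega>)"] by (simp add: g)
  have E_eq: "E \<omega> = (if hitting_time a (X t) \<omega> = \<infinity> then {0..} else {0..\<tau> t \<omega>})" for \<omega>
    using hitting_time_eq_tau[OF t, of \<omega>] by (auto simp: E_def)
  have set_eq: "(\<lambda>s. indicator (E \<omega>) s *\<^sub>R S s (\<lambda>y. g (X t s \<omega>, y)) x) = (\<lambda>s. indicator (E \<omega>) s * ?kX (s, \<omega>))" for \<omega>
  proof
    fix s show "indicator (E \<omega>) s *\<^sub>R S s (\<lambda>y. g (X t s \<omega>, y)) x = indicator (E \<omega>) s * ?kX (s, \<omega>)"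
      using S_eq[of s \<omega>] by (cases "s \<in> E \<omega>") (auto simp: E_def)
  qed
  show "AE \<omega> in M. set_integrable lborel (E \<omega>) (\<lambda>s. S s (\<lambda>y. g (X t s \<omega>, y)) x)"
    using AE_hitting_time_finite[OF t] AE_space
  proof eventually_elim
    case (elim \<omega>)
    have E: "E \<omega> = {0..\<tau> t \<omega>}" using elim E_eq by simp
    show ?case unfolding set_integrable_def set_eq
    proof (rule Bochner_Integration.integrable_bound)
      show "integrable lborel (\<lambda>s. B * indicator {0..\<tau> t \<omega>} s)"
        using tau_nonneg[OF t, of \<omega>] by (intro integrable_mult_right integrable_real_indicator) auto
      show "(\<lambda>s. indicator (E \<omega>) s * ?kX (s, \<omega>)) \<in> borel_measurable lborel"
        unfolding E using km[OF elim(2)] by (intro borel_measurable_times borel_measurable_indicator) auto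
      show "AE s in lborel. norm (indicator (E \<omega>) s * ?kX (s, \<omega>)) \<le> norm (B * indicator {0..\<tau> t \<omega>} s)"
      proof (rule AE_I2)
        fix s
        show "norm (indicator (E \<omega>) s * ?kX (s, \<omega>)) \<le> norm (B * indicator {0..\<tau> t \<omega>} s)"
          unfolding E using kb[of s "X t (max s 0) \<omega>"] B(1) by (cases "s \<in> {0..\<tau> t \<omega>}") simp_all
      qed
    qed
  qed
  \<comment> \<open>Measurability has to be proved for the domain as it stands, infinite hitting
    times included: \<open>M\<close> need not be complete, so almost sure agreement would not
    transfer it.\<close>
  have Hm: "(\<lambda>\<omega>. LINT s:E \<omega>|lborel. S s (\<lambda>y. g (X t s \<omega>, y)) x) \<in> borel_measurable M"
  proof -
    have sw: "(\<lambda>q. (snd q, fst q)) \<in> measurable (M \<Otimes>\<^sub>M lborel) PM" by measurable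
    have [measurable]: "(\<lambda>q. ?kX (snd q, fst q)) \<in> borel_measurable (M \<Otimes>\<^sub>M lborel)"
      by (rule measurable_compose[OF sw kXm'])
    have inf [measurable]: "{\<omega>\<in>space M. hitting_time a (X t) \<omega> = \<infinity>} \<in> sets M"
      by (rule infinite_hitting_time_sets[OF t]) (use t in auto)
    have [measurable]: "Measurable.pred M (\<lambda>\<omega>. hitting_time a (X t) \<omega> = \<infinity>)"
      unfolding pred_def by (rule inf)
    note [measurable] = tau_measurable_M[OF t]
    have "(\<lambda>q. if 0 \<le> snd q \<and> (hitting_time a (X t) (fst q) = \<infinity> \<or> snd q \<le> \<tau> t (fst q)) then ?kX (snd q, fst q) else 0)
        \<in> borel_measurable (M \<Otimes>\<^sub>M lborel)" by measurable
    moreover have "(\<lambda>q. if 0 \<le> snd q \<and> (hitting_time a (X t) (fst q) = \<infinity> \<or> snd q \<le> \<tau> t (fst q)) then ?kX (snd q, fst q) else 0)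
        = (\<lambda>(\<omega>, s). indicator (E \<omega>) s * ?kX (s, \<omega>))"
      by (auto simp: fun_eq_iff E_eq indicator_def)
    ultimately have "(\<lambda>(\<omega>, s). indicator (E \<omega>) s * ?kX (s, \<omega>)) \<in> borel_measurable (M \<Otimes>\<^sub>M lborel)" by simp
    then have "(\<lambda>\<omega>. LINT s|lborel. indicator (E \<omega>) s * ?kX (s, \<omega>)) \<in> borel_measurable M"
      by (rule lborel.borel_measurable_lebesgue_integral)
    then show ?thesis by (simp only: set_lebesgue_integral_def set_eq)
  qed
  have int': "integrable PM (\<lambda>(s, \<omega>). alive t (s, \<omega>) * ?kX (s, \<omega>))"
    using int by (simp add: case_prod_unfold)
  have AE: "AE \<omega> in M. (LINT s|lborel. alive t (s, \<omega>) * ?kX (s, \<omega>)) = (LINT s:E \<omega>|lborel. S s (\<lambda>y. g (X t s \<omega>, y)) x)"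
    using AE_hitting_time_finite[OF t] AE_space
  proof eventually_elim
    case (elim \<omega>)
    show ?case
      unfolding set_lebesgue_integral_def set_eq
      using integral_alive[OF t elim(2,1) km[OF elim(2)]] elim(1) by (simp add: E_eq)
  qed
  note i = LM.integrable_snd[OF int']
  show "integrable M (\<lambda>\<omega>. LINT s:E \<omega>|lborel. S s (\<lambda>y. g (X t s \<omega>, y)) x)"
    using integrable_cong_AE[OF borel_measurable_integrable[OF i] Hm AE] i by simp
  show "(LINT \<omega>|M. (LINT s:E \<omega>|lborel. S s (\<lambda>y. g (X t s \<omega>, y)) x)) = (LINT p|PM. alive t p * ?kX p)"
    using integral_cong_AE[OF borel_measurable_integrable[OF i] Hm AE] LM.integral_snd[OF int']
    by (simp add: case_prod_unfold)
qed

text \<open>The error d (1 + s) is integrated at s = \<tau>, whose mean is finite. It bounds the sup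
  norm over \<open>x\<close> path by path, hence the uniformity.\<close>

lemma yosida_time_limit:
  fixes p :: "'c c0"
  assumes Y: "\<And>x. feller_process M UNIV S x (Y x)" and indep: "\<And>x. indep_processes M (lift_process (X t)) (Y x)"
  shows "uniform_limit UNIV (\<lambda>lam x. LINT \<omega>|M. ev (L.expo lam (\<tau> t \<omega>) p) x)
      (\<lambda>x. LINT \<omega>|M. extend0 (ev p) (at_time (Y x) (hitting_time a (X t)) \<omega>)) at_top"
proof (rule uniform_limitI)
  fix e :: real assume e: "0 < e"
  define m where "m = (LINT \<omega>|M. 1 + \<tau> t \<omega>)"
  have m: "0 \<le> m" unfolding m_def by (rule integral_nonneg_AE) (use tau_nonneg[OF t] in \<open>auto simp: add_nonneg_nonneg\<close>)
  have int1: "integrable M (\<lambda>\<omega>. 1 + \<tau> t \<omega>)" using integrable_tau[OF t] by simp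
  \<comment> \<open>The added 1 makes d m < e strict and lets \<open>0 \<le> m\<close>
    suffice.\<close>
  define d where "d = e / (m + 1)"
  have d: "0 < d" "d * m < e" using m e by (auto simp: d_def field_simps add_nonneg_pos)
  show "\<forall>\<^sub>F lam in at_top. \<forall>x\<in>UNIV. dist (LINT \<omega>|M. ev (L.expo lam (\<tau> t \<omega>) p) x)
      (LINT \<omega>|M. extend0 (ev p) (at_time (Y x) (hitting_time a (X t)) \<omega>)) < e"
    using L.expo_tendsto_uniform[OF compact_sing[of p] d(1)] eventually_gt_at_top[of 0]
  proof eventually_elim
    case (elim lam)
    have close: "norm (L.expo lam s p - lift_op (S s) p) \<le> d * (1 + s)" if "0 \<le> s" for s
      using elim(1) that by simp
    show ?case
    proof
      fix x
      have Sb: "\<bar>S (\<tau> t \<omega>) (ev p) x\<bar> \<le> norm p" for \<omega>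
        using order_trans[OF abs_ev_le L.normS[OF tau_nonneg[OF t], of \<omega> p], of x]
        by (simp add: ev_lift_S[OF S tau_nonneg[OF t]])
      have i2: "integrable M (\<lambda>\<omega>. S (\<tau> t \<omega>) (ev p) x)"
        by (rule integrable_const_bound[OF _ at_time_expectation(3)[OF t Y[of x] indep[of x] ev_C_inf[of p]], where B = "norm p"]) (use Sb in auto)
      note i1 = yosida_time_series(2)[OF elim(2), where p = p and x = x]
      have "dist (LINT \<omega>|M. ev (L.expo lam (\<tau> t \<omega>) p) x) (LINT \<omega>|M. S (\<tau> t \<omega>) (ev p) x)
          = \<bar>LINT \<omega>|M. ev (L.expo lam (\<tau> t \<omega>) p) x - S (\<tau> t \<omega>) (ev p) x\<bar>"
        using i1 i2 by (simp add: dist_real_def)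
      also have "\<dots> \<le> (LINT \<omega>|M. \<bar>ev (L.expo lam (\<tau> t \<omega>) p) x - S (\<tau> t \<omega>) (ev p) x\<bar>)"
        by (rule integral_abs_bound)
      also have "\<dots> \<le> (LINT \<omega>|M. d * (1 + \<tau> t \<omega>))"
      proof (rule integral_mono)
        show "integrable M (\<lambda>\<omega>. \<bar>ev (L.expo lam (\<tau> t \<omega>) p) x - S (\<tau> t \<omega>) (ev p) x\<bar>)"
          using i1 i2 by (intro integrable_abs Bochner_Integration.integrable_diff)
        show "integrable M (\<lambda>\<omega>. d * (1 + \<tau> t \<omega>))" using int1 by (rule integrable_mult_right)
        fix \<omega>
        show "\<bar>ev (L.expo lam (\<tau> t \<omega>) p) x - S (\<tau> t \<omega>) (ev p) x\<bar> \<le> d * (1 + \<tau> t \<omega>)"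
          using order_trans[OF abs_ev_le close[OF tau_nonneg[OF t], of \<omega>], of x]
          by (simp add: ev_lift_S[OF S tau_nonneg[OF t]])
      qed
      also have "\<dots> = d * m" unfolding m_def by (rule integral_mult_right_zero)
      finally show "dist (LINT \<omega>|M. ev (L.expo lam (\<tau> t \<omega>) p) x)
          (LINT \<omega>|M. extend0 (ev p) (at_time (Y x) (hitting_time a (X t)) \<omega>)) < e"
        using d(2) at_time_expectation(2)[OF t Y[of x] indep[of x] ev_C_inf[of p]] by simp
    qed
  qed
qed

text \<open>The curve is evaluated at random positions, so the estimate must hold for all of them at
  once: while alive the process stays in [a, b], whose image under the curve is compact.\<close>

lemma yosida_space_time_limit:
  assumes \<gamma>: "curve \<gamma>" and g: "\<And>r. ev (\<gamma> r) = (\<lambda>y. g (r, y))"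
  shows "uniform_limit UNIV
      (\<lambda>lam x. LINT p|PM. alive t p * ev (L.expo lam (max (fst p) 0) (\<gamma> (X t (max (fst p) 0) (snd p)))) x)
      (\<lambda>x. LINT \<omega>|M. (LINT s:{s. 0 \<le> s \<and> ereal s \<le> hitting_time a (X t) \<omega>}|lborel. S s (\<lambda>y. g (X t s \<omega>, y)) x)) at_top"
proof (rule uniform_limitI)
  fix e :: real assume e: "0 < e"
  let ?X = "\<lambda>p :: real \<times> 'w. X t (max (fst p) 0) (snd p)"
  define m where "m = (LINT p|PM. alive t p * (1 + max (fst p) 0))"
  have m: "0 \<le> m" unfolding m_def by (rule integral_nonneg_AE) (auto intro!: always_eventually mult_nonneg_nonneg alive_nonneg)
  have int1: "integrable PM (\<lambda>p. alive t p * (1 + max (fst p) 0))"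
  proof (rule integrable_alive[OF t, of 1 _ 1])
    show "(\<lambda>p. alive t p * (1 + max (fst p) 0)) \<in> borel_measurable PM" using t by measurable
    fix p :: "real \<times> 'w"
    show "\<bar>alive t p * (1 + max (fst p) 0)\<bar> \<le> alive t p * (1 * exp (1 * fst p))"
      using exp_ge_add_one_self[of "fst p"] by (auto simp: alive_def)
  qed simp
  define d where "d = e / (m + 1)"
  have d: "0 < d" "d * m < e" using m e by (auto simp: d_def field_simps add_nonneg_pos)
  have K: "compact (\<gamma> ` {a..b})"
    using \<gamma> by (intro compact_continuous_image) (auto simp: curve_def)
  show "\<forall>\<^sub>F lam in at_top. \<forall>x\<in>UNIV. dist (LINT p|PM. alive t p * ev (L.expo lam (max (fst p) 0) (\<gamma> (?X p))) x)
      (LINT \<omega>|M. (LINT s:{s. 0 \<le> s \<and> ereal s \<le> hitting_time a (X t) \<omega>}|lborel. S s (\<lambda>y. g (X t s \<omega>, y)) x)) < e"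
    using L.expo_tendsto_uniform[OF K d(1)] eventually_gt_at_top[of 0]
  proof eventually_elim
    case (elim lam)
    show ?case
    proof
      fix x
      note i1 = yosida_space_time_series(2)[OF elim(2) \<gamma> g, where x = x] and i2 = occupation_integral(4)[OF \<gamma> g, where x = x]
      let ?u = "\<lambda>p :: real \<times> 'w. ev (L.expo lam (max (fst p) 0) (\<gamma> (?X p))) x" and ?v = "\<lambda>p :: real \<times> 'w. ev (lift_op (S (max (fst p) 0)) (\<gamma> (?X p))) x"
      have "dist (LINT p|PM. alive t p * ?u p) (LINT p|PM. alive t p * ?v p)
          = \<bar>LINT p|PM. alive t p * ?u p - alive t p * ?v p\<bar>"
        using i1 i2 by (simp add: dist_real_def)
      also have "\<dots> \<le> (LINT p|PM. \<bar>alive t p * ?u p - alive t p * ?v p\<bar>)"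
        by (rule integral_abs_bound)
      also have "\<dots> \<le> (LINT p|PM. d * (alive t p * (1 + max (fst p) 0)))"
      proof (rule integral_mono)
        show "integrable PM (\<lambda>p. \<bar>alive t p * ?u p - alive t p * ?v p\<bar>)"
          using i1 i2 by (intro integrable_abs Bochner_Integration.integrable_diff)
        show "integrable PM (\<lambda>p. d * (alive t p * (1 + max (fst p) 0)))" using int1 by (rule integrable_mult_right)
        fix p :: "real \<times> 'w" assume "p \<in> space PM"
        then have \<omega>: "snd p \<in> space M" by (auto simp: space_pair_measure)
        show "\<bar>alive t p * ?u p - alive t p * ?v p\<bar> \<le> d * (alive t p * (1 + max (fst p) 0))"
        proof (cases "alive t p = 0")
          case False
          then have al: "alive t p = 1" and "a < ?X p" by (auto simp: alive_def split: if_splits)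
          then have "?X p \<in> {a..b}" using X_le_b[OF t _ \<omega>, of "max (fst p) 0"] by simp
          then have "norm (L.expo lam (max (fst p) 0) (\<gamma> (?X p)) - lift_op (S (max (fst p) 0)) (\<gamma> (?X p))) \<le> d * (1 + max (fst p) 0)"
            using elim(1) by simp
          from order_trans[OF abs_ev_le this, of x] show ?thesis by (simp add: al)
        qed simp
      qed
      also have "\<dots> = d * m" unfolding m_def by (rule integral_mult_right_zero)
      finally show "dist (LINT p|PM. alive t p * ?u p)
          (LINT \<omega>|M. (LINT s:{s. 0 \<le> s \<and> ereal s \<le> hitting_time a (X t) \<omega>}|lborel. S s (\<lambda>y. g (X t s \<omega>, y)) x)) < e"
        using d(2) occupation_integral(3)[OF \<gamma> g, where x = x] by simp
    qed
  qed
qed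

end

end

text \<open>Markov's inequality for the Lyapunov function: exp(\<mu> a) P(X_s > a) <= E u(X_s) = T_s
  u (t) <= exp(- K s) exp(\<mu> b). Bounding the starting point by \<open>b\<close> makes the
  constant uniform in \<open>t\<close>.\<close>

lemma survival_probability_bound:
  fixes X :: "real \<Rightarrow> real \<Rightarrow> 'w \<Rightarrow> real"
  assumes M: "prob_space M" and T_feller: "feller_semigroup {..b} T"
    and T_gen: "generates_with_core {..b} (minus_D b \<nu>) (D_core b \<nu>) T"
    and X: "\<And>t. t \<le> b \<Longrightarrow> feller_process M {..b} T t (lift_process (X t))"
    and nn: "\<And>t r. 0 < r \<Longrightarrow> 0 \<le> \<nu> t r" and H0: "H0 \<nu>" and H1b: "H1b \<nu>" and K: "0 < K"
  shows "\<exists>C\<ge>0. \<forall>t\<le>b. \<forall>s\<ge>0. measure M {\<omega>\<in>space M. a < X t s \<omega>} \<le> C * exp (- (K * s))"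
proof -
  interpret prob_space M by (rule M)
  obtain \<mu> where \<mu>: "0 < \<mu>" "(\<lambda>t. if t \<le> b then exp (\<mu> * t) else 0) \<in> D_core b \<nu>"
    "\<forall>t\<le>b. minus_D b \<nu> (\<lambda>t. if t \<le> b then exp (\<mu> * t) else 0) t \<le> - K * exp (\<mu> * t)"
    by (rule ex_lyapunov[OF nn H0 H1b K])
  define u where "u = (\<lambda>t. if t \<le> b then exp (\<mu> * t) else 0)"
  have gr: "(u, minus_D b \<nu> u) \<in> generator_graph {..b} T"
    using T_gen \<mu>(2) by (simp add: generates_with_core_def u_def)
  have uC: "u \<in> C_inf {..b}" using gr by (simp add: generator_graph_def)
  have ub: "u \<in> borel_measurable borel" by (rule C_inf_borel[OF uC]) simp
  have "measure M {\<omega>\<in>space M. a < X t s \<omega>} \<le> exp (\<mu> * (b - a)) * exp (- (K * s))" if t: "t \<le> b" and s: "0 \<le> s" for t s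
  proof -
    have Xm [measurable]: "X t s \<in> borel_measurable M"
      by (rule measurable_the_Some) (use X[OF t] s in \<open>simp add: feller_process_def\<close>)
    have Xb: "X t s \<omega> \<le> b" if "\<omega> \<in> space M" for \<omega>
      using X[OF t] s that unfolding feller_process_def by auto
    have uX: "u (X t s \<omega>) = exp (\<mu> * X t s \<omega>)" if "\<omega> \<in> space M" for \<omega> using Xb[OF that] by (simp add: u_def)
    have "T s u t \<le> exp (- (K * s)) * u t"
    proof (rule semigroup_exp_decay[OF T_feller _ gr])
      show "T s f t \<le> c" if "0 \<le> s" "f \<in> C_inf {..b}" "0 \<le> c" "\<And>y. y \<in> {..b} \<Longrightarrow> f y \<le> c" for s f c
        by (rule feller_process_upper[OF M X[OF t] _ _ that(2,1,3,4)]) (use t in auto)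
      show "minus_D b \<nu> u y \<le> - K * u y" if "y \<in> {..b}" for y using \<mu>(3) that by (simp add: u_def)
    qed (use K s t in \<open>auto simp: u_def\<close>)
    moreover have "(LINT \<omega>|M. u (X t s \<omega>)) = T s u t"
      using feller_process_expectation[OF M X[OF t] _ _ uC s] t by simp
    moreover have "u t \<le> exp (\<mu> * b)" using t \<mu>(1) by (simp add: u_def)
    ultimately have E: "(LINT \<omega>|M. u (X t s \<omega>)) \<le> exp (- (K * s)) * exp (\<mu> * b)"
      by (smt (verit) exp_ge_zero mult_left_mono)
    have "exp (\<mu> * a) * measure M {\<omega>\<in>space M. a < X t s \<omega>} = (LINT \<omega>|M. exp (\<mu> * a) * indicator {\<omega>\<in>space M. a < X t s \<omega>} \<omega>)"
      by simp
    also have "\<dots> \<le> (LINT \<omega>|M. u (X t s \<omega>))"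
    proof (rule integral_mono)
      obtain B where B: "0 \<le> B" "\<forall>x. \<bar>u x\<bar> \<le> B" by (rule C_inf_bounded[OF uC])
      show "integrable M (\<lambda>\<omega>. u (X t s \<omega>))"
        by (rule integrable_const_bound[OF _ measurable_compose[OF Xm ub], where B = B]) (use B in auto)
      show "integrable M (\<lambda>\<omega>. exp (\<mu> * a) * indicator {\<omega>\<in>space M. a < X t s \<omega>} \<omega>)"
        by (intro integrable_mult_right integrable_real_indicator) (auto simp: emeasure_eq_measure)
      fix \<omega> assume \<omega>: "\<omega> \<in> space M"
      show "exp (\<mu> * a) * indicator {\<omega>\<in>space M. a < X t s \<omega>} \<omega> \<le> u (X t s \<omega>)"
        using uX[OF \<omega>] \<mu>(1) by (auto simp: indicator_def)
    qed
    finally have "exp (\<mu> * a) * measure M {\<omega>\<in>space M. a < X t s \<omega>} \<le> exp (- (K * s)) * exp (\<mu> * b)"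
      using E by simp
    then have "measure M {\<omega>\<in>space M. a < X t s \<omega>} \<le> (exp (- (K * s)) * exp (\<mu> * b)) / exp (\<mu> * a)"
      by (simp add: pos_le_divide_eq mult.commute)
    then show ?thesis by (simp add: exp_diff right_diff_distrib mult.commute)
  qed
  then show ?thesis by (intro exI[of _ "exp (\<mu> * (b - a))"]) auto
qed

theorem theorem4p27:
  fixes a b t :: real
    and \<nu> :: "real \<Rightarrow> real \<Rightarrow> real"
    and T :: "real semigroup"
    and S :: "(real ^ 'd) semigroup"
    and M :: "'w measure"
    and X :: "real \<Rightarrow> real \<Rightarrow> 'w \<Rightarrow> real"
    and Y :: "real ^ 'd \<Rightarrow> real \<Rightarrow> 'w \<Rightarrow> (real ^ 'd) option"
    and g :: "real \<times> (real ^ 'd) \<Rightarrow> real"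
    and \<phi> :: "real ^ 'd \<Rightarrow> real"
  assumes ab: "a < b"
    and nu_nonneg: "\<And>t r. r > 0 \<Longrightarrow> \<nu> t r \<ge> 0"
    and H0: "H0 \<nu>"
    and H1b: "H1b \<nu>"
    and T_feller: "feller_semigroup {..b} T"
    and T_gen: "generates_with_core {..b} (minus_D b \<nu>) (D_core b \<nu>) T"
    and S_feller: "feller_semigroup UNIV S"
    and smooth_dom: "C_inf_smooth \<subseteq> gen_dom UNIV S"
    and M: "prob_space M"
    and X_process: "\<And>t. t \<le> b \<Longrightarrow> feller_process M {..b} T t (lift_process (X t))"
    and X_nonincreasing:
      "\<And>t s u \<omega>. t \<le> b \<Longrightarrow> 0 \<le> s \<Longrightarrow> s \<le> u \<Longrightarrow> \<omega> \<in> space M \<Longrightarrow> X t u \<omega> \<le> X t s \<omega>"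
    and Y_process: "\<And>x. feller_process M UNIV S x (Y x)"
    and XY_indep: "\<And>t x. t \<le> b \<Longrightarrow> indep_processes M (lift_process (X t)) (Y x)"
    and H2_X: "\<And>t s. t \<in> {a..b} \<Longrightarrow> s > 0 \<Longrightarrow> absolutely_continuous lborel (distr M borel (X t s))"
    and H2_Y: "\<And>x s. s > 0 \<Longrightarrow> absolutely_continuous lborel (state_law M (Y x) s)"
    and g: "g \<in> C_inf ({a..b} \<times> UNIV)"
    and \<phi>: "\<phi> \<in> gen_dom UNIV S"
    and t: "t \<in> {a..b}"
  shows
    "let I = frac_int (\<lambda>s t. distr M borel (X t s)) a;
         A = yosida UNIV S;
         IA = (\<lambda>lam F. act_fst I (act_snd (A lam) F));
         \<tau> = hitting_time a (X t)
     in
       (\<forall>lam>0. \<forall>x. summable (\<lambda>n. (A lam ^^ n) \<phi> x * (I ^^ n) (\<lambda>_. 1) t)) \<and>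
       (\<forall>x. integrable M (\<lambda>\<omega>. extend0 \<phi> (at_time (Y x) \<tau> \<omega>))) \<and>
       uniform_limit UNIV
         (\<lambda>lam x. \<Sum>n. (A lam ^^ n) \<phi> x * (I ^^ n) (\<lambda>_. 1) t)
         (\<lambda>x. LINT \<omega>|M. extend0 \<phi> (at_time (Y x) \<tau> \<omega>))
         at_top \<and>
       (\<forall>lam>0. \<forall>x. summable (\<lambda>n. (IA lam ^^ n) (act_fst I g) (t, x))) \<and>
       (\<forall>x. AE \<omega> in M. set_integrable lborel {s. 0 \<le> s \<and> ereal s \<le> \<tau> \<omega>}
          (\<lambda>s. S s (\<lambda>y. g (X t s \<omega>, y)) x)) \<and>
       (\<forall>x. integrable M (\<lambda>\<omega>. LINT s:{s. 0 \<le> s \<and> ereal s \<le> \<tau> \<omega>}|lborel.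
          S s (\<lambda>y. g (X t s \<omega>, y)) x)) \<and>
       uniform_limit UNIV
         (\<lambda>lam x. \<Sum>n. (IA lam ^^ n) (act_fst I g) (t, x))
         (\<lambda>x. LINT \<omega>|M. (LINT s:{s. 0 \<le> s \<and> ereal s \<le> \<tau> \<omega>}|lborel.
            S s (\<lambda>y. g (X t s \<omega>, y)) x))
         at_top"
proof -
  let ?I = "frac_int (\<lambda>s t. distr M borel (X t s)) a"
  interpret prob_space M by (rule M)
  have tail: "\<exists>C\<ge>0. \<forall>t\<le>b. \<forall>s\<ge>0. prob {\<omega>\<in>space M. a < X t s \<omega>} \<le> C * exp (- (K * s))" if K: "0 < K" for K
    by (rule survival_probability_bound[OF M T_feller T_gen X_process nu_nonneg H0 H1b K])
  interpret killed_process M a b T X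
    by unfold_locales (use ab T_feller X_process X_nonincreasing tail in auto)
  have tb: "t \<le> b" using t by simp
  obtain p h where p: "\<phi> = ev p" using \<phi> gen_dom_iff[OF S_feller] by metis
  define \<gamma> where "\<gamma> r = c0_of (\<lambda>y. g (r, y))" for r
  have ev\<gamma>: "ev (\<gamma> r) = (\<lambda>y. g (r, y))" for r
    unfolding \<gamma>_def by (rule ev_c0_of[OF C_inf_section[OF g]])
  have \<gamma>: "curve \<gamma>"
    unfolding curve_def
  proof (intro conjI allI impI)
    show "continuous_on {a..b} \<gamma>" unfolding \<gamma>_def by (rule continuous_on_section[OF g])
    fix r assume "r \<notin> {a..b}"
    then have "g (r, y) = 0" for y by (intro C_inf_outside[OF g]) auto
    then show "\<gamma> r = 0" by (intro ev_eqI) (simp add: ev\<gamma>)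
  qed
  have indep: "indep_processes M (lift_process (X t)) (Y x)" for x by (rule XY_indep[OF tb])
  note series1 = yosida_time_series(1)[OF tb S_feller, where p = p, folded p]
    and series2 = yosida_space_time_series(1)[OF tb S_feller _ \<gamma> ev\<gamma>]
  show ?thesis
    unfolding Let_def
  proof (intro conjI allI impI)
    show "summable (\<lambda>n. (yosida UNIV S lam ^^ n) \<phi> x * (?I ^^ n) (\<lambda>_. 1) t)" if "0 < lam" for lam x
      by (rule sums_summable[OF series1[OF that]])
    show "integrable M (\<lambda>\<omega>. extend0 \<phi> (at_time (Y x) (hitting_time a (X t)) \<omega>))" for x
      unfolding p by (rule at_time_expectation(1)[OF tb Y_process indep ev_C_inf])
    show "uniform_limit UNIV (\<lambda>lam x. \<Sum>n. (yosida UNIV S lam ^^ n) \<phi> x * (?I ^^ n) (\<lambda>_. 1) t)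
        (\<lambda>x. LINT \<omega>|M. extend0 \<phi> (at_time (Y x) (hitting_time a (X t)) \<omega>)) at_top"
      \<comment> \<open>The series is identified with the expectation for positive
        \<open>lam\<close>, which suffices along \<open>at_top\<close>.\<close>
      using yosida_time_limit[OF tb S_feller Y_process indep, where p = p, folded p]
      by (rule uniform_limit_cong[THEN iffD1, rotated 2])
        (rule eventually_mono[OF eventually_gt_at_top[of 0]], simp_all add: sums_unique[OF series1])
    show "summable (\<lambda>n. ((\<lambda>F. act_fst ?I (act_snd (yosida UNIV S lam) F)) ^^ n) (act_fst ?I g) (t, x))" if "0 < lam" for lam x
      by (rule sums_summable[OF series2[OF that]])
    show "AE \<omega> in M. set_integrable lborel {s. 0 \<le> s \<and> ereal s \<le> hitting_time a (X t) \<omega>} (\<lambda>s. S s (\<lambda>y. g (X t s \<omega>, y)) x)" for x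
      by (rule occupation_integral(1)[OF tb S_feller \<gamma> ev\<gamma>])
    show "integrable M (\<lambda>\<omega>. LINT s:{s. 0 \<le> s \<and> ereal s \<le> hitting_time a (X t) \<omega>}|lborel. S s (\<lambda>y. g (X t s \<omega>, y)) x)" for x
      by (rule occupation_integral(2)[OF tb S_feller \<gamma> ev\<gamma>])
    show "uniform_limit UNIV (\<lambda>lam x. \<Sum>n. ((\<lambda>F. act_fst ?I (act_snd (yosida UNIV S lam) F)) ^^ n) (act_fst ?I g) (t, x))
        (\<lambda>x. LINT \<omega>|M. (LINT s:{s. 0 \<le> s \<and> ereal s \<le> hitting_time a (X t) \<omega>}|lborel. S s (\<lambda>y. g (X t s \<omega>, y)) x)) at_top"
      using yosida_space_time_limit[OF tb S_feller \<gamma> ev\<gamma>]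
      by (rule uniform_limit_cong[THEN iffD1, rotated 2])
        (rule eventually_mono[OF eventually_gt_at_top[of 0]], simp_all add: sums_unique[OF series2])
  qed
qed

end
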